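(* Let $A$ be a ring, $I$ a (two-sided) ideal of $A$, and $B:=A/I$ the quotient ring. If there is a (finite) projective resolution $P=(0\to P_n\to\cdots\to P_1\to P_0)$ of $B$ by $A$-modules satisfying $\mathrm{Hom}_A(P_j,V)=0$ for all $B$-modules $V$ and all $j>0$, then the pair $(\mathcal{G}_1,\mathcal{G}_2)=(\mathrm{Mod}\,A,\mathrm{Mod}\,B)$ satisfies condition (R): for all $V,W\in\mathsf{D}\mathcal{G}_2$ the complexes $\mathrm{RHom}_{\mathcal{G}_1}(V,W)$ and $\mathrm{RHom}_{\mathcal{G}_2}(V,W)$ are canonically isomorphic in $\mathsf{D}\mathbb{Z}$.
   Context: $\mathrm{Mod}\,A$ is the category of left $A$-modules; $\mathrm{Mod}\,B$ is identified with the full subcategory of $\mathrm{Mod}\,A$ of modules annihilated by $I$. For an abelian category $\mathcal{G}$, $\mathsf{D}\mathcal{G}$ is the (unbounded) derived category, and $\mathsf{D}\mathbb{Z}$ is the derived category of abelian groups. For a Grothendieck category $\mathcal{G}$, $\mathrm{RHom}_{\mathcal{G}}$ is defined on all of $\mathsf{D}\mathcal{G}^{op}\times \mathsf{D}\mathcal{G}$ (using K-injective resolutions in the second variable). Objects of $\mathsf{D}\mathcal{G}_2$ are viewed in $\mathsf{D}\mathcal{G}_1$ through the exact inclusion $\iota:\mathcal{G}_2\hookrightarrow\mathcal{G}_1$. "Canonically isomorphic" refers to the natural morphism $\mathrm{RHom}_{\mathcal{G}_2}(V,W)\to\mathrm{RHom}_{\mathcal{G}_1}(V,W)$ induced by $\iota$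 being an isomorphism. *)

theory Defs
  imports "HOL-Algebra.QuotRing" "HOL-Algebra.IntRing" "HOL-Algebra.Module"
begin

text \<open>
  Universe convention: \<open>Mod R\<close> is the category of left \<open>R\<close>-modules whose carrier is a subset of a
  type \<open>'u\<close>, and notions that quantify over all modules or all complexes (projective, K-injective)
  quantify over those in \<open>'u\<close>.  The type \<open>'u\<close> is arbitrary, so it can be taken as large as needed;
  K-injective resolutions exist in it as soon as \<open>|'u|\<close> is unchanged by exponentiation with the
  larger of \<open>|R|\<close> and the countable cardinal.
\<close>


section \<open>Left modules over a ring that need not be commutative\<close>

text \<open>The library locale \<open>module\<close> requires a commutative ring; only its record type is reused.\<close>

locale left_module = R?: ring R + M?: abelian_group M
  for R :: "('r, 'c) ring_scheme" (structure) and M :: "('r, 'm) module" (structure) +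
  assumes lm_smult_closed:
      "\<lbrakk>a \<in> carrier R; x \<in> carrier M\<rbrakk> \<Longrightarrow> a \<odot>\<^bsub>M\<^esub> x \<in> carrier M"
    and lm_smult_l_distr:
      "\<lbrakk>a \<in> carrier R; b \<in> carrier R; x \<in> carrier M\<rbrakk> \<Longrightarrow>
       (a \<oplus>\<^bsub>R\<^esub> b) \<odot>\<^bsub>M\<^esub> x = a \<odot>\<^bsub>M\<^esub> x \<oplus>\<^bsub>M\<^esub> b \<odot>\<^bsub>M\<^esub> x"
    and lm_smult_r_distr:
      "\<lbrakk>a \<in> carrier R; x \<in> carrier M; y \<in> carrier M\<rbrakk> \<Longrightarrow>
       a \<odot>\<^bsub>M\<^esub> (x \<oplus>\<^bsub>M\<^esub> y) = a \<odot>\<^bsub>M\<^esub> x \<oplus>\<^bsub>M\<^esub> a \<odot>\<^bsub>M\<^esub> y"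
    and lm_smult_assoc:
      "\<lbrakk>a \<in> carrier R; b \<in> carrier R; x \<in> carrier M\<rbrakk> \<Longrightarrow>
       (a \<otimes>\<^bsub>R\<^esub> b) \<odot>\<^bsub>M\<^esub> x = a \<odot>\<^bsub>M\<^esub> (b \<odot>\<^bsub>M\<^esub> x)"
    and lm_smult_one:
      "x \<in> carrier M \<Longrightarrow> \<one>\<^bsub>R\<^esub> \<odot>\<^bsub>M\<^esub> x = x"

text \<open>Homomorphisms are extensional functions, so that equal morphisms are equal as functions.\<close>

definition lhom ::
  "('r, 'c) ring_scheme \<Rightarrow> ('r, 'm) module \<Rightarrow> ('r, 'n) module \<Rightarrow> ('m \<Rightarrow> 'n) set" where
  "lhom R M N = {f \<in> carrier M \<rightarrow>\<^sub>E carrier N.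
     (\<forall>x\<in>carrier M. \<forall>y\<in>carrier M. f (x \<oplus>\<^bsub>M\<^esub> y) = f x \<oplus>\<^bsub>N\<^esub> f y) \<and>
     (\<forall>a\<in>carrier R. \<forall>x\<in>carrier M. f (a \<odot>\<^bsub>M\<^esub> x) = a \<odot>\<^bsub>N\<^esub> f x)}"

definition projective_module :: "('r, 'c) ring_scheme \<Rightarrow> ('r, 'u) module \<Rightarrow> bool" where
  "projective_module R P \<longleftrightarrow> left_module R P \<and>
     (\<forall>(M :: ('r, 'u) module) (N :: ('r, 'u) module) g f.
        left_module R M \<and> left_module R N \<and>
        g \<in> lhom R M N \<and> g ` carrier M = carrier N \<and> f \<in> lhom R P N \<longrightarrow>
        (\<exists>f' \<in> lhom R P M. \<forall>x\<in>carrier P. g (f' x) = f x))"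

definition regular_module :: "('r, 'c) ring_scheme \<Rightarrow> ('r, 'r) module" where
  "regular_module R =
     \<lparr>carrier = carrier R, monoid.mult = monoid.mult R, one = one R, zero = zero R, add = add R, smult = monoid.mult R\<rparr>"

definition restrict_scalars :: "('a \<Rightarrow> 'b) \<Rightarrow> ('b, 'm) module \<Rightarrow> ('a, 'm) module" where
  "restrict_scalars h M =
     \<lparr>carrier = carrier M, monoid.mult = monoid.mult M, one = one M, zero = zero M, add = add M,
      smult = (\<lambda>a x. h a \<odot>\<^bsub>M\<^esub> x)\<rparr>"

text \<open>
  A resolution \<open>0 \<rightarrow> P n \<rightarrow> \<dots> \<rightarrow> P 1 \<rightarrow> P 0\<close> of \<open>M\<close> with augmentation \<open>e : P 0 \<rightarrow> M\<close>
  and \<open>d j : P (j + 1) \<rightarrow> P j\<close>, continued by zero modules beyond \<open>n\<close>.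
\<close>

definition finite_projective_resolution ::
  "('r, 'c) ring_scheme \<Rightarrow> ('r, 'm) module \<Rightarrow> nat \<Rightarrow> (nat \<Rightarrow> ('r, 'u) module) \<Rightarrow>
   (nat \<Rightarrow> 'u \<Rightarrow> 'u) \<Rightarrow> ('u \<Rightarrow> 'm) \<Rightarrow> bool" where
  "finite_projective_resolution R M n P d e \<longleftrightarrow>
     (\<forall>j. projective_module R (P j)) \<and>
     (\<forall>j>n. carrier (P j) = {\<zero>\<^bsub>P j\<^esub>}) \<and>
     (\<forall>j. d j \<in> lhom R (P (Suc j)) (P j)) \<and>
     e \<in> lhom R (P 0) M \<and>
     e ` carrier (P 0) = carrier M \<and>
     {x \<in> carrier (P 0). e x = \<zero>\<^bsub>M\<^esub>} = d 0 ` carrier (P (Suc 0)) \<and>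
     (\<forall>j. {x \<in> carrier (P (Suc j)). d j x = \<zero>\<^bsub>P j\<^esub>} = d (Suc j) ` carrier (P (Suc (Suc j))))"


section \<open>Unbounded cochain complexes\<close>

record ('r, 'm) cochain_complex =
  obj :: "int \<Rightarrow> ('r, 'm) module"
  dif :: "int \<Rightarrow> 'm \<Rightarrow> 'm"

definition is_complex :: "('r, 'c) ring_scheme \<Rightarrow> ('r, 'm) cochain_complex \<Rightarrow> bool" where
  "is_complex R X \<longleftrightarrow>
     (\<forall>n. left_module R (obj X n)) \<and>
     (\<forall>n. dif X n \<in> lhom R (obj X n) (obj X (n + 1))) \<and>
     (\<forall>n. \<forall>x\<in>carrier (obj X n). dif X (n + 1) (dif X n x) = \<zero>\<^bsub>obj X (n + 2)\<^esub>)"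

definition chain_map ::
  "('r, 'c) ring_scheme \<Rightarrow> ('r, 'm) cochain_complex \<Rightarrow> ('r, 'n) cochain_complex \<Rightarrow>
   (int \<Rightarrow> 'm \<Rightarrow> 'n) \<Rightarrow> bool" where
  "chain_map R X Y f \<longleftrightarrow> is_complex R X \<and> is_complex R Y \<and>
     (\<forall>n. f n \<in> lhom R (obj X n) (obj Y n)) \<and>
     (\<forall>n. \<forall>x\<in>carrier (obj X n). f (n + 1) (dif X n x) = dif Y n (f n x))"

definition id_map :: "('r, 'm) cochain_complex \<Rightarrow> int \<Rightarrow> 'm \<Rightarrow> 'm" where
  "id_map X = (\<lambda>n. \<lambda>x\<in>carrier (obj X n). x)"

definition comp_map ::
  "('r, 'm) cochain_complex \<Rightarrow> (int \<Rightarrow> 'n \<Rightarrow> 'k) \<Rightarrow> (int \<Rightarrow> 'm \<Rightarrow> 'n) \<Rightarrow> int \<Rightarrow> 'm \<Rightarrow> 'k" where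
  "comp_map X g f = (\<lambda>n. compose (carrier (obj X n)) (g n) (f n))"

definition homotopic ::
  "('r, 'c) ring_scheme \<Rightarrow> ('r, 'm) cochain_complex \<Rightarrow> ('r, 'n) cochain_complex \<Rightarrow>
   (int \<Rightarrow> 'm \<Rightarrow> 'n) \<Rightarrow> (int \<Rightarrow> 'm \<Rightarrow> 'n) \<Rightarrow> bool" where
  "homotopic R X Y f g \<longleftrightarrow> chain_map R X Y f \<and> chain_map R X Y g \<and>
     (\<exists>s. (\<forall>n. s n \<in> lhom R (obj X n) (obj Y (n - 1))) \<and>
          (\<forall>n. \<forall>x\<in>carrier (obj X n).
             f n x = g n x \<oplus>\<^bsub>obj Y n\<^esub>
               (dif Y (n - 1) (s n x) \<oplus>\<^bsub>obj Y n\<^esub> s (n + 1) (dif X n x))))"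

definition cocycles :: "('r, 'm) cochain_complex \<Rightarrow> int \<Rightarrow> 'm set" where
  "cocycles X n = {x \<in> carrier (obj X n). dif X n x = \<zero>\<^bsub>obj X (n + 1)\<^esub>}"

definition coboundaries :: "('r, 'm) cochain_complex \<Rightarrow> int \<Rightarrow> 'm set" where
  "coboundaries X n = dif X (n - 1) ` carrier (obj X (n - 1))"

definition cohomology :: "('r, 'm) cochain_complex \<Rightarrow> int \<Rightarrow> 'm set set" where
  "cohomology X n = (\<lambda>x. coboundaries X n +>\<^bsub>obj X n\<^esub> x) ` cocycles X n"

text \<open>For a chain map \<open>f\<close> this sends the class of a cocycle \<open>x\<close> to the class of \<open>f n x\<close>.\<close>

definition cohomology_map ::
  "('r, 'n) cochain_complex \<Rightarrow> (int \<Rightarrow> 'm \<Rightarrow> 'n) \<Rightarrow> int \<Rightarrow> 'm set \<Rightarrow> 'n set" where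
  "cohomology_map Y f n C = coboundaries Y n <+>\<^bsub>obj Y n\<^esub> (f n ` C)"

definition acyclic_complex :: "('r, 'm) cochain_complex \<Rightarrow> bool" where
  "acyclic_complex X \<longleftrightarrow> (\<forall>n. cocycles X n = coboundaries X n)"

definition quasi_iso ::
  "('r, 'c) ring_scheme \<Rightarrow> ('r, 'm) cochain_complex \<Rightarrow> ('r, 'n) cochain_complex \<Rightarrow>
   (int \<Rightarrow> 'm \<Rightarrow> 'n) \<Rightarrow> bool" where
  "quasi_iso R X Y f \<longleftrightarrow> chain_map R X Y f \<and>
     (\<forall>n. bij_betw (cohomology_map Y f n) (cohomology X n) (cohomology Y n))"

definition restrict_scalars_complex ::
  "('a \<Rightarrow> 'b) \<Rightarrow> ('b, 'm) cochain_complex \<Rightarrow> ('a, 'm) cochain_complex" where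
  "restrict_scalars_complex h X = \<lparr>obj = (\<lambda>n. restrict_scalars h (obj X n)), dif = dif X\<rparr>"


section \<open>Isomorphisms in the derived category\<close>

text \<open>
  A morphism \<open>X \<rightarrow> Y\<close> of the derived category is an equivalence class of roofs \<open>(Z, s, f)\<close>, that is
  \<open>X \<leftarrow> Z \<rightarrow> Y\<close> with \<open>s : Z \<rightarrow> X\<close> a quasi-isomorphism and \<open>f : Z \<rightarrow> Y\<close> a chain map; the calculus of
  fractions takes place in the homotopy category, so all squares commute up to homotopy.
\<close>

type_synonym ('r, 'm) roof =
  "('r, 'm) cochain_complex \<times> (int \<Rightarrow> 'm \<Rightarrow> 'm) \<times> (int \<Rightarrow> 'm \<Rightarrow> 'm)"

definition is_roof ::
  "('r, 'c) ring_scheme \<Rightarrow> ('r, 'm) cochain_complex \<Rightarrow> ('r, 'm) cochain_complex \<Rightarrow>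
   ('r, 'm) roof \<Rightarrow> bool" where
  "is_roof R X Y \<rho> = (case \<rho> of (Z, s, f) \<Rightarrow> quasi_iso R Z X s \<and> chain_map R Z Y f)"

definition roof_equiv ::
  "('r, 'c) ring_scheme \<Rightarrow> ('r, 'm) cochain_complex \<Rightarrow> ('r, 'm) cochain_complex \<Rightarrow>
   ('r, 'm) roof \<Rightarrow> ('r, 'm) roof \<Rightarrow> bool" where
  "roof_equiv R X Y \<rho> \<rho>' = (case \<rho> of (Z, s, f) \<Rightarrow> case \<rho>' of (Z', s', f') \<Rightarrow>
     is_roof R X Y \<rho> \<and> is_roof R X Y \<rho>' \<and>
     (\<exists>(T :: ('r, 'm) cochain_complex) u v.
        chain_map R T Z u \<and> chain_map R T Z' v \<and>
        quasi_iso R T X (comp_map T s u) \<and>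
        homotopic R T X (comp_map T s u) (comp_map T s' v) \<and>
        homotopic R T Y (comp_map T f u) (comp_map T f' v)))"

text \<open>\<open>\<tau> : X \<rightarrow> W\<close> is a composite of \<open>\<rho> : X \<rightarrow> Y\<close> followed by \<open>\<sigma> : Y \<rightarrow> W\<close>; it is unique up to
  \<^const>\<open>roof_equiv\<close>.\<close>

definition roof_composite ::
  "('r, 'c) ring_scheme \<Rightarrow> ('r, 'm) cochain_complex \<Rightarrow> ('r, 'm) cochain_complex \<Rightarrow>
   ('r, 'm) cochain_complex \<Rightarrow> ('r, 'm) roof \<Rightarrow> ('r, 'm) roof \<Rightarrow> ('r, 'm) roof \<Rightarrow> bool" where
  "roof_composite R X Y W \<rho> \<sigma> \<tau> = (case \<rho> of (Z, s, f) \<Rightarrow> case \<sigma> of (Z', s', g) \<Rightarrow>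
     is_roof R X Y \<rho> \<and> is_roof R Y W \<sigma> \<and>
     (\<exists>T t k. quasi_iso R T Z t \<and> chain_map R T Z' k \<and>
        homotopic R T Y (comp_map T f t) (comp_map T s' k) \<and>
        \<tau> = (T, comp_map T s t, comp_map T g k)))"

definition roof_of_map :: "('r, 'm) cochain_complex \<Rightarrow> (int \<Rightarrow> 'm \<Rightarrow> 'm) \<Rightarrow> ('r, 'm) roof" where
  "roof_of_map X f = (X, id_map X, f)"

definition derived_iso ::
  "('r, 'c) ring_scheme \<Rightarrow> ('r, 'm) cochain_complex \<Rightarrow> ('r, 'm) cochain_complex \<Rightarrow>
   (int \<Rightarrow> 'm \<Rightarrow> 'm) \<Rightarrow> bool" where
  "derived_iso R X Y f \<longleftrightarrow> chain_map R X Y f \<and>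
     (\<exists>\<sigma>. is_roof R Y X \<sigma> \<and>
        (\<exists>\<tau>. roof_composite R X Y X (roof_of_map X f) \<sigma> \<tau> \<and>
             roof_equiv R X X \<tau> (roof_of_map X (id_map X))) \<and>
        (\<exists>\<tau>. roof_composite R Y X Y \<sigma> (roof_of_map X f) \<tau> \<and>
             roof_equiv R Y Y \<tau> (roof_of_map Y (id_map Y))))"


section \<open>Hom complexes, K-injective resolutions and RHom\<close>

text \<open>
  Degree \<open>n\<close> is the product over \<open>p\<close> of \<open>Hom(X p, Y (p + n))\<close>, an abelian group regarded as a
  module over \<open>\<Z>\<close>; the fields \<open>mult\<close> and \<open>one\<close> are irrelevant.
\<close>

definition hom_group ::
  "('r, 'c) ring_scheme \<Rightarrow> ('r, 'm) cochain_complex \<Rightarrow> ('r, 'n) cochain_complex \<Rightarrow> int \<Rightarrow>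
   (int, int \<Rightarrow> 'm \<Rightarrow> 'n) module" where
  "hom_group R X Y n =
     \<lparr>carrier = {\<phi>. \<forall>p. \<phi> p \<in> lhom R (obj X p) (obj Y (p + n))},
      monoid.mult = undefined,
      one = undefined,
      zero = (\<lambda>p. \<lambda>x\<in>carrier (obj X p). \<zero>\<^bsub>obj Y (p + n)\<^esub>),
      add = (\<lambda>\<phi> \<psi> p. \<lambda>x\<in>carrier (obj X p). \<phi> p x \<oplus>\<^bsub>obj Y (p + n)\<^esub> \<psi> p x),
      smult = (\<lambda>k \<phi> p. \<lambda>x\<in>carrier (obj X p). [k] \<cdot>\<^bsub>obj Y (p + n)\<^esub> \<phi> p x)\<rparr>"

text \<open>The differential is \<open>\<phi> \<mapsto> d \<circ> \<phi> - (-1)^n \<phi> \<circ> d\<close> in degree \<open>n\<close>.\<close>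

definition hom_complex ::
  "('r, 'c) ring_scheme \<Rightarrow> ('r, 'm) cochain_complex \<Rightarrow> ('r, 'n) cochain_complex \<Rightarrow>
   (int, int \<Rightarrow> 'm \<Rightarrow> 'n) cochain_complex" where
  "hom_complex R X Y =
     \<lparr>obj = hom_group R X Y,
      dif = (\<lambda>n. \<lambda>\<phi>\<in>carrier (hom_group R X Y n). \<lambda>p. \<lambda>x\<in>carrier (obj X p).
        if even n
        then dif Y (p + n) (\<phi> p x) \<ominus>\<^bsub>obj Y (p + (n + 1))\<^esub> \<phi> (p + 1) (dif X p x)
        else dif Y (p + n) (\<phi> p x) \<oplus>\<^bsub>obj Y (p + (n + 1))\<^esub> \<phi> (p + 1) (dif X p x))\<rparr>"

definition K_injective :: "('r, 'c) ring_scheme \<Rightarrow> ('r, 'u) cochain_complex \<Rightarrow> bool" where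
  "K_injective R J \<longleftrightarrow> is_complex R J \<and>
     (\<forall>X :: ('r, 'u) cochain_complex.
        is_complex R X \<and> acyclic_complex X \<longrightarrow> acyclic_complex (hom_complex R X J))"

definition K_injective_resolution ::
  "('r, 'c) ring_scheme \<Rightarrow> ('r, 'u) cochain_complex \<Rightarrow> ('r, 'u) cochain_complex \<Rightarrow>
   (int \<Rightarrow> 'u \<Rightarrow> 'u) \<Rightarrow> bool" where
  "K_injective_resolution R W J i \<longleftrightarrow> K_injective R J \<and> quasi_iso R W J i"

text \<open>
  \<open>RHom R V (J, i)\<close> computes \<open>RHom(V, W)\<close> from a K-injective resolution \<open>i : W \<rightarrow> J\<close>.
\<close>

definition RHom ::
  "('r, 'c) ring_scheme \<Rightarrow> ('r, 'u) cochain_complex \<Rightarrow>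
   ('r, 'u) cochain_complex \<times> (int \<Rightarrow> 'u \<Rightarrow> 'u) \<Rightarrow> (int, int \<Rightarrow> 'u \<Rightarrow> 'u) cochain_complex" where
  "RHom R V \<J> = hom_complex R V (fst \<J>)"

text \<open>
  Let \<open>h : A \<rightarrow> B\<close> be a ring homomorphism and \<open>\<iota> : Mod B \<rightarrow> Mod A\<close> restriction of scalars along it.
  Given K-injective resolutions \<open>i2 : W \<rightarrow> J2\<close> over \<open>B\<close> and \<open>i1 : \<iota> W \<rightarrow> J1\<close> over \<open>A\<close>, a comparison map
  is a chain map \<open>c : \<iota> J2 \<rightarrow> J1\<close> under \<open>\<iota> W\<close>, up to homotopy.
\<close>

definition comparison_map ::
  "('a, 'c) ring_scheme \<Rightarrow> ('a \<Rightarrow> 'b) \<Rightarrow> ('b, 'u) cochain_complex \<Rightarrow>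
   ('b, 'u) cochain_complex \<times> (int \<Rightarrow> 'u \<Rightarrow> 'u) \<Rightarrow>
   ('a, 'u) cochain_complex \<times> (int \<Rightarrow> 'u \<Rightarrow> 'u) \<Rightarrow> (int \<Rightarrow> 'u \<Rightarrow> 'u) \<Rightarrow> bool" where
  "comparison_map A h W \<J>2 \<J>1 c = (case \<J>2 of (J2, i2) \<Rightarrow> case \<J>1 of (J1, i1) \<Rightarrow>
     chain_map A (restrict_scalars_complex h J2) J1 c \<and>
     homotopic A (restrict_scalars_complex h W) J1 (comp_map W c i2) i1)"

text \<open>
  The natural map \<open>RHom\<^sub>B(V, W) \<rightarrow> RHom\<^sub>A(\<iota> V, \<iota> W)\<close>: apply \<open>\<iota>\<close>, which does not change the underlying
  functions, and compose with the comparison map.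
\<close>

definition natural_RHom_map ::
  "('b, 'd) ring_scheme \<Rightarrow> ('b, 'u) cochain_complex \<Rightarrow>
   ('b, 'u) cochain_complex \<times> (int \<Rightarrow> 'u \<Rightarrow> 'u) \<Rightarrow> (int \<Rightarrow> 'u \<Rightarrow> 'u) \<Rightarrow>
   int \<Rightarrow> (int \<Rightarrow> 'u \<Rightarrow> 'u) \<Rightarrow> (int \<Rightarrow> 'u \<Rightarrow> 'u)" where
  "natural_RHom_map B V \<J>2 c =
     (\<lambda>n. \<lambda>\<phi>\<in>carrier (obj (RHom B V \<J>2) n). \<lambda>p. compose (carrier (obj V p)) (c (p + n)) (\<phi> p))"

text \<open>
  Condition (R) for the pair \<open>(Mod A, Mod B)\<close> and the inclusion \<open>\<iota>\<close>, over the universe \<open>'u\<close>: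
  for all resolutions, a comparison map exists and every one makes the natural map an isomorphism
  in the derived category of abelian groups.
\<close>

definition condition_R ::
  "'u itself \<Rightarrow> ('a, 'c) ring_scheme \<Rightarrow> ('b, 'd) ring_scheme \<Rightarrow> ('a \<Rightarrow> 'b) \<Rightarrow> bool" where
  "condition_R (_ :: 'u itself) A B h \<longleftrightarrow>
     (\<forall>(V :: ('b, 'u) cochain_complex) (W :: ('b, 'u) cochain_complex) J2 i2 J1 i1.
        is_complex B V \<and> is_complex B W \<and>
        K_injective_resolution B W J2 i2 \<and>
        K_injective_resolution A (restrict_scalars_complex h W) J1 i1 \<longrightarrow>
        (\<exists>c. comparison_map A h W (J2, i2) (J1, i1) c) \<and>
        (\<forall>c. comparison_map A h W (J2, i2) (J1, i1) c \<longrightarrow>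
           derived_iso \<Z> (RHom B V (J2, i2)) (RHom A (restrict_scalars_complex h V) (J1, i1))
             (natural_RHom_map B V (J2, i2) c)))"

end

theory Submission
  imports Defs
begin

text \<open>
  Write \<open>B = A / I\<close>, and let \<open>W \<rightarrow> J\<^sub>2\<close> and \<open>i : W \<rightarrow> J\<^sub>1\<close> be K-injective resolutions over \<open>B\<close> and over \<open>A\<close>.
  The subcomplex \<open>J' = Hom\<^sub>A(B, J\<^sub>1)\<close> of elements killed by \<open>I\<close> is K-injective over \<open>B\<close>, and \<open>i\<close> factors
  through it.  The point is that \<open>W \<rightarrow> J'\<close> is still a quasi-isomorphism: in the square formed by
  \<open>Hom\<^sub>A(B, W) \<rightarrow> Hom\<^sub>A(B, J\<^sub>1)\<close> and \<open>Hom\<^sub>A(P, W) \<rightarrow> Hom\<^sub>A(P, J\<^sub>1)\<close>, the lower map is a quasi-isomorphism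
  because the \<open>P j\<close> are projective, the right one because \<open>J\<^sub>1\<close> is K-injective, and
  \<open>Hom\<^sub>A(B, W) = Hom\<^sub>A(P, W)\<close> because \<open>Hom\<^sub>A(P j, W)\<close> vanishes for \<open>j > 0\<close>.
  So the comparison map \<open>J\<^sub>2 \<rightarrow> J'\<close> is a quasi-isomorphism between K-injective complexes over \<open>B\<close>, hence
  a homotopy equivalence, and \<open>Hom\<^sub>B(V, J\<^sub>2) \<rightarrow> Hom\<^sub>B(V, J') = Hom\<^sub>A(V, J\<^sub>1)\<close> is a quasi-isomorphism.
\<close>

text \<open>The square is never built out of Hom complexes: each of its two quasi-isomorphisms is
  used as a single null-homotopy. Projectivity bounds a map from P into the acyclic mapping fibre of
  W -> J1. K-injectivity bounds a map from the augmented resolution ... -> P 0 -> B -> 0 into J1.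
  Mapping out of B is essential there: the homotopy evaluated at 1 is a primitive killed by I,
  whereas an arbitrary primitive in J1 need not lie in Hom(B, J1).

  The obstacle is the universe. Projectivity and K-injectivity are tested only on modules inside
  \<open>'u\<close>, so the mapping fibre has to live there, which takes a bijection between pairs
  and \<open>'u\<close>; this is where infinity of \<open>'u\<close> enters. For the same reason B
  is replaced by a copy inside \<open>P 0\<close>.

  Morphisms are extensional functions and coinduced modules are subsets, so the adjunction Hom_A(V,
  J1) = Hom_B(V, J') is an equality of sets of functions, and the natural map needs no transport.
  Cohomology is handled on representatives; roofs appear only when a quasi-isomorphism is inverted
  at the end.\<close>

lemmas agroup_a_closed [intro] = abelian_monoid.a_closed [OF abelian_group.axioms(1)]

lemma left_module_group: "left_module R M \<Longrightarrow> abelian_group M"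
  by (simp add: left_module_def)

text \<open>\<open>abelian_group\<close> reads only the carrier, the addition and the zero of the
  record, so a new scalar action or new multiplicative fields do no harm.\<close>

lemma abelian_group_cong:
  assumes "abelian_group M" "carrier N = carrier M" "add N = add M" "zero N = zero M"
  shows "abelian_group N"
proof -
  interpret abelian_group M by fact
  show ?thesis
    by (rule abelian_groupI) (auto simp: assms(2-) a_ac intro: l_neg a_inv_closed)
qed

lemma left_moduleI:
  assumes "ring R" "abelian_group M"
    and "\<And>a x. \<lbrakk>a \<in> carrier R; x \<in> carrier M\<rbrakk> \<Longrightarrow> a \<odot>\<^bsub>M\<^esub> x \<in> carrier M"
    and "\<And>a b x. \<lbrakk>a \<in> carrier R; b \<in> carrier R; x \<in> carrier M\<rbrakk> \<Longrightarrow>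
       (a \<oplus>\<^bsub>R\<^esub> b) \<odot>\<^bsub>M\<^esub> x = a \<odot>\<^bsub>M\<^esub> x \<oplus>\<^bsub>M\<^esub> b \<odot>\<^bsub>M\<^esub> x"
    and "\<And>a x y. \<lbrakk>a \<in> carrier R; x \<in> carrier M; y \<in> carrier M\<rbrakk> \<Longrightarrow>
       a \<odot>\<^bsub>M\<^esub> (x \<oplus>\<^bsub>M\<^esub> y) = a \<odot>\<^bsub>M\<^esub> x \<oplus>\<^bsub>M\<^esub> a \<odot>\<^bsub>M\<^esub> y"
    and "\<And>a b x. \<lbrakk>a \<in> carrier R; b \<in> carrier R; x \<in> carrier M\<rbrakk> \<Longrightarrow>
       (a \<otimes>\<^bsub>R\<^esub> b) \<odot>\<^bsub>M\<^esub> x = a \<odot>\<^bsub>M\<^esub> (b \<odot>\<^bsub>M\<^esub> x)"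
    and "\<And>x. x \<in> carrier M \<Longrightarrow> \<one>\<^bsub>R\<^esub> \<odot>\<^bsub>M\<^esub> x = x"
  shows "left_module R M"
  using assms by (simp add: left_module_def left_module_axioms_def)

context left_module
begin

lemma smult_zero: assumes "a \<in> carrier R" shows "a \<odot>\<^bsub>M\<^esub> \<zero>\<^bsub>M\<^esub> = \<zero>\<^bsub>M\<^esub>"
proof -
  have "a \<odot>\<^bsub>M\<^esub> \<zero>\<^bsub>M\<^esub> \<oplus>\<^bsub>M\<^esub> a \<odot>\<^bsub>M\<^esub> \<zero>\<^bsub>M\<^esub> = a \<odot>\<^bsub>M\<^esub> \<zero>\<^bsub>M\<^esub>"
    using assms lm_smult_r_distr[of a "\<zero>\<^bsub>M\<^esub>" "\<zero>\<^bsub>M\<^esub>"] by simp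
  then show ?thesis
    using assms M.add.r_cancel_one' lm_smult_closed by simp
qed

lemma smult_neg: assumes "a \<in> carrier R" "x \<in> carrier M"
  shows "a \<odot>\<^bsub>M\<^esub> (\<ominus>\<^bsub>M\<^esub> x) = \<ominus>\<^bsub>M\<^esub> (a \<odot>\<^bsub>M\<^esub> x)"
  using assms lm_smult_r_distr[of a "\<ominus>\<^bsub>M\<^esub> x" x]
  by (metis M.a_inv_closed M.l_neg M.minus_equality lm_smult_closed smult_zero)

lemma submodule:
  assumes "H \<subseteq> carrier M" "\<zero>\<^bsub>M\<^esub> \<in> H"
    and "\<And>x y. \<lbrakk>x \<in> H; y \<in> H\<rbrakk> \<Longrightarrow> x \<oplus>\<^bsub>M\<^esub> y \<in> H"
    and "\<And>x. x \<in> H \<Longrightarrow> \<ominus>\<^bsub>M\<^esub> x \<in> H"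
    and "\<And>a x. \<lbrakk>a \<in> carrier R; x \<in> H\<rbrakk> \<Longrightarrow> a \<odot>\<^bsub>M\<^esub> x \<in> H"
  shows "left_module R (M\<lparr>carrier := H\<rparr>)"
proof (rule left_moduleI)
  have [simp]: "x \<in> carrier M" if "x \<in> H" for x using that assms(1) by auto
  have "\<exists>y\<in>H. y \<oplus>\<^bsub>M\<^esub> x = \<zero>\<^bsub>M\<^esub>" if "x \<in> H" for x
    using assms(4)[OF that] M.l_neg[of x] that by auto
  then show "abelian_group (M\<lparr>carrier := H\<rparr>)"
    by (intro abelian_groupI) (auto simp: assms M.a_assoc intro: M.a_comm)
qed (use assms in \<open>auto simp: R.ring_axioms subset_iff lm_smult_l_distr lm_smult_r_distr lm_smult_assoc lm_smult_one\<close>)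

end


section \<open>Homomorphisms\<close>

lemma lhomI:
  assumes "f \<in> extensional (carrier M)" "\<And>x. x \<in> carrier M \<Longrightarrow> f x \<in> carrier N"
    "\<And>x y. \<lbrakk>x \<in> carrier M; y \<in> carrier M\<rbrakk> \<Longrightarrow> f (x \<oplus>\<^bsub>M\<^esub> y) = f x \<oplus>\<^bsub>N\<^esub> f y"
    "\<And>a x. \<lbrakk>a \<in> carrier R; x \<in> carrier M\<rbrakk> \<Longrightarrow> f (a \<odot>\<^bsub>M\<^esub> x) = a \<odot>\<^bsub>N\<^esub> f x"
  shows "f \<in> lhom R M N"
  using assms by (auto simp: lhom_def PiE_def)

lemma lhom_closed: "f \<in> lhom R M N \<Longrightarrow> x \<in> carrier M \<Longrightarrow> f x \<in> carrier N"
  by (auto simp: lhom_def)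

lemma lhom_add: "f \<in> lhom R M N \<Longrightarrow> x \<in> carrier M \<Longrightarrow> y \<in> carrier M \<Longrightarrow>
    f (x \<oplus>\<^bsub>M\<^esub> y) = f x \<oplus>\<^bsub>N\<^esub> f y"
  by (auto simp: lhom_def)

lemma lhom_smult: "f \<in> lhom R M N \<Longrightarrow> a \<in> carrier R \<Longrightarrow> x \<in> carrier M \<Longrightarrow>
    f (a \<odot>\<^bsub>M\<^esub> x) = a \<odot>\<^bsub>N\<^esub> f x"
  by (auto simp: lhom_def)

lemma lhom_extensional: "f \<in> lhom R M N \<Longrightarrow> f \<in> extensional (carrier M)"
  by (auto simp: lhom_def PiE_def)

lemma lhom_eqI: "f \<in> lhom R M N \<Longrightarrow> g \<in> lhom R M N' \<Longrightarrow> (\<And>x. x \<in> carrier M \<Longrightarrow> f x = g x) \<Longrightarrow> f = g"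
  by (auto intro: extensionalityI[OF lhom_extensional lhom_extensional])

lemma lhom_zero:
  assumes "f \<in> lhom R M N" "abelian_group M" "abelian_group N"
  shows "f \<zero>\<^bsub>M\<^esub> = \<zero>\<^bsub>N\<^esub>"
proof -
  interpret M: abelian_group M by fact
  interpret N: abelian_group N by fact
  have "f \<zero>\<^bsub>M\<^esub> \<oplus>\<^bsub>N\<^esub> f \<zero>\<^bsub>M\<^esub> = f \<zero>\<^bsub>M\<^esub>"
    using lhom_add[OF assms(1), of "\<zero>\<^bsub>M\<^esub>" "\<zero>\<^bsub>M\<^esub>"] by simp
  then show ?thesis
    using lhom_closed[OF assms(1)] N.add.r_cancel_one' by simp
qed

lemma lhom_neg:
  assumes "f \<in> lhom R M N" "abelian_group M" "abelian_group N" "x \<in> carrier M"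
  shows "f (\<ominus>\<^bsub>M\<^esub> x) = \<ominus>\<^bsub>N\<^esub> f x"
proof -
  interpret M: abelian_group M by fact
  interpret N: abelian_group N by fact
  show ?thesis
    using lhom_add[OF assms(1), of "\<ominus>\<^bsub>M\<^esub> x" x] lhom_zero[OF assms(1-3)] assms(4)
      lhom_closed[OF assms(1)] by (simp add: M.l_neg N.minus_equality)
qed

lemma lhom_minus:
  assumes "f \<in> lhom R M N" "abelian_group M" "abelian_group N" "x \<in> carrier M" "y \<in> carrier M"
  shows "f (x \<ominus>\<^bsub>M\<^esub> y) = f x \<ominus>\<^bsub>N\<^esub> f y"
proof -
  interpret M: abelian_group M by fact
  show ?thesis using assms by (simp add: a_minus_def lhom_add lhom_neg)
qed

lemma lhom_restrict_comp:
  assumes "f \<in> lhom R M N" "g \<in> lhom R N K" "left_module R M"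
  shows "(\<lambda>x\<in>carrier M. g (f x)) \<in> lhom R M K"
proof -
  interpret left_module R M by fact
  show ?thesis using assms
    by (intro lhomI) (auto simp: lhom_closed lhom_add lhom_smult lm_smult_closed)
qed

lemma lhom_compose:
  "f \<in> lhom R M N \<Longrightarrow> g \<in> lhom R N K \<Longrightarrow> left_module R M \<Longrightarrow> compose (carrier M) g f \<in> lhom R M K"
  unfolding compose_def by (rule lhom_restrict_comp)

lemma lhom_restrict_zero:
  assumes "left_module R M" "left_module R N"
  shows "(\<lambda>x\<in>carrier M. \<zero>\<^bsub>N\<^esub>) \<in> lhom R M N"
proof -
  interpret M: left_module R M by fact
  interpret N: left_module R N by fact
  show ?thesis
    by (intro lhomI) (auto simp: M.lm_smult_closed N.smult_zero)
qed

lemma lhom_restrict_add: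
  assumes "f \<in> lhom R M N" "g \<in> lhom R M N" "left_module R M" "left_module R N"
  shows "(\<lambda>x\<in>carrier M. f x \<oplus>\<^bsub>N\<^esub> g x) \<in> lhom R M N"
proof -
  interpret M: left_module R M by fact
  interpret N: left_module R N by fact
  note [simp] = lhom_closed[OF assms(1)] lhom_closed[OF assms(2)] lhom_add[OF assms(1)] lhom_add[OF assms(2)]
    lhom_smult[OF assms(1)] lhom_smult[OF assms(2)]
  show ?thesis
    by (intro lhomI) (auto simp: M.lm_smult_closed N.lm_smult_r_distr N.M.a_ac)
qed

lemma lhom_restrict_neg:
  assumes "f \<in> lhom R M N" "left_module R M" "left_module R N"
  shows "(\<lambda>x\<in>carrier M. \<ominus>\<^bsub>N\<^esub> f x) \<in> lhom R M N"
proof -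
  interpret M: left_module R M by fact
  interpret N: left_module R N by fact
  note [simp] = lhom_closed[OF assms(1)] lhom_add[OF assms(1)] lhom_smult[OF assms(1)]
  show ?thesis
    by (intro lhomI) (auto simp: M.lm_smult_closed N.smult_neg N.M.minus_add N.M.a_ac)
qed

lemma lhom_restrict_id:
  assumes "left_module R M"
  shows "(\<lambda>x\<in>carrier M. x) \<in> lhom R M M"
proof -
  interpret M: left_module R M by fact
  show ?thesis
    by (intro lhomI) (auto simp: M.lm_smult_closed)
qed

text \<open>\<open>projective_module\<close> lifts only along surjections. Here \<open>g\<close>
  need only hit the values of \<open>f\<close>: its image is a submodule of \<open>N\<close>, again
  in the universe \<open>'u\<close>, and \<open>g\<close> maps onto that.\<close>

lemma projective_lift:
  fixes Q M N :: "('r, 'u) module"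
  assumes "projective_module R Q" "left_module R M" "left_module R N" "g \<in> lhom R M N"
    "f \<in> lhom R Q N" "f ` carrier Q \<subseteq> g ` carrier M"
  obtains f' where "f' \<in> lhom R Q M" "\<And>x. x \<in> carrier Q \<Longrightarrow> g (f' x) = f x"
proof -
  interpret M: left_module R M by fact
  interpret N: left_module R N by fact
  let ?N = "N\<lparr>carrier := g ` carrier M\<rparr>"
  have ag: "abelian_group M" "abelian_group N" by (rule left_module_group, fact)+
  have "left_module R ?N"
  proof (rule N.submodule)
    fix x y assume "x \<in> g ` carrier M" "y \<in> g ` carrier M"
    then obtain u v where "u \<in> carrier M" "v \<in> carrier M" "x = g u" "y = g v" by blast
    then show "x \<oplus>\<^bsub>N\<^esub> y \<in> g ` carrier M"
      using lhom_add[OF assms(4)] by (auto intro!: image_eqI[of _ _ "u \<oplus>\<^bsub>M\<^esub> v"])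
  next
    show "\<zero>\<^bsub>N\<^esub> \<in> g ` carrier M"
      using lhom_zero[OF assms(4) ag] by (auto intro!: image_eqI[of _ _ "\<zero>\<^bsub>M\<^esub>"])
  next
    fix x assume "x \<in> g ` carrier M"
    then show "\<ominus>\<^bsub>N\<^esub> x \<in> g ` carrier M"
      using lhom_neg[OF assms(4) ag] by (auto intro!: image_eqI[of _ _ "\<ominus>\<^bsub>M\<^esub> _"])
  next
    fix a x assume "a \<in> carrier R" "x \<in> g ` carrier M"
    then show "a \<odot>\<^bsub>N\<^esub> x \<in> g ` carrier M"
      using lhom_smult[OF assms(4)] M.lm_smult_closed by (auto intro!: image_eqI[of _ _ "_ \<odot>\<^bsub>M\<^esub> _"])
  qed (auto intro: lhom_closed[OF assms(4)])
  moreover have "g \<in> lhom R M ?N" "f \<in> lhom R Q ?N"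
    using assms(4-6) by (auto simp: lhom_def PiE_def)
  moreover have "g ` carrier M = carrier ?N" by simp
  ultimately obtain f' where "f' \<in> lhom R Q M" "\<forall>x\<in>carrier Q. g (f' x) = f x"
    using assms(1,2) unfolding projective_module_def by blast
  then show ?thesis using that by blast
qed

section \<open>Complexes and chain maps\<close>

locale cpx = fixes R :: "('r, 'c) ring_scheme" and X :: "('r, 'm) cochain_complex"
  assumes is_complex: "is_complex R X"
begin

lemma left_module: "left_module R (obj X n)"
  using is_complex by (simp add: is_complex_def)

sublocale g: abelian_group "obj X n" for n
  by (rule left_module_group[OF left_module])

lemma abelian_group [simp]: "abelian_group (obj X n)" ..

lemma neg_zero [simp]: "\<ominus>\<^bsub>obj X n\<^esub> \<zero>\<^bsub>obj X n\<^esub> = \<zero>\<^bsub>obj X n\<^esub>"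
  by (rule g.minus_equality) auto

lemma dif_lhom: "dif X n \<in> lhom R (obj X n) (obj X (n + 1))"
  using is_complex by (simp add: is_complex_def)

text \<open>The target degree is a separate variable because degrees such as
  \<open>n - 1 + 1\<close> and \<open>n\<close> are equal but not syntactically so; the two forms
  that occur most are then derived as simplification rules.\<close>

lemma dif_closed: "x \<in> carrier (obj X n) \<Longrightarrow> m = n + 1 \<Longrightarrow> dif X n x \<in> carrier (obj X m)"
  using lhom_closed[OF dif_lhom] by simp

lemmas dif_closed1 [simp] = dif_closed[OF _ refl]

lemma dif_closed2 [simp]: "x \<in> carrier (obj X (n - 1)) \<Longrightarrow> dif X (n - 1) x \<in> carrier (obj X n)"
  by (erule dif_closed) simp

lemma dif_add [simp]: "x \<in> carrier (obj X n) \<Longrightarrow> y \<in> carrier (obj X n) \<Longrightarrow>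
   dif X n (x \<oplus>\<^bsub>obj X n\<^esub> y) = dif X n x \<oplus>\<^bsub>obj X (n + 1)\<^esub> dif X n y"
  by (rule lhom_add[OF dif_lhom])

lemma dif_zero [simp]: "dif X n \<zero>\<^bsub>obj X n\<^esub> = \<zero>\<^bsub>obj X (n + 1)\<^esub>"
  by (rule lhom_zero[OF dif_lhom]) auto

lemma dif_neg [simp]: "x \<in> carrier (obj X n) \<Longrightarrow>
   dif X n (\<ominus>\<^bsub>obj X n\<^esub> x) = \<ominus>\<^bsub>obj X (n + 1)\<^esub> dif X n x"
  by (rule lhom_neg[OF dif_lhom]) auto

lemma dif_smult [simp]: "a \<in> carrier R \<Longrightarrow> x \<in> carrier (obj X n) \<Longrightarrow>
   dif X n (a \<odot>\<^bsub>obj X n\<^esub> x) = a \<odot>\<^bsub>obj X (n + 1)\<^esub> dif X n x"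
  by (rule lhom_smult[OF dif_lhom])

lemma smult_closed [simp]: "a \<in> carrier R \<Longrightarrow> x \<in> carrier (obj X n) \<Longrightarrow>
   a \<odot>\<^bsub>obj X n\<^esub> x \<in> carrier (obj X n)"
  by (rule left_module.lm_smult_closed[OF left_module])

lemma dif_dif: "x \<in> carrier (obj X n) \<Longrightarrow> m = n + 1 \<Longrightarrow> dif X m (dif X n x) = \<zero>\<^bsub>obj X (m + 1)\<^esub>"
  using is_complex by (simp add: is_complex_def add.assoc)

lemmas dif_dif1 [simp] = dif_dif[OF _ refl]

lemma dif_dif2 [simp]: "x \<in> carrier (obj X (n - 1)) \<Longrightarrow> dif X n (dif X (n - 1) x) = \<zero>\<^bsub>obj X (n + 1)\<^esub>"
  by (rule dif_dif) auto

lemma cocyclesD: "x \<in> cocycles X n \<Longrightarrow> x \<in> carrier (obj X n)"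
  "x \<in> cocycles X n \<Longrightarrow> dif X n x = \<zero>\<^bsub>obj X (n + 1)\<^esub>"
  by (auto simp: cocycles_def)

lemma cocyclesI: "x \<in> carrier (obj X n) \<Longrightarrow> dif X n x = \<zero>\<^bsub>obj X (n + 1)\<^esub> \<Longrightarrow> x \<in> cocycles X n"
  by (auto simp: cocycles_def)

lemma zero_cocycle: "\<zero>\<^bsub>obj X n\<^esub> \<in> cocycles X n"
  by (simp add: cocycles_def)

lemma cocycles_minus: "x \<in> cocycles X n \<Longrightarrow> y \<in> cocycles X n \<Longrightarrow> x \<ominus>\<^bsub>obj X n\<^esub> y \<in> cocycles X n"
  by (simp add: cocycles_def a_minus_def)

lemma coboundariesI: "z \<in> carrier (obj X (n - 1)) \<Longrightarrow> x = dif X (n - 1) z \<Longrightarrow> x \<in> coboundaries X n"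
  by (auto simp: coboundaries_def)

lemma coboundaries_cocycles: "coboundaries X n \<subseteq> cocycles X n"
  by (auto simp: coboundaries_def cocycles_def)

lemma coboundaries_closed: "x \<in> coboundaries X n \<Longrightarrow> x \<in> carrier (obj X n)"
  by (auto simp: coboundaries_def)

lemma coboundaries_add: "x \<in> coboundaries X n \<Longrightarrow> y \<in> coboundaries X n \<Longrightarrow>
   x \<oplus>\<^bsub>obj X n\<^esub> y \<in> coboundaries X n"
  unfolding coboundaries_def
  by (clarsimp, rule_tac x = "xa \<oplus>\<^bsub>obj X (n - 1)\<^esub> xaa" in image_eqI) auto

lemma coboundaries_neg: "x \<in> coboundaries X n \<Longrightarrow> \<ominus>\<^bsub>obj X n\<^esub> x \<in> coboundaries X n"
  unfolding coboundaries_def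
  by (clarsimp, rule image_eqI[of _ _ "\<ominus>\<^bsub>obj X (n - 1)\<^esub> _"]) auto

lemma coboundaries_minus: "x \<in> coboundaries X n \<Longrightarrow> y \<in> coboundaries X n \<Longrightarrow>
   x \<ominus>\<^bsub>obj X n\<^esub> y \<in> coboundaries X n"
  unfolding a_minus_def by (intro coboundaries_add coboundaries_neg)

lemma coboundaries_zero: "\<zero>\<^bsub>obj X n\<^esub> \<in> coboundaries X n"
  by (rule coboundariesI[of "\<zero>\<^bsub>obj X (n - 1)\<^esub>"]) auto

text \<open>After sorting by \<open>a_ac\<close>, an element and its negative may be separated by
  one or two summands, where the library rules for adjacent inverses do not apply. This rule and the
  next close these gaps.\<close>

lemma a_cancel: "x \<in> carrier (obj X n) \<Longrightarrow> y \<in> carrier (obj X n) \<Longrightarrow> z \<in> carrier (obj X n) \<Longrightarrow>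
   x \<oplus>\<^bsub>obj X n\<^esub> (y \<oplus>\<^bsub>obj X n\<^esub> (z \<oplus>\<^bsub>obj X n\<^esub> \<ominus>\<^bsub>obj X n\<^esub> x)) = y \<oplus>\<^bsub>obj X n\<^esub> z"
  by (metis g.a_closed g.a_inv_closed g.a_assoc g.a_comm g.r_neg g.r_zero)

lemma a_cancel2: "x \<in> carrier (obj X n) \<Longrightarrow> y \<in> carrier (obj X n) \<Longrightarrow>
   x \<oplus>\<^bsub>obj X n\<^esub> (y \<oplus>\<^bsub>obj X n\<^esub> \<ominus>\<^bsub>obj X n\<^esub> x) = y"
  by (metis g.a_inv_closed g.a_comm g.r_neg2)

lemma minus_eq_zeroD:
  assumes "x \<in> carrier (obj X n)" "y \<in> carrier (obj X n)" "x \<ominus>\<^bsub>obj X n\<^esub> y = \<zero>\<^bsub>obj X n\<^esub>"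
  shows "x = y"
  using a_cancel2[OF assms(2,1)] assms by (simp add: a_minus_def)

lemma class_mem_iff: "x \<in> carrier (obj X n) \<Longrightarrow>
   z \<in> coboundaries X n +>\<^bsub>obj X n\<^esub> x \<longleftrightarrow> z \<in> carrier (obj X n) \<and> z \<ominus>\<^bsub>obj X n\<^esub> x \<in> coboundaries X n"
proof -
  assume x: "x \<in> carrier (obj X n)"
  have "z \<in> coboundaries X n +>\<^bsub>obj X n\<^esub> x \<longleftrightarrow> (\<exists>b\<in>coboundaries X n. z = b \<oplus>\<^bsub>obj X n\<^esub> x)"
    by (auto simp: a_r_coset_def r_coset_def)
  also have "\<dots> \<longleftrightarrow> z \<in> carrier (obj X n) \<and> z \<ominus>\<^bsub>obj X n\<^esub> x \<in> coboundaries X n"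
  proof (intro iffI; (elim bexE conjE)?)
    fix b assume "b \<in> coboundaries X n" "z = b \<oplus>\<^bsub>obj X n\<^esub> x"
    then show "z \<in> carrier (obj X n) \<and> z \<ominus>\<^bsub>obj X n\<^esub> x \<in> coboundaries X n"
      using x coboundaries_closed by (simp add: a_minus_def g.a_assoc g.r_neg)
  next
    assume z: "z \<in> carrier (obj X n)" "z \<ominus>\<^bsub>obj X n\<^esub> x \<in> coboundaries X n"
    then show "\<exists>b\<in>coboundaries X n. z = b \<oplus>\<^bsub>obj X n\<^esub> x"
      using x by (intro bexI[OF _ z(2)]) (simp add: a_minus_def g.a_assoc g.l_neg)
  qed
  finally show ?thesis .
qed

lemma class_eq_iff: 
  assumes "x \<in> carrier (obj X n)" "y \<in> carrier (obj X n)"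
  shows "coboundaries X n +>\<^bsub>obj X n\<^esub> x = coboundaries X n +>\<^bsub>obj X n\<^esub> y
    \<longleftrightarrow> x \<ominus>\<^bsub>obj X n\<^esub> y \<in> coboundaries X n"
proof
  assume "coboundaries X n +>\<^bsub>obj X n\<^esub> x = coboundaries X n +>\<^bsub>obj X n\<^esub> y"
  moreover have "x \<in> coboundaries X n +>\<^bsub>obj X n\<^esub> x"
    using assms coboundaries_zero by (simp add: class_mem_iff g.r_neg a_minus_def)
  ultimately show "x \<ominus>\<^bsub>obj X n\<^esub> y \<in> coboundaries X n"
    using assms by (simp add: class_mem_iff)
next
  assume b: "x \<ominus>\<^bsub>obj X n\<^esub> y \<in> coboundaries X n"
  have "z \<ominus>\<^bsub>obj X n\<^esub> x \<in> coboundaries X n \<longleftrightarrow> z \<ominus>\<^bsub>obj X n\<^esub> y \<in> coboundaries X n"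
    if z: "z \<in> carrier (obj X n)" for z
  proof
    assume "z \<ominus>\<^bsub>obj X n\<^esub> x \<in> coboundaries X n"
    from coboundaries_add[OF this b] show "z \<ominus>\<^bsub>obj X n\<^esub> y \<in> coboundaries X n"
      using assms z by (simp add: a_minus_def g.a_assoc g.r_neg1)
  next
    assume "z \<ominus>\<^bsub>obj X n\<^esub> y \<in> coboundaries X n"
    from coboundaries_minus[OF this b] show "z \<ominus>\<^bsub>obj X n\<^esub> x \<in> coboundaries X n"
      using assms z by (simp add: a_minus_def g.minus_add g.a_ac g.r_neg1 g.r_neg2 a_cancel)
  qed
  then show "coboundaries X n +>\<^bsub>obj X n\<^esub> x = coboundaries X n +>\<^bsub>obj X n\<^esub> y"
    using assms by (auto simp: class_mem_iff)
qed

end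

locale cmap = X: cpx R X + Y: cpx R Y
  for R :: "('r, 'c) ring_scheme" and X :: "('r, 'm) cochain_complex" and Y :: "('r, 'n) cochain_complex" +
  fixes f
  assumes map_lhom: "f n \<in> lhom R (obj X n) (obj Y n)"
    and map_dif [simp]: "x \<in> carrier (obj X n) \<Longrightarrow> f (n + 1) (dif X n x) = dif Y n (f n x)"
begin

lemma map_closed [simp]: "x \<in> carrier (obj X n) \<Longrightarrow> f n x \<in> carrier (obj Y n)"
  using lhom_closed[OF map_lhom] .

lemma map_add [simp]: "x \<in> carrier (obj X n) \<Longrightarrow> y \<in> carrier (obj X n) \<Longrightarrow>
   f n (x \<oplus>\<^bsub>obj X n\<^esub> y) = f n x \<oplus>\<^bsub>obj Y n\<^esub> f n y"
  by (rule lhom_add[OF map_lhom])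

lemma map_zero [simp]: "f n \<zero>\<^bsub>obj X n\<^esub> = \<zero>\<^bsub>obj Y n\<^esub>"
  by (rule lhom_zero[OF map_lhom]) auto

lemma map_neg [simp]: "x \<in> carrier (obj X n) \<Longrightarrow> f n (\<ominus>\<^bsub>obj X n\<^esub> x) = \<ominus>\<^bsub>obj Y n\<^esub> f n x"
  by (rule lhom_neg[OF map_lhom]) auto

lemma map_minus [simp]: "x \<in> carrier (obj X n) \<Longrightarrow> y \<in> carrier (obj X n) \<Longrightarrow>
   f n (x \<ominus>\<^bsub>obj X n\<^esub> y) = f n x \<ominus>\<^bsub>obj Y n\<^esub> f n y"
  by (rule lhom_minus[OF map_lhom]) auto

lemma map_smult [simp]: "a \<in> carrier R \<Longrightarrow> x \<in> carrier (obj X n) \<Longrightarrow>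
   f n (a \<odot>\<^bsub>obj X n\<^esub> x) = a \<odot>\<^bsub>obj Y n\<^esub> f n x"
  by (rule lhom_smult[OF map_lhom])

lemma map_dif2 [simp]: "x \<in> carrier (obj X (n - 1)) \<Longrightarrow> f n (dif X (n - 1) x) = dif Y (n - 1) (f (n - 1) x)"
  using map_dif[of x "n - 1"] by simp

lemma map_cocycles: "x \<in> cocycles X n \<Longrightarrow> f n x \<in> cocycles Y n"
  unfolding cocycles_def using map_dif[of x n] by auto

lemma map_coboundaries: "x \<in> coboundaries X n \<Longrightarrow> f n x \<in> coboundaries Y n"
  unfolding coboundaries_def by auto

text \<open>\<open>f n\<close> maps a class into a class of \<open>Y\<close>, in general not onto
  it; adding all coboundaries of \<open>Y\<close> fills it up. Changing the representative by a
  coboundary of \<open>X\<close> is absorbed by the same sum.\<close>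

lemma cohomology_map_class:
  assumes "x \<in> carrier (obj X n)"
  shows "cohomology_map Y f n (coboundaries X n +>\<^bsub>obj X n\<^esub> x) = coboundaries Y n +>\<^bsub>obj Y n\<^esub> f n x"
proof -
  have "cohomology_map Y f n (coboundaries X n +>\<^bsub>obj X n\<^esub> x) =
     {b \<oplus>\<^bsub>obj Y n\<^esub> f n (c \<oplus>\<^bsub>obj X n\<^esub> x) | b c. b \<in> coboundaries Y n \<and> c \<in> coboundaries X n}"
    by (auto simp: cohomology_map_def set_add_def set_mult_def a_r_coset_def r_coset_def)
  also have "\<dots> = {b \<oplus>\<^bsub>obj Y n\<^esub> f n x | b. b \<in> coboundaries Y n}"
  proof (intro equalityI subsetI; elim CollectE exE conjE)
    fix z b c assume z: "z = b \<oplus>\<^bsub>obj Y n\<^esub> f n (c \<oplus>\<^bsub>obj X n\<^esub> x)" "b \<in> coboundaries Y n" "c \<in> coboundaries X n"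
    then have "z = (b \<oplus>\<^bsub>obj Y n\<^esub> f n c) \<oplus>\<^bsub>obj Y n\<^esub> f n x"
      using assms X.coboundaries_closed Y.coboundaries_closed by (simp add: Y.g.a_assoc)
    then show "z \<in> {b \<oplus>\<^bsub>obj Y n\<^esub> f n x | b. b \<in> coboundaries Y n}"
      using Y.coboundaries_add[OF z(2) map_coboundaries[OF z(3)]] by blast
  next
    fix z b assume z: "z = b \<oplus>\<^bsub>obj Y n\<^esub> f n x" "b \<in> coboundaries Y n"
    then have "z = b \<oplus>\<^bsub>obj Y n\<^esub> f n (\<zero>\<^bsub>obj X n\<^esub> \<oplus>\<^bsub>obj X n\<^esub> x)"
      using assms by simp
    then show "z \<in> {b \<oplus>\<^bsub>obj Y n\<^esub> f n (c \<oplus>\<^bsub>obj X n\<^esub> x) | b c. b \<in> coboundaries Y n \<and> c \<in> coboundaries X n}"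
      using z(2) X.coboundaries_zero by blast
  qed
  finally show ?thesis by (auto simp: a_r_coset_def r_coset_def)
qed

end

section \<open>Quasi-isomorphisms and homotopies on representatives\<close>

lemma chain_map_iff: "chain_map R X Y f \<longleftrightarrow> cmap R X Y f"
  unfolding chain_map_def cmap_def cpx_def cmap_axioms_def by auto

lemma chain_map_cpx: "chain_map R X Y f \<Longrightarrow> is_complex R X" "chain_map R X Y f \<Longrightarrow> is_complex R Y"
  by (auto simp: chain_map_def)

text \<open>Bijectivity on cohomology without cosets: trivial kernel, and surjectivity up to
  coboundaries. No scalars occur, so the notion is insensitive to restriction of scalars.\<close>

definition cohomology_bij :: "('r, 'm) cochain_complex \<Rightarrow> ('r, 'n) cochain_complex \<Rightarrow> (int \<Rightarrow> 'm \<Rightarrow> 'n) \<Rightarrow> bool" where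
  "cohomology_bij X Y f \<longleftrightarrow> (\<forall>n.
     (\<forall>x\<in>cocycles X n. f n x \<in> coboundaries Y n \<longrightarrow> x \<in> coboundaries X n) \<and>
     (\<forall>y\<in>cocycles Y n. \<exists>x\<in>cocycles X n. \<exists>b\<in>coboundaries Y n. y = f n x \<oplus>\<^bsub>obj Y n\<^esub> b))"

text \<open>A trivial kernel suffices for injectivity because two cocycles with the same image class
  differ by a cocycle whose image is a coboundary.\<close>

lemma (in cmap) bij_betw_cohomology_iff:
  "bij_betw (cohomology_map Y f n) (cohomology X n) (cohomology Y n) \<longleftrightarrow>
     (\<forall>x\<in>cocycles X n. f n x \<in> coboundaries Y n \<longrightarrow> x \<in> coboundaries X n) \<and>
     (\<forall>y\<in>cocycles Y n. \<exists>x\<in>cocycles X n. \<exists>b\<in>coboundaries Y n. y = f n x \<oplus>\<^bsub>obj Y n\<^esub> b)"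
  (is "_ \<longleftrightarrow> ?I \<and> ?S")
proof -
  note [simp] = X.cocyclesD Y.cocyclesD map_cocycles cohomology_map_class
  have I: "inj_on (cohomology_map Y f n) (cohomology X n) \<longleftrightarrow> ?I"
  proof
    assume inj: "inj_on (cohomology_map Y f n) (cohomology X n)"
    show ?I
    proof (intro ballI impI)
      fix x assume x: "x \<in> cocycles X n" "f n x \<in> coboundaries Y n"
      note X.zero_cocycle
      moreover have "cohomology_map Y f n (coboundaries X n +>\<^bsub>obj X n\<^esub> x) =
        cohomology_map Y f n (coboundaries X n +>\<^bsub>obj X n\<^esub> \<zero>\<^bsub>obj X n\<^esub>)"
        using x by (simp add: Y.class_eq_iff a_minus_def)
      ultimately have "coboundaries X n +>\<^bsub>obj X n\<^esub> x = coboundaries X n +>\<^bsub>obj X n\<^esub> \<zero>\<^bsub>obj X n\<^esub>"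
        using x by (intro inj_onD[OF inj]) (auto simp: cohomology_def)
      then show "x \<in> coboundaries X n"
        using x by (simp add: X.class_eq_iff a_minus_def)
    qed
  next
    assume I: ?I
    have "coboundaries X n +>\<^bsub>obj X n\<^esub> x = coboundaries X n +>\<^bsub>obj X n\<^esub> x'"
      if "x \<in> cocycles X n" "x' \<in> cocycles X n"
        "coboundaries Y n +>\<^bsub>obj Y n\<^esub> f n x = coboundaries Y n +>\<^bsub>obj Y n\<^esub> f n x'" for x x'
    proof -
      have "x \<ominus>\<^bsub>obj X n\<^esub> x' \<in> cocycles X n"
        using that(1,2) by (rule X.cocycles_minus)
      moreover have "f n (x \<ominus>\<^bsub>obj X n\<^esub> x') \<in> coboundaries Y n"
        using that by (simp add: Y.class_eq_iff)
      ultimately show ?thesis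
        using that I by (simp add: X.class_eq_iff)
    qed
    note eqI = this
    show "inj_on (cohomology_map Y f n) (cohomology X n)"
    proof (rule inj_onI)
      fix C C' assume "C \<in> cohomology X n" "C' \<in> cohomology X n"
        and eq: "cohomology_map Y f n C = cohomology_map Y f n C'"
      then obtain x x' where x: "x \<in> cocycles X n" "C = coboundaries X n +>\<^bsub>obj X n\<^esub> x"
          "x' \<in> cocycles X n" "C' = coboundaries X n +>\<^bsub>obj X n\<^esub> x'"
        by (auto simp: cohomology_def)
      show "C = C'"
        unfolding x(2,4) by (rule eqI) (use x eq in simp_all)
    qed
  qed
  have sub: "cohomology_map Y f n ` cohomology X n \<subseteq> cohomology Y n"
    by (auto simp: cohomology_def)
  have S: "cohomology_map Y f n ` cohomology X n = cohomology Y n \<longleftrightarrow> ?S"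
  proof
    assume eq: "cohomology_map Y f n ` cohomology X n = cohomology Y n"
    show ?S
    proof
      fix y assume y: "y \<in> cocycles Y n"
      then have "coboundaries Y n +>\<^bsub>obj Y n\<^esub> y \<in> cohomology_map Y f n ` cohomology X n"
        unfolding eq by (simp add: cohomology_def)
      then obtain x where x: "x \<in> cocycles X n" 
          "coboundaries Y n +>\<^bsub>obj Y n\<^esub> y = coboundaries Y n +>\<^bsub>obj Y n\<^esub> f n x"
        by (auto simp: cohomology_def)
      then have "y \<ominus>\<^bsub>obj Y n\<^esub> f n x \<in> coboundaries Y n"
        using y by (simp add: Y.class_eq_iff)
      moreover have "y = f n x \<oplus>\<^bsub>obj Y n\<^esub> (y \<ominus>\<^bsub>obj Y n\<^esub> f n x)"
        using x y by (simp add: a_minus_def Y.g.a_ac Y.g.r_neg2 Y.g.r_neg)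
      ultimately show "\<exists>x\<in>cocycles X n. \<exists>b\<in>coboundaries Y n. y = f n x \<oplus>\<^bsub>obj Y n\<^esub> b"
        using x(1) by blast
    qed
  next
    assume S: ?S
    show "cohomology_map Y f n ` cohomology X n = cohomology Y n"
    proof (intro equalityI sub subsetI)
      fix C assume "C \<in> cohomology Y n"
      then obtain y where y: "y \<in> cocycles Y n" "C = coboundaries Y n +>\<^bsub>obj Y n\<^esub> y"
        by (auto simp: cohomology_def)
      then obtain x b where x: "x \<in> cocycles X n" "b \<in> coboundaries Y n" "y = f n x \<oplus>\<^bsub>obj Y n\<^esub> b"
        using S by blast
      then have "C = cohomology_map Y f n (coboundaries X n +>\<^bsub>obj X n\<^esub> x)"
        using y Y.coboundaries_closed[OF x(2)]
        by (simp add: Y.class_eq_iff a_minus_def Y.g.a_ac Y.g.r_neg2 Y.g.r_neg)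
      then show "C \<in> cohomology_map Y f n ` cohomology X n"
        using x(1) unfolding cohomology_def by blast
    qed
  qed
  show ?thesis unfolding bij_betw_def I S ..
qed

lemma quasi_iso_iff: "quasi_iso R X Y f \<longleftrightarrow> chain_map R X Y f \<and> cohomology_bij X Y f"
proof (cases "chain_map R X Y f")
  case True
  then interpret cmap R X Y f by (simp add: chain_map_iff)
  show ?thesis
    unfolding quasi_iso_def cohomology_bij_def bij_betw_cohomology_iff ..
qed (simp add: quasi_iso_def)

lemma chain_map_comp:
  assumes "chain_map R X Y f" "chain_map R Y Z g"
  shows "chain_map R X Z (comp_map X g f)"
proof -
  interpret f: cmap R X Y f using assms by (simp add: chain_map_iff)
  interpret g: cmap R Y Z g using assms by (simp add: chain_map_iff)
  show ?thesis
    unfolding chain_map_iff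
    by unfold_locales
      (auto simp: comp_map_def compose_def intro!: lhom_restrict_comp[OF f.map_lhom g.map_lhom] f.X.left_module)
qed

lemma chain_map_id: "is_complex R X \<Longrightarrow> chain_map R X X (id_map X)"
proof -
  assume "is_complex R X"
  then interpret cpx R X by unfold_locales
  show ?thesis
    unfolding chain_map_iff
    by unfold_locales (auto simp: id_map_def intro!: lhom_restrict_id left_module)
qed

lemma homotopicD:
  assumes "homotopic R X Y f g"
  obtains s where "\<And>n. s n \<in> lhom R (obj X n) (obj Y (n - 1))"
    "\<And>n x. x \<in> carrier (obj X n) \<Longrightarrow> f n x = g n x \<oplus>\<^bsub>obj Y n\<^esub>
               (dif Y (n - 1) (s n x) \<oplus>\<^bsub>obj Y n\<^esub> s (n + 1) (dif X n x))"
  using assms unfolding homotopic_def by blast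

lemma homotopic_refl:
  assumes "chain_map R X Y f"
  shows "homotopic R X Y f f"
proof -
  interpret cmap R X Y f using assms by (simp add: chain_map_iff)
  define s where "s = (\<lambda>n. \<lambda>x\<in>carrier (obj X n). \<zero>\<^bsub>obj Y (n - 1)\<^esub>)"
  have z: "dif Y (n - 1) \<zero>\<^bsub>obj Y (n - 1)\<^esub> = \<zero>\<^bsub>obj Y n\<^esub>" for n
    using Y.dif_zero[of "n - 1"] by simp
  have "s n \<in> lhom R (obj X n) (obj Y (n - 1))" for n
    unfolding s_def by (intro lhom_restrict_zero X.left_module Y.left_module)
  then show ?thesis
    unfolding homotopic_def using assms
    by (auto intro!: exI[of _ s] simp: z) (simp_all add: s_def z)
qed

text \<open>On a cocycle the summand \<open>s (n + 1) (dif X n x)\<close> of the homotopy vanishes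
  and the other summand is a coboundary.\<close>

lemma homotopic_cocycle:
  assumes "homotopic R X Y f g" "x \<in> cocycles X n"
  obtains b where "b \<in> coboundaries Y n" "f n x = g n x \<oplus>\<^bsub>obj Y n\<^esub> b"
proof -
  interpret cmap R X Y f using assms by (simp add: chain_map_iff homotopic_def)
  obtain s where s: "\<And>n. s n \<in> lhom R (obj X n) (obj Y (n - 1))"
    "\<And>n x. x \<in> carrier (obj X n) \<Longrightarrow> f n x = g n x \<oplus>\<^bsub>obj Y n\<^esub>
               (dif Y (n - 1) (s n x) \<oplus>\<^bsub>obj Y n\<^esub> s (n + 1) (dif X n x))"
    using homotopicD[OF assms(1)] by blast
  have "s (n + 1) (dif X n x) = \<zero>\<^bsub>obj Y n\<^esub>"
    using lhom_zero[OF s(1)[of "n + 1"]] X.cocyclesD[OF assms(2)] by simp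
  moreover have "s n x \<in> carrier (obj Y (n - 1))"
    using lhom_closed[OF s(1)] X.cocyclesD[OF assms(2)] by simp
  ultimately show ?thesis
    using that[of "dif Y (n - 1) (s n x)"] s(2)[of x n] X.cocyclesD[OF assms(2)]
    by (simp add: coboundaries_def)
qed

text \<open>Two out of three for a triangle that commutes up to homotopy: on cohomology,
  \<open>h\<close> is \<open>k\<close> composed with the inverse of \<open>f\<close>.\<close>

lemma cohomology_bij_cancel:
  assumes f: "chain_map R X Y f" "cohomology_bij X Y f" and h: "chain_map R Y Z h"
    and k: "chain_map R X Z k" "cohomology_bij X Z k"
    and hk: "homotopic R X Z (comp_map X h f) k"
  shows "cohomology_bij Y Z h"
proof -
  interpret f: cmap R X Y f using f by (simp add: chain_map_iff)
  interpret h: cmap R Y Z h using h by (simp add: chain_map_iff)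
  interpret k: cmap R X Z k using k by (simp add: chain_map_iff)
  have hf: "\<exists>b\<in>coboundaries Z n. h n (f n x) = k n x \<oplus>\<^bsub>obj Z n\<^esub> b" if "x \<in> cocycles X n" for n x
    using homotopic_cocycle[OF hk that] f.X.cocyclesD[OF that] by (auto simp: comp_map_def compose_def)
  have "y \<in> coboundaries Y n" if y: "y \<in> cocycles Y n" "h n y \<in> coboundaries Z n" for n y
  proof -
    obtain x b where x: "x \<in> cocycles X n" "b \<in> coboundaries Y n" "y = f n x \<oplus>\<^bsub>obj Y n\<^esub> b"
      using f(2) y(1) unfolding cohomology_bij_def by blast
    obtain b' where b': "b' \<in> coboundaries Z n" "h n (f n x) = k n x \<oplus>\<^bsub>obj Z n\<^esub> b'"
      using hf[OF x(1)] by blast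
    note [simp] = f.X.cocyclesD(1)[OF x(1)] f.Y.coboundaries_closed[OF x(2)] h.Y.coboundaries_closed[OF b'(1)]
    have "k n x = h n y \<ominus>\<^bsub>obj Z n\<^esub> (h n b \<oplus>\<^bsub>obj Z n\<^esub> b')"
      by (simp add: x(3) b'(2) a_minus_def h.Y.g.minus_add h.Y.g.a_ac h.Y.g.r_neg h.Y.g.r_neg2 h.Y.g.r_neg1 h.Y.a_cancel h.Y.a_cancel2)
    also have "\<dots> \<in> coboundaries Z n"
      using y(2) b'(1) h.map_coboundaries[OF x(2)] by (intro h.Y.coboundaries_minus h.Y.coboundaries_add)
    finally have "x \<in> coboundaries X n"
      using k(2) x(1) unfolding cohomology_bij_def by blast
    then show ?thesis
      unfolding x(3) using x(2) by (intro f.Y.coboundaries_add f.map_coboundaries)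
  qed
  moreover have "\<exists>y\<in>cocycles Y n. \<exists>b\<in>coboundaries Z n. z = h n y \<oplus>\<^bsub>obj Z n\<^esub> b" if z: "z \<in> cocycles Z n" for n z
  proof -
    obtain x b where x: "x \<in> cocycles X n" "b \<in> coboundaries Z n" "z = k n x \<oplus>\<^bsub>obj Z n\<^esub> b"
      using k(2) z unfolding cohomology_bij_def by blast
    obtain b' where b': "b' \<in> coboundaries Z n" "h n (f n x) = k n x \<oplus>\<^bsub>obj Z n\<^esub> b'"
      using hf[OF x(1)] by blast
    note [simp] = f.X.cocyclesD(1)[OF x(1)] h.Y.coboundaries_closed[OF x(2)] h.Y.coboundaries_closed[OF b'(1)]
    have "z = h n (f n x) \<oplus>\<^bsub>obj Z n\<^esub> (b \<ominus>\<^bsub>obj Z n\<^esub> b')"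
      by (simp add: x(3) b'(2) a_minus_def h.Y.g.a_ac h.Y.g.r_neg h.Y.a_cancel h.Y.a_cancel2)
    then show ?thesis
      using f.map_cocycles[OF x(1)] h.Y.coboundaries_minus[OF x(2) b'(1)] by blast
  qed
  ultimately show ?thesis unfolding cohomology_bij_def by blast
qed

lemma cohomology_bij_id: "is_complex R X \<Longrightarrow> cohomology_bij X X (id_map X)"
proof -
  assume "is_complex R X"
  then interpret cpx R X by unfold_locales
  show ?thesis
    unfolding cohomology_bij_def
  proof (intro allI conjI ballI impI)
    fix n y assume "y \<in> cocycles X n"
    then show "\<exists>x\<in>cocycles X n. \<exists>b\<in>coboundaries X n. y = id_map X n x \<oplus>\<^bsub>obj X n\<^esub> b"
      by (intro bexI[of _ y] bexI[OF _ coboundaries_zero]) (auto simp: id_map_def cocycles_def)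
  qed (auto simp: id_map_def cocycles_def)
qed

section \<open>The mapping fibre\<close>

text \<open>Projectivity and K-injectivity only concern modules in the universe \<open>'u\<close>, so direct sums have to
  be formed inside \<open>'u\<close>.\<close>

locale pairing =
  fixes pr :: "'u \<Rightarrow> 'u \<Rightarrow> 'u" and p1 p2 :: "'u \<Rightarrow> 'u"
  assumes p1 [simp]: "p1 (pr x y) = x" and p2 [simp]: "p2 (pr x y) = y"
    and pr [simp]: "pr (p1 z) (p2 z) = z"
begin

lemma pr_eq_iff: "pr x y = z \<longleftrightarrow> x = p1 z \<and> y = p2 z"
  by (metis p1 p2 pr)

definition dsum :: "('r, 'u) module \<Rightarrow> ('r, 'u) module \<Rightarrow> ('r, 'u) module" where
  "dsum M N = \<lparr>carrier = {z. p1 z \<in> carrier M \<and> p2 z \<in> carrier N},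
     monoid.mult = undefined, one = undefined, zero = pr \<zero>\<^bsub>M\<^esub> \<zero>\<^bsub>N\<^esub>,
     add = (\<lambda>z w. pr (p1 z \<oplus>\<^bsub>M\<^esub> p1 w) (p2 z \<oplus>\<^bsub>N\<^esub> p2 w)),
     smult = (\<lambda>a z. pr (a \<odot>\<^bsub>M\<^esub> p1 z) (a \<odot>\<^bsub>N\<^esub> p2 z))\<rparr>"

lemma dsum_simps [simp]:
  "z \<in> carrier (dsum M N) \<longleftrightarrow> p1 z \<in> carrier M \<and> p2 z \<in> carrier N"
  "\<zero>\<^bsub>dsum M N\<^esub> = pr \<zero>\<^bsub>M\<^esub> \<zero>\<^bsub>N\<^esub>"
  "z \<oplus>\<^bsub>dsum M N\<^esub> w = pr (p1 z \<oplus>\<^bsub>M\<^esub> p1 w) (p2 z \<oplus>\<^bsub>N\<^esub> p2 w)"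
  "a \<odot>\<^bsub>dsum M N\<^esub> z = pr (a \<odot>\<^bsub>M\<^esub> p1 z) (a \<odot>\<^bsub>N\<^esub> p2 z)"
  by (simp_all add: dsum_def)

lemma left_module_dsum:
  assumes "left_module R M" "left_module R N"
  shows "left_module R (dsum M N)"
proof -
  interpret M: left_module R M by fact
  interpret N: left_module R N by fact
  have inv: "\<exists>y\<in>carrier (dsum M N). y \<oplus>\<^bsub>dsum M N\<^esub> x = \<zero>\<^bsub>dsum M N\<^esub>" if "x \<in> carrier (dsum M N)" for x
    using that by (intro bexI[of _ "pr (\<ominus>\<^bsub>M\<^esub> p1 x) (\<ominus>\<^bsub>N\<^esub> p2 x)"]) (auto simp: M.M.l_neg N.M.l_neg)
  have "abelian_group (dsum M N)"
    by (rule abelian_groupI) (use inv in \<open>auto simp: M.M.a_assoc N.M.a_assoc intro: arg_cong2[of _ _ _ _ pr] M.M.a_comm N.M.a_comm\<close>)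
  then show ?thesis
    by (intro left_moduleI)
      (auto simp: M.R.ring_axioms M.lm_smult_closed N.lm_smult_closed M.lm_smult_l_distr N.lm_smult_l_distr
        M.lm_smult_r_distr N.lm_smult_r_distr M.lm_smult_assoc N.lm_smult_assoc M.lm_smult_one N.lm_smult_one)
qed

lemma lhom_pr:
  assumes "f \<in> lhom R K M" "g \<in> lhom R K N" "left_module R K"
  shows "(\<lambda>x\<in>carrier K. pr (f x) (g x)) \<in> lhom R K (dsum M N)"
proof -
  interpret K: left_module R K by fact
  show ?thesis
    using assms by (intro lhomI) (auto simp: lhom_closed lhom_add lhom_smult K.lm_smult_closed)
qed

lemma lhom_p1: "left_module R M \<Longrightarrow> left_module R N \<Longrightarrow> (\<lambda>z\<in>carrier (dsum M N). p1 z) \<in> lhom R (dsum M N) M"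
  by (intro lhomI) (auto dest: left_module.lm_smult_closed left_module_group simp: agroup_a_closed)

lemma lhom_p2: "left_module R M \<Longrightarrow> left_module R N \<Longrightarrow> (\<lambda>z\<in>carrier (dsum M N). p2 z) \<in> lhom R (dsum M N) N"
  by (intro lhomI) (auto dest: left_module.lm_smult_closed left_module_group simp: agroup_a_closed)

text \<open>The mapping cone of \<open>f\<close> shifted by one.  With this shift a chain map \<open>X \<rightarrow> J\<close> gives a chain map
  \<open>fibre X Y f \<rightarrow> J\<close> of degree 0, without signs.\<close>

definition fibre :: "('r, 'u) cochain_complex \<Rightarrow> ('r, 'u) cochain_complex \<Rightarrow> (int \<Rightarrow> 'u \<Rightarrow> 'u) \<Rightarrow>
    ('r, 'u) cochain_complex" where
  "fibre X Y f = \<lparr>obj = (\<lambda>n. dsum (obj X n) (obj Y (n - 1))),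
     dif = (\<lambda>n. \<lambda>z\<in>carrier (dsum (obj X n) (obj Y (n - 1))).
       pr (dif X n (p1 z)) (f n (p1 z) \<ominus>\<^bsub>obj Y n\<^esub> dif Y (n - 1) (p2 z)))\<rparr>"

lemma obj_fibre [simp]: "obj (fibre X Y f) n = dsum (obj X n) (obj Y (n - 1))"
  by (simp add: fibre_def)

lemma dif_fibre [simp]: "p1 z \<in> carrier (obj X n) \<Longrightarrow> p2 z \<in> carrier (obj Y (n - 1)) \<Longrightarrow>
    dif (fibre X Y f) n z = pr (dif X n (p1 z)) (f n (p1 z) \<ominus>\<^bsub>obj Y n\<^esub> dif Y (n - 1) (p2 z))"
  by (simp add: fibre_def)

lemma is_complex_fibre:
  assumes "chain_map R X Y f"
  shows "is_complex R (fibre X Y f)"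
proof -
  interpret cmap R X Y f using assms by (simp add: chain_map_iff)
  have "dif (fibre X Y f) n \<in> lhom R (obj (fibre X Y f) n) (obj (fibre X Y f) (n + 1))" for n
  proof -
    let ?F = "dsum (obj X n) (obj Y (n - 1))"
    have F: "left_module R ?F" by (intro left_module_dsum X.left_module Y.left_module)
    have P: "(\<lambda>z\<in>carrier ?F. p1 z) \<in> lhom R ?F (obj X n)" "(\<lambda>z\<in>carrier ?F. p2 z) \<in> lhom R ?F (obj Y (n - 1))"
      by (intro lhom_p1 lhom_p2 X.left_module Y.left_module)+
    have "dif Y (n - 1) \<in> lhom R (obj Y (n - 1)) (obj Y n)"
      using Y.dif_lhom[of "n - 1"] by simp
    from lhom_pr[OF lhom_restrict_comp[OF P(1) X.dif_lhom F]
        lhom_restrict_add[OF lhom_restrict_comp[OF P(1) map_lhom F]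
         lhom_restrict_neg[OF lhom_restrict_comp[OF P(2) this F] F Y.left_module] F Y.left_module] F]
    show ?thesis by (simp add: fibre_def a_minus_def cong: restrict_cong)
  qed
  moreover have "dif (fibre X Y f) (n + 1) (dif (fibre X Y f) n z) = \<zero>\<^bsub>obj (fibre X Y f) (n + 2)\<^esub>"
    if "z \<in> carrier (obj (fibre X Y f) n)" for n z
    using that by (simp add: pr_eq_iff a_minus_def Y.g.r_neg add.commute[of 1 n] add.commute[of 2 n])
  moreover have "left_module R (obj (fibre X Y f) n)" for n
    unfolding obj_fibre by (intro left_module_dsum X.left_module Y.left_module)
  ultimately show ?thesis unfolding is_complex_def by blast
qed

text \<open>The long exact sequence unwound: a cocycle (x, y) has
  \<open>f n x = dif Y (n - 1) y\<close>, so injectivity on cohomology bounds x, and surjectivity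
  one degree lower corrects the primitive so that it also accounts for y.\<close>

lemma acyclic_fibre:
  assumes "quasi_iso R X Y f"
  shows "acyclic_complex (fibre X Y f)"
proof -
  have cm: "chain_map R X Y f" and bij: "cohomology_bij X Y f" using assms by (auto simp: quasi_iso_iff)
  interpret cmap R X Y f using cm by (simp add: chain_map_iff)
  interpret F: cpx R "fibre X Y f" by unfold_locales (rule is_complex_fibre[OF cm])
  have "z \<in> coboundaries (fibre X Y f) n" if z: "z \<in> cocycles (fibre X Y f) n" for n z
  proof -
    define x y where "x = p1 z" and "y = p2 z"
    have xy: "x \<in> carrier (obj X n)" "y \<in> carrier (obj Y (n - 1))"
      using z by (auto simp: cocycles_def x_def y_def)
    have "dif X n x = \<zero>\<^bsub>obj X (n + 1)\<^esub>" and "f n x \<ominus>\<^bsub>obj Y n\<^esub> dif Y (n - 1) y = \<zero>\<^bsub>obj Y n\<^esub>"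
      using z xy by (auto simp: cocycles_def pr_eq_iff simp flip: x_def y_def)
    then have xc: "x \<in> cocycles X n" and fx: "f n x = dif Y (n - 1) y"
      using xy Y.minus_eq_zeroD[of "f n x" n "dif Y (n - 1) y"] by (auto simp: cocycles_def)
    have "f n x \<in> coboundaries Y n" unfolding fx using xy by (simp add: coboundaries_def)
    then have "x \<in> coboundaries X n" using bij xc unfolding cohomology_bij_def by blast
    then obtain x' where x': "x' \<in> carrier (obj X (n - 1))" "x = dif X (n - 1) x'"
      by (auto simp: coboundaries_def)
    \<comment> \<open>The primitive \<open>x'\<close> is determined only up to cocycles. Its failure
      to match \<open>y\<close> is a cocycle of \<open>Y\<close>, which surjectivity splits into the
      image of a cocycle \<open>x0\<close>, to be subtracted from \<open>x'\<close>, and a boundary,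
      which supplies the second component \<open>y0\<close>.\<close>
    have "f (n - 1) x' \<ominus>\<^bsub>obj Y (n - 1)\<^esub> y \<in> cocycles Y (n - 1)"
      using x' xy fx by (intro Y.cocyclesI) (simp_all add: Y.g.r_neg a_minus_def)
    then obtain x0 b where x0: "x0 \<in> cocycles X (n - 1)" "b \<in> coboundaries Y (n - 1)"
      "f (n - 1) x' \<ominus>\<^bsub>obj Y (n - 1)\<^esub> y = f (n - 1) x0 \<oplus>\<^bsub>obj Y (n - 1)\<^esub> b"
      using bij unfolding cohomology_bij_def by blast
    obtain y0 where y0: "y0 \<in> carrier (obj Y (n - 1 - 1))" "b = dif Y (n - 1 - 1) y0"
      using x0(2) by (auto simp: coboundaries_def)
    note c = X.cocyclesD[OF x0(1)] Y.coboundaries_closed[OF x0(2)]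
    have "y = f (n - 1) x' \<ominus>\<^bsub>obj Y (n - 1)\<^esub> (f (n - 1) x' \<ominus>\<^bsub>obj Y (n - 1)\<^esub> y)"
      using x' xy by (simp add: a_minus_def Y.g.minus_add Y.g.a_ac Y.g.r_neg2 Y.g.r_neg)
    also have "\<dots> = f (n - 1) (x' \<ominus>\<^bsub>obj X (n - 1)\<^esub> x0) \<ominus>\<^bsub>obj Y (n - 1)\<^esub> b"
      unfolding x0(3) using x' c by (simp add: a_minus_def Y.g.minus_add Y.g.a_ac)
    finally have "y = f (n - 1) (x' \<ominus>\<^bsub>obj X (n - 1)\<^esub> x0) \<ominus>\<^bsub>obj Y (n - 1)\<^esub> dif Y (n - 1 - 1) y0"
      by (simp add: y0(2))
    moreover have "x = dif X (n - 1) (x' \<ominus>\<^bsub>obj X (n - 1)\<^esub> x0)"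
      using x' c by (simp add: a_minus_def)
    ultimately have zeq: "z = dif (fibre X Y f) (n - 1) (pr (x' \<ominus>\<^bsub>obj X (n - 1)\<^esub> x0) y0)"
      using x' c y0(1) by (simp add: eq_commute[of z] pr_eq_iff x_def y_def)
    show ?thesis
      by (rule F.coboundariesI[OF _ zeq]) (use x' c y0(1) in auto)
  qed
  then show ?thesis
    unfolding acyclic_complex_def using F.coboundaries_cocycles by blast
qed

end

section \<open>Complexes into which maps from acyclic complexes are null-homotopic\<close>

text \<open>The degree 0 part of K-injectivity; by shifting the argument it is all of it.\<close>

definition null_from_acyclic :: "('r, 'c) ring_scheme \<Rightarrow> ('r, 'u) cochain_complex \<Rightarrow> bool" where
  "null_from_acyclic R J \<longleftrightarrow> is_complex R J \<and>
     (\<forall>(X :: ('r, 'u) cochain_complex) f. chain_map R X J f \<and> acyclic_complex X \<longrightarrow>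
        (\<exists>s. (\<forall>n. s n \<in> lhom R (obj X n) (obj J (n - 1))) \<and>
             (\<forall>n. \<forall>x\<in>carrier (obj X n).
                f n x = dif J (n - 1) (s n x) \<oplus>\<^bsub>obj J n\<^esub> s (n + 1) (dif X n x))))"

lemma null_from_acyclicE:
  fixes J X :: "('r, 'u) cochain_complex"
  assumes "null_from_acyclic R J" "chain_map R X J f" "acyclic_complex X"
  obtains s where "\<And>n. s n \<in> lhom R (obj X n) (obj J (n - 1))"
    "\<And>n x. x \<in> carrier (obj X n) \<Longrightarrow> f n x = dif J (n - 1) (s n x) \<oplus>\<^bsub>obj J n\<^esub> s (n + 1) (dif X n x)"
  using assms unfolding null_from_acyclic_def by blast

text \<open>A chain map is a cocycle of degree 0 in the Hom complex, and a cochain of degree -1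
  bounding it is a null-homotopy. Since -1 is odd, the differential there carries a plus sign, as
  the homotopy formula requires.\<close>

lemma K_injective_null_from_acyclic:
  fixes J :: "('r, 'u) cochain_complex"
  assumes "K_injective R J"
  shows "null_from_acyclic R J"
  unfolding null_from_acyclic_def
proof (intro conjI allI impI; (elim conjE)?)
  show "is_complex R J" using assms by (simp add: K_injective_def)
next
  fix X :: "('r, 'u) cochain_complex" and f
  assume f: "chain_map R X J f" and X: "acyclic_complex X"
  interpret cmap R X J f using f by (simp add: chain_map_iff)
  have ac: "acyclic_complex (hom_complex R X J)"
    using assms X X.is_complex unfolding K_injective_def by blast
  have fc: "f \<in> carrier (hom_group R X J 0)"
    by (simp add: hom_group_def map_lhom)
  have "f \<in> cocycles (hom_complex R X J) 0"
    using fc by (auto simp: cocycles_def hom_complex_def hom_group_def a_minus_def Y.g.r_neg fun_eq_iff)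
  then have "f \<in> coboundaries (hom_complex R X J) 0"
    using ac by (simp add: acyclic_complex_def)
  then obtain s where s: "s \<in> carrier (hom_group R X J (-1))" "f = dif (hom_complex R X J) (-1) s"
    by (auto simp: coboundaries_def hom_complex_def)
  have "s n \<in> lhom R (obj X n) (obj J (n - 1))" for n
    using s(1) by (simp add: hom_group_def)
  moreover have "f n x = dif J (n - 1) (s n x) \<oplus>\<^bsub>obj J n\<^esub> s (n + 1) (dif X n x)"
    if "x \<in> carrier (obj X n)" for n x
    using fun_cong[OF fun_cong[OF s(2)], of n x] that s(1) by (simp add: hom_complex_def)
  ultimately show "\<exists>s. (\<forall>n. s n \<in> lhom R (obj X n) (obj J (n - 1))) \<and>
             (\<forall>n. \<forall>x\<in>carrier (obj X n).
                f n x = dif J (n - 1) (s n x) \<oplus>\<^bsub>obj J n\<^esub> s (n + 1) (dif X n x))"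
    by blast
qed

section \<open>Extending chain maps along quasi-isomorphisms\<close>

context pairing
begin

text \<open>A null-homotopy on the mapping fibre of \<open>f\<close> restricts to the extension on \<open>Y\<close> and to the
  homotopy on \<open>X\<close>.\<close>

lemma extend_along_quasi_iso:
  fixes X Y J :: "('r, 'u) cochain_complex"
  assumes J: "null_from_acyclic R J" and f: "quasi_iso R X Y f" and g: "chain_map R X J g"
  obtains h where "chain_map R Y J h" "homotopic R X J (comp_map X h f) g"
proof -
  have cf: "chain_map R X Y f" using f by (simp add: quasi_iso_def)
  interpret f: cmap R X Y f using cf by (simp add: chain_map_iff)
  interpret g: cmap R X J g using g by (simp add: chain_map_iff)
  interpret F: cpx R "fibre X Y f" by unfold_locales (rule is_complex_fibre[OF cf])
  \<comment> \<open>\<open>G\<close> is the projection of the fibre to \<open>X\<close> followed by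
    \<open>g\<close>. It is a chain map because the first component of the fibre's differential is
    that of \<open>X\<close>.\<close>
  define G where "G = (\<lambda>n. \<lambda>z\<in>carrier (obj (fibre X Y f) n). g n (p1 z))"
  have "cmap R (fibre X Y f) J G"
  proof unfold_locales
    show "G n \<in> lhom R (obj (fibre X Y f) n) (obj J n)" for n
      using lhom_restrict_comp[OF lhom_p1 g.map_lhom F.left_module[unfolded obj_fibre]]
        f.X.left_module f.Y.left_module by (simp add: G_def cong: restrict_cong)
  qed (auto simp: G_def)
  then have "chain_map R (fibre X Y f) J G" by (simp add: chain_map_iff)
  from null_from_acyclicE[OF J this acyclic_fibre[OF f]]
  obtain s where s: "\<And>n. s n \<in> lhom R (obj (fibre X Y f) n) (obj J (n - 1))"
    "\<And>n z. z \<in> carrier (obj (fibre X Y f) n) \<Longrightarrow>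
       G n z = dif J (n - 1) (s n z) \<oplus>\<^bsub>obj J n\<^esub> s (n + 1) (dif (fibre X Y f) n z)"
    by metis
  have s1: "s (n + 1) \<in> lhom R (dsum (obj X (n + 1)) (obj Y n)) (obj J n)" for n
    using s(1)[of "n + 1"] by simp
  have s0: "s n \<in> lhom R (dsum (obj X n) (obj Y (n - 1))) (obj J (n - 1))" for n
    using s(1)[of n] by simp
  \<comment> \<open>\<open>Y\<close> in degree \<open>n\<close> is the second summand of the fibre
    in degree \<open>n + 1\<close>, hence the index in \<open>h\<close>. The sign in
    \<open>k\<close> comes from solving the null-homotopy identity for the composite of
    \<open>f\<close> and \<open>h\<close>.\<close>
  define h where "h = (\<lambda>n. \<lambda>y\<in>carrier (obj Y n). s (n + 1) (pr \<zero>\<^bsub>obj X (n + 1)\<^esub> y))"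
  define k where "k = (\<lambda>n. \<lambda>x\<in>carrier (obj X n). \<ominus>\<^bsub>obj J (n - 1)\<^esub> s n (pr x \<zero>\<^bsub>obj Y (n - 1)\<^esub>))"
  have h_lhom: "h n \<in> lhom R (obj Y n) (obj J n)" for n
    using lhom_restrict_comp[OF lhom_pr[OF lhom_restrict_zero[OF f.Y.left_module f.X.left_module[of "n + 1"]]
      lhom_restrict_id[OF f.Y.left_module] f.Y.left_module] s1 f.Y.left_module]
    by (simp add: h_def cong: restrict_cong)
  have k_lhom: "k n \<in> lhom R (obj X n) (obj J (n - 1))" for n
    using lhom_restrict_neg[OF lhom_restrict_comp[OF lhom_pr[OF lhom_restrict_id[OF f.X.left_module[of n]]
      lhom_restrict_zero[OF f.X.left_module f.Y.left_module[of "n - 1"]] f.X.left_module] s0 f.X.left_module]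
      f.X.left_module g.Y.left_module]
    by (simp add: k_def cong: restrict_cong)
  have [simp]: "s (n + 1) (pr u v) \<in> carrier (obj J n)" if "u \<in> carrier (obj X (n + 1))" "v \<in> carrier (obj Y n)" for n u v
    using that by (intro lhom_closed[OF s1]) auto
  have [simp]: "s n (pr u v) \<in> carrier (obj J (n - 1))" if "u \<in> carrier (obj X n)" "v \<in> carrier (obj Y (n - 1))" for n u v
    using that by (intro lhom_closed[OF s0]) auto
  have dh: "h (n + 1) (dif Y n y) = dif J n (h n y)" if y: "y \<in> carrier (obj Y n)" for n y
  proof -
    \<comment> \<open>On (0, y) the map \<open>G\<close> vanishes and the fibre's differential is
      (0, - dif y); the null-homotopy identity there says precisely that \<open>h\<close> commutes
      with the differentials.\<close>
    have "G (n + 1) (pr \<zero>\<^bsub>obj X (n + 1)\<^esub> y) = dif J n (s (n + 1) (pr \<zero>\<^bsub>obj X (n + 1)\<^esub> y)) \<oplus>\<^bsub>obj J (n + 1)\<^esub>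
        s (n + 1 + 1) (pr \<zero>\<^bsub>obj X (n + 1 + 1)\<^esub> (\<ominus>\<^bsub>obj Y (n + 1)\<^esub> dif Y n y))"
      using s(2)[of "pr \<zero>\<^bsub>obj X (n + 1)\<^esub> y" "n + 1"] y f.X.dif_zero[of "n + 1"] by (simp add: a_minus_def)
    moreover have "pr \<zero>\<^bsub>obj X (n + 1 + 1)\<^esub> (\<ominus>\<^bsub>obj Y (n + 1)\<^esub> dif Y n y) =
      \<ominus>\<^bsub>dsum (obj X (n + 1 + 1)) (obj Y (n + 1))\<^esub> (pr \<zero>\<^bsub>obj X (n + 1 + 1)\<^esub> (dif Y n y))"
      using y left_module_group[OF left_module_dsum[OF f.X.left_module[of "n + 1 + 1"] f.Y.left_module[of "n + 1"]]]
      by (intro sym[OF abelian_group.minus_equality]) (auto simp: f.Y.g.l_neg)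
    moreover have "s (n + 1 + 1) (\<ominus>\<^bsub>dsum (obj X (n + 1 + 1)) (obj Y (n + 1))\<^esub> (pr \<zero>\<^bsub>obj X (n + 1 + 1)\<^esub> (dif Y n y)))
       = \<ominus>\<^bsub>obj J (n + 1)\<^esub> s (n + 1 + 1) (pr \<zero>\<^bsub>obj X (n + 1 + 1)\<^esub> (dif Y n y))"
      using y left_module_group[OF left_module_dsum[OF f.X.left_module[of "n + 1 + 1"] f.Y.left_module[of "n + 1"]]]
      by (intro lhom_neg[OF s1]) auto
    ultimately have "\<zero>\<^bsub>obj J (n + 1)\<^esub> = dif J n (h n y) \<ominus>\<^bsub>obj J (n + 1)\<^esub> h (n + 1) (dif Y n y)"
      using y by (simp add: G_def h_def a_minus_def)
    then show ?thesis
      using g.Y.minus_eq_zeroD[of "dif J n (h n y)" "n + 1" "h (n + 1) (dif Y n y)"] y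
        lhom_closed[OF h_lhom] by simp
  qed
  then have hc: "chain_map R Y J h"
    unfolding chain_map_iff by unfold_locales (auto simp: h_lhom)
  have "h n (f n x) = g n x \<oplus>\<^bsub>obj J n\<^esub> (dif J (n - 1) (k n x) \<oplus>\<^bsub>obj J n\<^esub> k (n + 1) (dif X n x))"
    if x: "x \<in> carrier (obj X n)" for n x
  proof -
    \<comment> \<open>On (x, 0) the fibre's differential is (dif x, f x), and its second component
      contributes \<open>h n (f n x)\<close>.\<close>
    have "g n x = dif J (n - 1) (s n (pr x \<zero>\<^bsub>obj Y (n - 1)\<^esub>)) \<oplus>\<^bsub>obj J n\<^esub>
        s (n + 1) (pr (dif X n x) (f n x))"
      using s(2)[of "pr x \<zero>\<^bsub>obj Y (n - 1)\<^esub>" n] x f.Y.dif_zero[of "n - 1"] by (simp add: a_minus_def G_def)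
    moreover have "s (n + 1) (pr (dif X n x) (f n x)) = 
       s (n + 1) (pr (dif X n x) \<zero>\<^bsub>obj Y n\<^esub>) \<oplus>\<^bsub>obj J n\<^esub> s (n + 1) (pr \<zero>\<^bsub>obj X (n + 1)\<^esub> (f n x))"
      using lhom_add[OF s1, of "pr (dif X n x) \<zero>\<^bsub>obj Y n\<^esub>" n "pr \<zero>\<^bsub>obj X (n + 1)\<^esub> (f n x)"] x by simp
    ultimately show ?thesis
      using x g.Y.dif_neg[of "s n (pr x \<zero>\<^bsub>obj Y (n - 1)\<^esub>)" "n - 1"]
      by (simp add: h_def k_def g.Y.g.a_ac g.Y.g.r_neg g.Y.g.r_neg1 g.Y.g.r_neg2 g.Y.a_cancel g.Y.a_cancel2)
  qed
  then have "homotopic R X J (comp_map X h f) g"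
    unfolding homotopic_def using g chain_map_comp[OF cf hc] k_lhom
    by (auto intro!: exI[of _ k] simp: comp_map_def compose_def)
  with hc that show ?thesis by blast
qed

end

text \<open>Up to homotopy \<open>g\<close> has the right inverse \<open>c\<close> and the left
  inverse \<open>h\<close>, so these agree: \<open>c g ~ h g c g ~ h g ~ id\<close>.\<close>

lemma homotopy_inverse:
  assumes c: "chain_map R X Y c" and g: "chain_map R Y X g" and h: "chain_map R X Y h"
    and gc: "homotopic R X X (comp_map X g c) (id_map X)"
    and hg: "homotopic R Y Y (comp_map Y h g) (id_map Y)"
  shows "homotopic R Y Y (comp_map Y c g) (id_map Y)"
proof -
  interpret c: cmap R X Y c using c by (simp add: chain_map_iff)
  interpret g: cmap R Y X g using g by (simp add: chain_map_iff)
  interpret h: cmap R X Y h using h by (simp add: chain_map_iff)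
  obtain s where s: "\<And>n. s n \<in> lhom R (obj X n) (obj X (n - 1))"
    "\<And>n x. x \<in> carrier (obj X n) \<Longrightarrow> g n (c n x) = x \<oplus>\<^bsub>obj X n\<^esub>
               (dif X (n - 1) (s n x) \<oplus>\<^bsub>obj X n\<^esub> s (n + 1) (dif X n x))"
    using homotopicD[OF gc] by (auto simp: comp_map_def id_map_def compose_def cong: conj_cong)
  obtain t where t: "\<And>n. t n \<in> lhom R (obj Y n) (obj Y (n - 1))"
    "\<And>n x. x \<in> carrier (obj Y n) \<Longrightarrow> h n (g n x) = x \<oplus>\<^bsub>obj Y n\<^esub>
               (dif Y (n - 1) (t n x) \<oplus>\<^bsub>obj Y n\<^esub> t (n + 1) (dif Y n x))"
    using homotopicD[OF hg] by (auto simp: comp_map_def id_map_def compose_def)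
  \<comment> \<open>The sum of three homotopies: \<open>t\<close> for \<open>h g ~ id\<close>, the
    middle term \<open>h s g\<close> for \<open>h g c g ~ h g\<close>, and \<open>- t c g\<close>
    for \<open>c g ~ h g c g\<close>.\<close>
  define u where "u = (\<lambda>n. \<lambda>y\<in>carrier (obj Y n). t n y \<oplus>\<^bsub>obj Y (n - 1)\<^esub>
     (h (n - 1) (s n (g n y)) \<oplus>\<^bsub>obj Y (n - 1)\<^esub> \<ominus>\<^bsub>obj Y (n - 1)\<^esub> t n (c n (g n y))))"
  have u: "u n \<in> lhom R (obj Y n) (obj Y (n - 1))" for n
  proof -
    note L = c.Y.left_module
    show ?thesis
      using lhom_restrict_add[OF t(1) lhom_restrict_add[OF 
        lhom_restrict_comp[OF lhom_restrict_comp[OF g.map_lhom s(1) L] h.map_lhom L]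
        lhom_restrict_neg[OF lhom_restrict_comp[OF lhom_restrict_comp[OF g.map_lhom c.map_lhom L] t(1) L] L L] L L] L L]
      by (simp add: u_def cong: restrict_cong)
  qed
  have [simp]: "s n x \<in> carrier (obj X (n - 1))" "s (n + 1) x' \<in> carrier (obj X n)"
    if "x \<in> carrier (obj X n)" "x' \<in> carrier (obj X (n + 1))" for n x x'
    using that lhom_closed[OF s(1)] lhom_closed[OF s(1)[of "n + 1"]] by auto
  have [simp]: "t n x \<in> carrier (obj Y (n - 1))" if "x \<in> carrier (obj Y n)" for n x
    using that lhom_closed[OF t(1)] by auto
  have [simp]: "t (n + 1) x \<in> carrier (obj Y n)" if "x \<in> carrier (obj Y (n + 1))" for n x
    using that lhom_closed[OF t(1)[of "n + 1"]] by auto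
  have [simp]: "s n x \<in> carrier (obj X (n - 1))" if "x \<in> carrier (obj X n)" for n x
    using that lhom_closed[OF s(1)] by auto
  have [simp]: "s (n + 1) x \<in> carrier (obj X n)" if "x \<in> carrier (obj X (n + 1))" for n x
    using that lhom_closed[OF s(1)[of "n + 1"]] by auto
  have "c n (g n y) = y \<oplus>\<^bsub>obj Y n\<^esub> (dif Y (n - 1) (u n y) \<oplus>\<^bsub>obj Y n\<^esub> u (n + 1) (dif Y n y))"
    if y: "y \<in> carrier (obj Y n)" for n y
  proof -
    \<comment> \<open>The element \<open>h g c g y\<close> is computed in two ways, by
      \<open>t\<close> at the point \<open>c g y\<close> and by \<open>s\<close> at the point
      \<open>g y\<close> pushed forward along \<open>h\<close>; comparing the results isolates
      \<open>c g y\<close>.\<close>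
    have 1: "h n (g n (c n (g n y))) = c n (g n y) \<oplus>\<^bsub>obj Y n\<^esub>
      (dif Y (n - 1) (t n (c n (g n y))) \<oplus>\<^bsub>obj Y n\<^esub> t (n + 1) (c (n + 1) (g (n + 1) (dif Y n y))))"
      using t(2)[of "c n (g n y)" n] y by simp
    have 2: "h n (g n (c n (g n y))) = h n (g n y) \<oplus>\<^bsub>obj Y n\<^esub>
      (dif Y (n - 1) (h (n - 1) (s n (g n y))) \<oplus>\<^bsub>obj Y n\<^esub> h n (s (n + 1) (g (n + 1) (dif Y n y))))"
      using s(2)[of "g n y" n] y by simp
    have 3: "dif Y (n - 1) (u n y) = dif Y (n - 1) (t n y) \<oplus>\<^bsub>obj Y n\<^esub>
     (dif Y (n - 1) (h (n - 1) (s n (g n y))) \<oplus>\<^bsub>obj Y n\<^esub> \<ominus>\<^bsub>obj Y n\<^esub> dif Y (n - 1) (t n (c n (g n y))))"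
    proof -
      have "dif Y (n - 1) \<in> lhom R (obj Y (n - 1)) (obj Y n)" using c.Y.dif_lhom[of "n - 1"] by simp
      note d = lhom_add[OF this] lhom_neg[OF this]
      show ?thesis using y by (simp add: u_def d)
    qed
    have 4: "u (n + 1) (dif Y n y) = t (n + 1) (dif Y n y) \<oplus>\<^bsub>obj Y n\<^esub>
     (h n (s (n + 1) (g (n + 1) (dif Y n y))) \<oplus>\<^bsub>obj Y n\<^esub> \<ominus>\<^bsub>obj Y n\<^esub> t (n + 1) (c (n + 1) (g (n + 1) (dif Y n y))))"
      using y by (simp add: u_def)
    define C a a' b b' e e' where "C = c n (g n y)" "a = dif Y (n - 1) (t n (c n (g n y)))"
      "a' = t (n + 1) (c (n + 1) (g (n + 1) (dif Y n y)))"
      "b = dif Y (n - 1) (h (n - 1) (s n (g n y)))" "b' = h n (s (n + 1) (g (n + 1) (dif Y n y)))"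
      "e = dif Y (n - 1) (t n y)" "e' = t (n + 1) (dif Y n y)"
    note defs = this
    have cl: "C \<in> carrier (obj Y n)" "a \<in> carrier (obj Y n)" "a' \<in> carrier (obj Y n)" "b \<in> carrier (obj Y n)"
      "b' \<in> carrier (obj Y n)" "e \<in> carrier (obj Y n)" "e' \<in> carrier (obj Y n)"
      using y by (simp_all add: defs del: c.map_dif g.map_dif h.map_dif)
    have "C \<oplus>\<^bsub>obj Y n\<^esub> (a \<oplus>\<^bsub>obj Y n\<^esub> a') = (y \<oplus>\<^bsub>obj Y n\<^esub> (e \<oplus>\<^bsub>obj Y n\<^esub> e')) \<oplus>\<^bsub>obj Y n\<^esub> (b \<oplus>\<^bsub>obj Y n\<^esub> b')"
      using 1 2 t(2)[OF y] by (simp only: defs)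
    then have "(C \<oplus>\<^bsub>obj Y n\<^esub> (a \<oplus>\<^bsub>obj Y n\<^esub> a')) \<ominus>\<^bsub>obj Y n\<^esub> (a \<oplus>\<^bsub>obj Y n\<^esub> a') =
      ((y \<oplus>\<^bsub>obj Y n\<^esub> (e \<oplus>\<^bsub>obj Y n\<^esub> e')) \<oplus>\<^bsub>obj Y n\<^esub> (b \<oplus>\<^bsub>obj Y n\<^esub> b')) \<ominus>\<^bsub>obj Y n\<^esub> (a \<oplus>\<^bsub>obj Y n\<^esub> a')"
      by simp
    moreover have "(C \<oplus>\<^bsub>obj Y n\<^esub> (a \<oplus>\<^bsub>obj Y n\<^esub> a')) \<ominus>\<^bsub>obj Y n\<^esub> (a \<oplus>\<^bsub>obj Y n\<^esub> a') = C"
      using cl by (simp add: a_minus_def c.Y.g.a_assoc c.Y.g.r_neg)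
    ultimately have "C = y \<oplus>\<^bsub>obj Y n\<^esub> ((e \<oplus>\<^bsub>obj Y n\<^esub> (b \<oplus>\<^bsub>obj Y n\<^esub> \<ominus>\<^bsub>obj Y n\<^esub> a)) \<oplus>\<^bsub>obj Y n\<^esub>
        (e' \<oplus>\<^bsub>obj Y n\<^esub> (b' \<oplus>\<^bsub>obj Y n\<^esub> \<ominus>\<^bsub>obj Y n\<^esub> a')))"
      using cl y by (simp add: a_minus_def c.Y.g.a_ac c.Y.g.minus_add)
    then show ?thesis
      unfolding 3 4 defs .
  qed
  then show ?thesis
    unfolding homotopic_def using chain_map_comp[OF g c] chain_map_id[OF c.Y.is_complex] u
    by (auto intro!: exI[of _ u] simp: comp_map_def compose_def id_map_def)
qed

section \<open>Restriction of scalars along a surjective ring homomorphism\<close>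

lemma (in left_module) smult_l_zero: assumes "x \<in> carrier M" shows "\<zero>\<^bsub>R\<^esub> \<odot>\<^bsub>M\<^esub> x = \<zero>\<^bsub>M\<^esub>"
proof -
  have "\<zero>\<^bsub>R\<^esub> \<odot>\<^bsub>M\<^esub> x \<oplus>\<^bsub>M\<^esub> \<zero>\<^bsub>R\<^esub> \<odot>\<^bsub>M\<^esub> x = \<zero>\<^bsub>R\<^esub> \<odot>\<^bsub>M\<^esub> x"
    using assms lm_smult_l_distr[of "\<zero>\<^bsub>R\<^esub>" "\<zero>\<^bsub>R\<^esub>" x] by simp
  then show ?thesis
    using assms M.add.r_cancel_one' lm_smult_closed by simp
qed

lemma restrict_scalars_simps [simp]:
  "carrier (restrict_scalars h M) = carrier M" "\<zero>\<^bsub>restrict_scalars h M\<^esub> = \<zero>\<^bsub>M\<^esub>"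
  "add (restrict_scalars h M) = add M" "a \<odot>\<^bsub>restrict_scalars h M\<^esub> x = h a \<odot>\<^bsub>M\<^esub> x"
  by (simp_all add: restrict_scalars_def)

lemma restrict_scalars_complex_simps [simp]:
  "obj (restrict_scalars_complex h X) n = restrict_scalars h (obj X n)"
  "dif (restrict_scalars_complex h X) = dif X"
  by (simp_all add: restrict_scalars_complex_def)

lemma cocycles_restrict_scalars [simp]: "cocycles (restrict_scalars_complex h X) = cocycles X"
  by (simp add: cocycles_def fun_eq_iff)

lemma coboundaries_restrict_scalars [simp]: "coboundaries (restrict_scalars_complex h X) = coboundaries X"
  by (simp add: coboundaries_def fun_eq_iff)

lemma acyclic_restrict_scalars [simp]: "acyclic_complex (restrict_scalars_complex h X) = acyclic_complex X"
  by (simp add: acyclic_complex_def)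

lemma a_inv_restrict_scalars [simp]: "a_inv (restrict_scalars h M) = a_inv M"
  by (simp add: a_inv_def m_inv_def fun_eq_iff)

lemma comp_map_restrict_scalars [simp]: "comp_map (restrict_scalars_complex h X) = comp_map X"
  by (simp add: comp_map_def fun_eq_iff)

text \<open>Abstracts the projection of a ring onto its quotient by an ideal; the ideal appears as
  the set of \<open>a\<close> with \<open>h a\<close> zero, so that no cosets occur in the
  argument.\<close>

locale ring_epi = A: ring A + B: ring B for A :: "('a, 'c) ring_scheme" and B :: "('b, 'd) ring_scheme" +
  fixes h assumes hom: "h \<in> ring_hom A B" and surj: "h ` carrier A = carrier B"
begin

lemma h_closed [simp]: "a \<in> carrier A \<Longrightarrow> h a \<in> carrier B"
  using surj by blast

lemma h_zero [simp]: "h \<zero>\<^bsub>A\<^esub> = \<zero>\<^bsub>B\<^esub>"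
  by (rule ring_hom_zero[OF hom A.ring_axioms B.ring_axioms])

lemmas h_add [simp] = ring_hom_add[OF hom] and h_mult [simp] = ring_hom_mult[OF hom]
  and h_one [simp] = ring_hom_one[OF hom]

lemma surjE: assumes "b \<in> carrier B" obtains a where "a \<in> carrier A" "b = h a"
  using assms surj by blast

lemma left_module_restrict_scalars:
  assumes "left_module B M"
  shows "left_module A (restrict_scalars h M)"
proof -
  interpret M: left_module B M by fact
  show ?thesis
    by (rule left_moduleI) (auto simp: A.ring_axioms M.lm_smult_closed M.lm_smult_l_distr M.lm_smult_r_distr
      M.lm_smult_assoc M.lm_smult_one intro!: abelian_group_cong[OF M.M.abelian_group_axioms])
qed

text \<open>Full faithfulness of restriction: by surjectivity every scalar of \<open>B\<close> has
  the form \<open>h a\<close>, so linearity over \<open>A\<close> already gives linearity over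
  \<open>B\<close>.\<close>

lemma lhom_restrict_scalars [simp]: "lhom A (restrict_scalars h M) (restrict_scalars h N) = lhom B M N"
  by (auto simp: lhom_def elim!: surjE)

lemma is_complex_restrict_scalars: "is_complex B X \<Longrightarrow> is_complex A (restrict_scalars_complex h X)"
  by (simp add: is_complex_def left_module_restrict_scalars)

lemma chain_map_restrict_scalars:
  "chain_map B X Y f \<Longrightarrow> chain_map A (restrict_scalars_complex h X) (restrict_scalars_complex h Y) f"
  by (simp add: chain_map_def is_complex_restrict_scalars)

lemma quasi_iso_restrict_scalars:
  "quasi_iso B X Y f \<Longrightarrow> quasi_iso A (restrict_scalars_complex h X) (restrict_scalars_complex h Y) f"
  by (simp add: quasi_iso_iff chain_map_restrict_scalars cohomology_bij_def)

text \<open>\<open>Hom\<^sub>A(B, M)\<close>, where \<open>f\<close> is identified with \<open>f 1\<close>.\<close>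

definition coinduced :: "('a, 'm) module \<Rightarrow> ('b, 'm) module" where
  "coinduced M = \<lparr>carrier = {x \<in> carrier M. \<forall>a\<in>carrier A. h a = \<zero>\<^bsub>B\<^esub> \<longrightarrow> a \<odot>\<^bsub>M\<^esub> x = \<zero>\<^bsub>M\<^esub>},
     monoid.mult = undefined, one = undefined, zero = zero M, add = add M,
     smult = (\<lambda>b x. inv_into (carrier A) h b \<odot>\<^bsub>M\<^esub> x)\<rparr>"

lemma coinduced_simps [simp]:
  "carrier (coinduced M) = {x \<in> carrier M. \<forall>a\<in>carrier A. h a = \<zero>\<^bsub>B\<^esub> \<longrightarrow> a \<odot>\<^bsub>M\<^esub> x = \<zero>\<^bsub>M\<^esub>}"
  "\<zero>\<^bsub>coinduced M\<^esub> = \<zero>\<^bsub>M\<^esub>" "add (coinduced M) = add M"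
  by (simp_all add: coinduced_def)

text \<open>Two preimages of the same scalar differ by an element of the kernel of \<open>h\<close>,
  which annihilates \<open>x\<close>. Hence the preimage chosen by \<open>inv_into\<close> does not
  matter.\<close>

lemma coinduced_smult:
  assumes "left_module A M" "a \<in> carrier A" "x \<in> carrier (coinduced M)"
  shows "h a \<odot>\<^bsub>coinduced M\<^esub> x = a \<odot>\<^bsub>M\<^esub> x"
proof -
  interpret M: left_module A M by fact
  define a' where "a' = inv_into (carrier A) h (h a)"
  have a': "a' \<in> carrier A" "h a' = h a"
    unfolding a'_def using assms(2) by (auto intro: inv_into_into f_inv_into_f)
  have x: "x \<in> carrier M" using assms by simp
  have "h (a' \<ominus>\<^bsub>A\<^esub> a) \<oplus>\<^bsub>B\<^esub> h a = \<zero>\<^bsub>B\<^esub> \<oplus>\<^bsub>B\<^esub> h a"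
    using a' assms(2) by (simp flip: h_add add: a_minus_def A.a_assoc A.l_neg)
  then have "h (a' \<ominus>\<^bsub>A\<^esub> a) = \<zero>\<^bsub>B\<^esub>"
    using a' assms(2) by (subst (asm) B.add.right_cancel) auto
  then have "(a' \<ominus>\<^bsub>A\<^esub> a) \<odot>\<^bsub>M\<^esub> x = \<zero>\<^bsub>M\<^esub>"
    using a' assms by simp
  then have "((a' \<ominus>\<^bsub>A\<^esub> a) \<oplus>\<^bsub>A\<^esub> a) \<odot>\<^bsub>M\<^esub> x = a \<odot>\<^bsub>M\<^esub> x"
    using a' assms(2) x by (simp add: M.lm_smult_l_distr M.lm_smult_closed)
  then have "a' \<odot>\<^bsub>M\<^esub> x = a \<odot>\<^bsub>M\<^esub> x"
    using a' assms(2) by (simp add: a_minus_def A.a_assoc A.l_neg)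
  then show ?thesis by (simp add: coinduced_def a'_def)
qed

lemma left_module_coinduced:
  assumes "left_module A M"
  shows "left_module B (coinduced M)"
proof -
  interpret M: left_module A M by fact
  have neg: "\<ominus>\<^bsub>M\<^esub> x \<in> carrier (coinduced M)" if "x \<in> carrier (coinduced M)" for x
    using that by (auto simp: M.smult_neg intro: M.M.minus_equality)
  \<comment> \<open>If \<open>h b\<close> is zero then so is \<open>h (b \<otimes> a)\<close>, hence
    \<open>b\<close> annihilates \<open>a x\<close>: this is closure of the kernel under
    multiplication from the right.\<close>
  have sm: "a \<odot>\<^bsub>M\<^esub> x \<in> carrier (coinduced M)" if "a \<in> carrier A" "x \<in> carrier (coinduced M)" for a x
    using that by (auto simp: M.lm_smult_closed simp flip: M.lm_smult_assoc)
  have add: "x \<oplus>\<^bsub>M\<^esub> y \<in> carrier (coinduced M)" if "x \<in> carrier (coinduced M)" "y \<in> carrier (coinduced M)" for x y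
    using that by (auto simp: M.lm_smult_r_distr)
  have "abelian_group (coinduced M)"
  proof (rule abelian_groupI)
    fix x assume x: "x \<in> carrier (coinduced M)"
    show "\<exists>y\<in>carrier (coinduced M). y \<oplus>\<^bsub>coinduced M\<^esub> x = \<zero>\<^bsub>coinduced M\<^esub>"
      by (rule bexI[OF _ neg[OF x]]) (use x in \<open>simp add: M.M.l_neg\<close>)
  qed (use add in \<open>auto simp: M.smult_zero M.M.a_assoc intro: M.M.a_comm\<close>)
  note coinduced_simps [simp del]
  have car: "x \<in> carrier M" if "x \<in> carrier (coinduced M)" for x
    using that by (simp add: coinduced_simps)
  note [simp] = coinduced_smult[OF assms]
  show ?thesis
  proof (rule left_moduleI)
    fix x assume x: "x \<in> carrier (coinduced M)"
    show "\<one>\<^bsub>B\<^esub> \<odot>\<^bsub>coinduced M\<^esub> x = x"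
      using coinduced_smult[OF assms A.one_closed x] car[OF x] by (simp add: M.lm_smult_one)
    fix b assume "b \<in> carrier B"
    then obtain a where a: "a \<in> carrier A" "b = h a" by (rule surjE)
    show "b \<odot>\<^bsub>coinduced M\<^esub> x \<in> carrier (coinduced M)"
      using a x sm by simp
    show "b \<odot>\<^bsub>coinduced M\<^esub> (x \<oplus>\<^bsub>coinduced M\<^esub> y) = b \<odot>\<^bsub>coinduced M\<^esub> x \<oplus>\<^bsub>coinduced M\<^esub> b \<odot>\<^bsub>coinduced M\<^esub> y"
      if "y \<in> carrier (coinduced M)" for y
      using a x that add car by (simp add: M.lm_smult_r_distr coinduced_simps(3))
    fix b' assume "b' \<in> carrier B"
    then obtain a' where a': "a' \<in> carrier A" "b' = h a'" by (rule surjE)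
    show "(b \<oplus>\<^bsub>B\<^esub> b') \<odot>\<^bsub>coinduced M\<^esub> x = b \<odot>\<^bsub>coinduced M\<^esub> x \<oplus>\<^bsub>coinduced M\<^esub> b' \<odot>\<^bsub>coinduced M\<^esub> x"
      using a a' x car by (simp flip: h_add add: M.lm_smult_l_distr coinduced_simps(3))
    show "(b \<otimes>\<^bsub>B\<^esub> b') \<odot>\<^bsub>coinduced M\<^esub> x = b \<odot>\<^bsub>coinduced M\<^esub> (b' \<odot>\<^bsub>coinduced M\<^esub> x)"
      using a a' x car sm by (simp flip: h_mult add: M.lm_smult_assoc)
  qed (fact B.ring_axioms \<open>abelian_group (coinduced M)\<close>)+
qed

text \<open>Coinduction is right adjoint to restriction. The kernel of \<open>h\<close> acts as zero
  on \<open>V\<close>, so every \<open>A\<close>-linear map out of \<open>V\<close> takes its values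
  in the coinduced submodule; the bijection of the adjunction is therefore an equality of
  sets.\<close>

lemma lhom_coinduced:
  assumes "left_module B V" "left_module A M"
  shows "lhom A (restrict_scalars h V) M = lhom B V (coinduced M)"
proof (intro equalityI subsetI)
  interpret V: left_module B V by fact
  interpret M: left_module A M by fact
  interpret V': left_module A "restrict_scalars h V" by (rule left_module_restrict_scalars) fact
  fix f assume f: "f \<in> lhom A (restrict_scalars h V) M"
  have cl: "f v \<in> carrier (coinduced M)" if v: "v \<in> carrier V" for v
  proof -
    have "a \<odot>\<^bsub>M\<^esub> f v = \<zero>\<^bsub>M\<^esub>" if "a \<in> carrier A" "h a = \<zero>\<^bsub>B\<^esub>" for a
      using lhom_smult[OF f that(1), of v] that v lhom_zero[OF f V'.M.abelian_group_axioms M.M.abelian_group_axioms]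
      by (simp add: V.smult_l_zero)
    then show ?thesis using lhom_closed[OF f, of v] v by simp
  qed
  show "f \<in> lhom B V (coinduced M)"
  proof (rule lhomI)
    show "f \<in> extensional (carrier V)" using lhom_extensional[OF f] by simp
    fix x assume x: "x \<in> carrier V"
    show "f x \<in> carrier (coinduced M)" by (rule cl[OF x])
    show "f (x \<oplus>\<^bsub>V\<^esub> y) = f x \<oplus>\<^bsub>coinduced M\<^esub> f y" if "y \<in> carrier V" for y
      using lhom_add[OF f, of x y] x that by simp
    fix b assume "b \<in> carrier B"
    then obtain a where a: "a \<in> carrier A" "b = h a" by (rule surjE)
    show "f (b \<odot>\<^bsub>V\<^esub> x) = b \<odot>\<^bsub>coinduced M\<^esub> f x"
      using lhom_smult[OF f a(1), of x] x a coinduced_smult[OF assms(2) a(1) cl[OF x]] by simp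
  qed
next
  interpret V: left_module B V by fact
  fix f assume f: "f \<in> lhom B V (coinduced M)"
  show "f \<in> lhom A (restrict_scalars h V) M"
    using lhom_extensional[OF f] lhom_closed[OF f] lhom_add[OF f] lhom_smult[OF f]
    by (intro lhomI) (auto simp: coinduced_smult[OF assms(2)])
qed

text \<open>The differential is cut down to the smaller carrier because elements of
  \<open>lhom\<close> are extensional.\<close>

definition coinduced_complex :: "('a, 'm) cochain_complex \<Rightarrow> ('b, 'm) cochain_complex" where
  "coinduced_complex X = \<lparr>obj = (\<lambda>n. coinduced (obj X n)),
     dif = (\<lambda>n. restrict (dif X n) (carrier (coinduced (obj X n))))\<rparr>"

lemma obj_coinduced [simp]: "obj (coinduced_complex X) n = coinduced (obj X n)"
  by (simp add: coinduced_complex_def)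

lemma dif_coinduced: "x \<in> carrier (coinduced (obj X n)) \<Longrightarrow> dif (coinduced_complex X) n x = dif X n x"
  by (simp add: coinduced_complex_def)

lemma is_complex_coinduced:
  assumes "is_complex A X"
  shows "is_complex B (coinduced_complex X)"
proof -
  interpret cpx A X by unfold_locales fact
  have cl: "dif X n x \<in> carrier (coinduced (obj X (n + 1)))" if "x \<in> carrier (coinduced (obj X n))" for n x
    using that by (auto simp flip: dif_smult)
  have "dif (coinduced_complex X) n \<in> lhom B (coinduced (obj X n)) (coinduced (obj X (n + 1)))" for n
  proof (rule lhomI)
    interpret left_module B "coinduced (obj X n)" by (rule left_module_coinduced[OF left_module])
    fix x assume x: "x \<in> carrier (coinduced (obj X n))"
    show "dif (coinduced_complex X) n x \<in> carrier (coinduced (obj X (n + 1)))"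
      using cl[OF x] dif_coinduced[OF x] by simp
    show "dif (coinduced_complex X) n (x \<oplus>\<^bsub>coinduced (obj X n)\<^esub> y) =
       dif (coinduced_complex X) n x \<oplus>\<^bsub>coinduced (obj X (n + 1))\<^esub> dif (coinduced_complex X) n y"
      if y: "y \<in> carrier (coinduced (obj X n))" for y
      unfolding dif_coinduced[OF x] dif_coinduced[OF y] dif_coinduced[OF M.a_closed[OF x y]]
      using x y by simp
    fix b assume b: "b \<in> carrier B"
    then obtain a where a: "a \<in> carrier A" "b = h a" by (rule surjE)
    show "dif (coinduced_complex X) n (b \<odot>\<^bsub>coinduced (obj X n)\<^esub> x) =
        b \<odot>\<^bsub>coinduced (obj X (n + 1))\<^esub> dif (coinduced_complex X) n x"
      unfolding dif_coinduced[OF x] dif_coinduced[OF lm_smult_closed[OF b x]]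
      unfolding a(2) coinduced_smult[OF left_module a(1) x] coinduced_smult[OF left_module a(1) cl[OF x]]
      using x a(1) by simp
  qed (simp add: coinduced_complex_def)
  moreover have "dif (coinduced_complex X) (n + 1) (dif (coinduced_complex X) n x) =
      \<zero>\<^bsub>coinduced (obj X (n + 2))\<^esub>" if x: "x \<in> carrier (coinduced (obj X n))" for n x
    unfolding dif_coinduced[OF x] dif_coinduced[OF cl[OF x]] using x by (simp add: add.commute[of 2 n])
  ultimately show ?thesis
    unfolding is_complex_def by (simp only: obj_coinduced) (blast intro: left_module_coinduced left_module)
qed

lemma chain_map_coinduced:
  assumes "is_complex B X" "chain_map A (restrict_scalars_complex h X) J f"
  shows "chain_map B X (coinduced_complex J) f"
proof -
  interpret X: cpx B X by unfold_locales fact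
  interpret f: cmap A "restrict_scalars_complex h X" J f using assms(2) by (simp add: chain_map_iff)
  have l: "f n \<in> lhom B (obj X n) (coinduced (obj J n))" for n
    using f.map_lhom[of n] lhom_coinduced[OF X.left_module f.Y.left_module, of n n] by simp
  have "f (n + 1) (dif X n x) = dif (coinduced_complex J) n (f n x)" if x: "x \<in> carrier (obj X n)" for n x
    unfolding dif_coinduced[OF lhom_closed[OF l x]] using f.map_dif[of x n] x by simp
  then show ?thesis
    unfolding chain_map_def using assms(1) is_complex_coinduced[OF f.Y.is_complex] l by simp
qed

lemma chain_map_from_coinduced:
  assumes "is_complex A J" "chain_map B X (coinduced_complex J) f"
  shows "chain_map A (restrict_scalars_complex h X) J f"
proof -
  interpret J: cpx A J by unfold_locales fact
  interpret f: cmap B X "coinduced_complex J" f using assms(2) by (simp add: chain_map_iff)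
  have l: "f n \<in> lhom B (obj X n) (coinduced (obj J n))" for n
    using f.map_lhom[of n] by simp
  have "f (n + 1) (dif X n x) = dif J n (f n x)" if x: "x \<in> carrier (obj X n)" for n x
    using f.map_dif[OF x] dif_coinduced[OF lhom_closed[OF l x]] by simp
  then show ?thesis
    unfolding chain_map_def using assms(1) is_complex_restrict_scalars[OF f.X.is_complex] l
    by (simp add: lhom_coinduced[OF f.X.left_module J.left_module])
qed

text \<open>The adjunction in every degree: the same functions serve as a homotopy over either
  ring.\<close>

lemma homotopy_coinduced:
  assumes "is_complex B X" "is_complex A J" "\<And>n. s n \<in> lhom A (restrict_scalars h (obj X n)) (obj J (n - 1))"
  shows "s n \<in> lhom B (obj X n) (obj (coinduced_complex J) (n - 1))"
    "x \<in> carrier (obj X n) \<Longrightarrow> dif (coinduced_complex J) (n - 1) (s n x) = dif J (n - 1) (s n x)"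
proof -
  interpret X: cpx B X by unfold_locales fact
  interpret J: cpx A J by unfold_locales fact
  show *: "s n \<in> lhom B (obj X n) (obj (coinduced_complex J) (n - 1))"
    using assms(3)[of n] lhom_coinduced[OF X.left_module J.left_module] by simp
  assume x: "x \<in> carrier (obj X n)"
  show "dif (coinduced_complex J) (n - 1) (s n x) = dif J (n - 1) (s n x)"
    by (rule dif_coinduced) (use lhom_closed[OF *] x in simp)
qed

lemma homotopic_coinduced:
  assumes "is_complex B X" "homotopic A (restrict_scalars_complex h X) J f g"
  shows "homotopic B X (coinduced_complex J) f g"
proof -
  have c: "chain_map A (restrict_scalars_complex h X) J f" "chain_map A (restrict_scalars_complex h X) J g"
    using assms(2) by (auto simp: homotopic_def)
  obtain s where s: "\<And>n. s n \<in> lhom A (restrict_scalars h (obj X n)) (obj J (n - 1))"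
    "\<And>n x. x \<in> carrier (obj X n) \<Longrightarrow> f n x = g n x \<oplus>\<^bsub>obj J n\<^esub>
               (dif J (n - 1) (s n x) \<oplus>\<^bsub>obj J n\<^esub> s (n + 1) (dif X n x))"
    using homotopicD[OF assms(2)] by auto
  note hc = homotopy_coinduced[OF assms(1) chain_map_cpx(2)[OF c(1)] s(1)]
  show ?thesis
    unfolding homotopic_def
    using chain_map_coinduced[OF assms(1)] c hc s(2) by (intro conjI exI[of _ s]) auto
qed

text \<open>A right adjoint of an exact functor preserves this property: an acyclic \<open>X\<close>
  stays acyclic over \<open>A\<close>, and the null-homotopy found there takes its values in the
  coinduced complex.\<close>

lemma null_from_acyclic_coinduced:
  fixes J :: "('a, 'u) cochain_complex"
  assumes "null_from_acyclic A J"
  shows "null_from_acyclic B (coinduced_complex J)"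
  unfolding null_from_acyclic_def
proof (intro conjI allI impI; (elim conjE)?)
  have J: "is_complex A J" using assms by (simp add: null_from_acyclic_def)
  then show "is_complex B (coinduced_complex J)" by (rule is_complex_coinduced)
  fix X :: "('b, 'u) cochain_complex" and f
  assume f: "chain_map B X (coinduced_complex J) f" and X: "acyclic_complex X"
  obtain s where s: "\<And>n. s n \<in> lhom A (restrict_scalars h (obj X n)) (obj J (n - 1))"
    "\<And>n x. x \<in> carrier (obj X n) \<Longrightarrow> f n x = dif J (n - 1) (s n x) \<oplus>\<^bsub>obj J n\<^esub> s (n + 1) (dif X n x)"
    using null_from_acyclicE[OF assms chain_map_from_coinduced[OF J f]] X by auto
  note hc = homotopy_coinduced[OF chain_map_cpx(1)[OF f] J s(1)]
  show "\<exists>s. (\<forall>n. s n \<in> lhom B (obj X n) (obj (coinduced_complex J) (n - 1))) \<and>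
             (\<forall>n. \<forall>x\<in>carrier (obj X n). f n x = dif (coinduced_complex J) (n - 1) (s n x)
                \<oplus>\<^bsub>obj (coinduced_complex J) n\<^esub> s (n + 1) (dif X n x))"
    using hc s(2) by (intro exI[of _ s]) auto
qed

end

section \<open>Projective resolutions\<close>

lemma projective_module_left_module: "projective_module R Q \<Longrightarrow> left_module R Q"
  by (simp add: projective_module_def)

text \<open>With \<open>P j\<close> in degree \<open>- j\<close>, \<open>\<phi>\<close> is a cocycle
  of degree \<open>N + 1\<close> in Hom(P, C) supported on \<open>P 0\<close>, and \<open>s\<close>
  is a cochain of degree \<open>N\<close> bounding it. As in the comparison theorem it is built by
  recursion on \<open>j\<close>: acyclicity puts the required values into the image of the
  differential, and projectivity lifts them.\<close>

lemma lift_along_projectives: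
  fixes C :: "('r, 'u) cochain_complex" and P :: "nat \<Rightarrow> ('r, 'u) module"
  assumes C: "is_complex R C" "acyclic_complex C"
    and P: "\<And>j. projective_module R (P j)" "\<And>j. d j \<in> lhom R (P (Suc j)) (P j)"
      "\<And>j x. x \<in> carrier (P (Suc (Suc j))) \<Longrightarrow> d j (d (Suc j) x) = \<zero>\<^bsub>P j\<^esub>"
    and \<phi>: "\<phi> \<in> lhom R (P 0) (obj C (N + 1))"
      "\<And>x. x \<in> carrier (P 0) \<Longrightarrow> dif C (N + 1) (\<phi> x) = \<zero>\<^bsub>obj C (N + 2)\<^esub>"
      "\<And>x. x \<in> carrier (P (Suc 0)) \<Longrightarrow> \<phi> (d 0 x) = \<zero>\<^bsub>obj C (N + 1)\<^esub>"
  obtains s where "\<And>j. s j \<in> lhom R (P j) (obj C (N - int j))"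
    "\<And>x. x \<in> carrier (P 0) \<Longrightarrow> dif C N (s 0 x) = \<phi> x"
    "\<And>j x. x \<in> carrier (P (Suc j)) \<Longrightarrow>
       dif C (N - int (Suc j)) (s (Suc j) x) = \<ominus>\<^bsub>obj C (N - int j)\<^esub> s j (d j x)"
proof -
  interpret C: cpx R C by unfold_locales fact
  note PL = projective_module_left_module[OF P(1)]
  note PG = left_module_group[OF PL]
  \<comment> \<open>The middle clause is the induction invariant: it makes
    \<open>- s j (d j x)\<close> a cocycle, so that the next lift exists. It is renewed by
    \<open>d j (d (Suc j) x) = 0\<close>, and for \<open>j = 0\<close> it comes from
    \<open>\<phi>\<close> vanishing on the image of \<open>d 0\<close>.\<close>
  define Q where "Q j s \<longleftrightarrow> s \<in> lhom R (P j) (obj C (N - int j)) \<and>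
     (\<forall>x\<in>carrier (P (Suc j)). dif C (N - int j) (s (d j x)) = \<zero>\<^bsub>obj C (N - int j + 1)\<^esub>) \<and>
     (j = 0 \<longrightarrow> (\<forall>x\<in>carrier (P 0). dif C N (s x) = \<phi> x))" for j s
  have "\<exists>s. \<forall>j. Q j (s j) \<and> (\<forall>x\<in>carrier (P (Suc j)).
     dif C (N - int (Suc j)) (s (Suc j) x) = \<ominus>\<^bsub>obj C (N - int j)\<^esub> s j (d j x))"
  proof (rule dependent_nat_choice)
    have "\<phi> ` carrier (P 0) \<subseteq> cocycles C (N + 1)"
      using \<phi>(2) lhom_closed[OF \<phi>(1)] by (auto simp: cocycles_def add.commute[of 2 N])
    also have "\<dots> = dif C N ` carrier (obj C N)"
      using C(2) by (simp add: acyclic_complex_def coboundaries_def)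
    finally obtain s where "s \<in> lhom R (P 0) (obj C N)" "\<And>x. x \<in> carrier (P 0) \<Longrightarrow> dif C N (s x) = \<phi> x"
      using projective_lift[OF P(1) C.left_module C.left_module C.dif_lhom \<phi>(1)] by metis
    then show "\<exists>s. Q 0 s"
      using \<phi>(3) lhom_closed[OF P(2)] by (auto simp: Q_def)
  next
    fix s j assume s: "Q j s"
    define \<psi> where "\<psi> = (\<lambda>x\<in>carrier (P (Suc j)). \<ominus>\<^bsub>obj C (N - int j)\<^esub> s (d j x))"
    have sl: "s \<in> lhom R (P j) (obj C (N - int j))" using s by (simp add: Q_def)
    have \<psi>: "\<psi> \<in> lhom R (P (Suc j)) (obj C (N - int j))"
      using lhom_restrict_neg[OF lhom_restrict_comp[OF P(2) sl PL] PL C.left_module]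
      by (simp add: \<psi>_def cong: restrict_cong)
    have "\<psi> ` carrier (P (Suc j)) \<subseteq> cocycles C (N - int j)"
      using lhom_closed[OF \<psi>] s lhom_closed[OF sl lhom_closed[OF P(2)]] by (auto simp: cocycles_def \<psi>_def Q_def)
    also have "\<dots> = dif C (N - int j - 1) ` carrier (obj C (N - int j - 1))"
      using C(2) by (simp add: acyclic_complex_def coboundaries_def)
    finally have sub: "\<psi> ` carrier (P (Suc j)) \<subseteq> dif C (N - int j - 1) ` carrier (obj C (N - int j - 1))" .
    have "dif C (N - int j - 1) \<in> lhom R (obj C (N - int j - 1)) (obj C (N - int j))"
      using C.dif_lhom[of "N - int j - 1"] by simp
    from projective_lift[OF P(1) C.left_module C.left_module this \<psi> sub]
    obtain s' where s': "s' \<in> lhom R (P (Suc j)) (obj C (N - int j - 1))"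
      "\<And>x. x \<in> carrier (P (Suc j)) \<Longrightarrow> dif C (N - int j - 1) (s' x) = \<psi> x"
      by metis
    have eq: "N - int j - 1 = N - int (Suc j)" by simp
    have "dif C (N - int j - 1) (s' (d (Suc j) x)) = \<zero>\<^bsub>obj C (N - int j)\<^esub>" if "x \<in> carrier (P (Suc (Suc j)))" for x
      using that s'(2)[of "d (Suc j) x"] lhom_closed[OF P(2)] P(3) lhom_zero[OF sl PG] by (simp add: \<psi>_def)
    then show "\<exists>s'. Q (Suc j) s' \<and> (\<forall>x\<in>carrier (P (Suc j)).
        dif C (N - int (Suc j)) (s' x) = \<ominus>\<^bsub>obj C (N - int j)\<^esub> s (d j x))"
      using s' unfolding Q_def eq[symmetric] by (intro exI[of _ s']) (simp add: \<psi>_def)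
  qed
  then obtain s where s: "\<And>j. Q j (s j)" "\<And>j x. x \<in> carrier (P (Suc j)) \<Longrightarrow>
     dif C (N - int (Suc j)) (s (Suc j) x) = \<ominus>\<^bsub>obj C (N - int j)\<^esub> s j (d j x)"
    by blast
  show ?thesis
  proof (rule that)
    show "s j \<in> lhom R (P j) (obj C (N - int j))" for j
      using s(1)[of j] by (simp add: Q_def)
    show "dif C N (s 0 x) = \<phi> x" if "x \<in> carrier (P 0)" for x
      using s(1)[of 0] that by (simp add: Q_def)
  qed (rule s(2))
qed

text \<open>\<open>B\<close> itself need not lie in the universe \<open>'u\<close>, but it is a quotient of \<open>P 0\<close> and hence has a copy
  there.\<close>

definition transport :: "('m \<Rightarrow> 'u) \<Rightarrow> ('u \<Rightarrow> 'm) \<Rightarrow> ('r, 'm) module \<Rightarrow> ('r, 'u) module" where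
  "transport \<sigma> e M = \<lparr>carrier = \<sigma> ` carrier M, monoid.mult = undefined, one = undefined, zero = \<sigma> \<zero>\<^bsub>M\<^esub>,
     add = (\<lambda>x y. \<sigma> (e x \<oplus>\<^bsub>M\<^esub> e y)), smult = (\<lambda>a x. \<sigma> (a \<odot>\<^bsub>M\<^esub> e x))\<rparr>"

lemma transport_simps [simp]:
  "carrier (transport \<sigma> e M) = \<sigma> ` carrier M" "\<zero>\<^bsub>transport \<sigma> e M\<^esub> = \<sigma> \<zero>\<^bsub>M\<^esub>"
  "x \<oplus>\<^bsub>transport \<sigma> e M\<^esub> y = \<sigma> (e x \<oplus>\<^bsub>M\<^esub> e y)" "a \<odot>\<^bsub>transport \<sigma> e M\<^esub> x = \<sigma> (a \<odot>\<^bsub>M\<^esub> e x)"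
  by (simp_all add: transport_def)

lemma
  assumes "left_module R M" "\<And>x. x \<in> carrier M \<Longrightarrow> e (\<sigma> x) = x"
  shows left_module_transport: "left_module R (transport \<sigma> e M)"
    and lhom_to_transport: "(\<lambda>x\<in>carrier M. \<sigma> x) \<in> lhom R M (transport \<sigma> e M)"
    and lhom_from_transport: "(\<lambda>x\<in>carrier (transport \<sigma> e M). e x) \<in> lhom R (transport \<sigma> e M) M"
proof -
  interpret M: left_module R M by fact
  note [simp] = assms(2) M.lm_smult_closed
  have [simp]: "\<sigma> x = \<sigma> y \<longleftrightarrow> x = y" if "x \<in> carrier M" "y \<in> carrier M" for x y
    using assms(2) that by metis
  have inv: "\<exists>y\<in>carrier M. \<sigma> (y \<oplus>\<^bsub>M\<^esub> x) = \<sigma> \<zero>\<^bsub>M\<^esub>" if "x \<in> carrier M" for x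
    using that by (intro bexI[of _ "\<ominus>\<^bsub>M\<^esub> x"]) (auto simp: M.M.l_neg)
  have "abelian_group (transport \<sigma> e M)"
    by (rule abelian_groupI) (use inv in \<open>auto simp: M.M.a_assoc intro: arg_cong[of _ _ \<sigma>, OF M.M.a_comm]\<close>)
  then show "left_module R (transport \<sigma> e M)"
    by (intro left_moduleI) (auto simp: M.R.ring_axioms M.lm_smult_l_distr M.lm_smult_r_distr M.lm_smult_assoc M.lm_smult_one)
  show "(\<lambda>x\<in>carrier M. \<sigma> x) \<in> lhom R M (transport \<sigma> e M)"
    "(\<lambda>x\<in>carrier (transport \<sigma> e M). e x) \<in> lhom R (transport \<sigma> e M) M"
    by (intro lhomI; auto)+
qed

lemma finite_projective_resolutionD:
  assumes "finite_projective_resolution R M n P d e"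
  shows "projective_module R (P j)" "d j \<in> lhom R (P (Suc j)) (P j)" "e \<in> lhom R (P 0) M"
    "e ` carrier (P 0) = carrier M"
    "{x \<in> carrier (P 0). e x = \<zero>\<^bsub>M\<^esub>} = d 0 ` carrier (P (Suc 0))"
    "{x \<in> carrier (P (Suc j)). d j x = \<zero>\<^bsub>P j\<^esub>} = d (Suc j) ` carrier (P (Suc (Suc j)))"
  using assms by (simp_all add: finite_projective_resolution_def)

lemma finite_projective_resolution_zero:
  assumes "finite_projective_resolution R M n P d e"
  shows "x \<in> carrier (P (Suc 0)) \<Longrightarrow> e (d 0 x) = \<zero>\<^bsub>M\<^esub>"
    "x \<in> carrier (P (Suc (Suc j))) \<Longrightarrow> d j (d (Suc j) x) = \<zero>\<^bsub>P j\<^esub>"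
  using finite_projective_resolutionD(5,6)[OF assms] by blast+

text \<open>\<open>\<dots> \<rightarrow> P 1 \<rightarrow> P 0 \<rightarrow> M \<rightarrow> 0 \<rightarrow> \<dots>\<close> as a cochain complex with \<open>M\<close> in degree \<open>N\<close>.\<close>

definition augmented_complex :: "int \<Rightarrow> (nat \<Rightarrow> ('r, 'u) module) \<Rightarrow> (nat \<Rightarrow> 'u \<Rightarrow> 'u) \<Rightarrow> ('r, 'u) module \<Rightarrow> ('u \<Rightarrow> 'u) \<Rightarrow>
    ('r, 'u) cochain_complex" where
  "augmented_complex N P d M e =
     \<lparr>obj = (\<lambda>k. if k = N then M else if k < N then P (nat (N - 1 - k)) else M\<lparr>carrier := {\<zero>\<^bsub>M\<^esub>}\<rparr>),
      dif = (\<lambda>k. if k = N then \<lambda>x\<in>carrier M. \<zero>\<^bsub>M\<^esub> else if N < k then \<lambda>x\<in>{\<zero>\<^bsub>M\<^esub>}. \<zero>\<^bsub>M\<^esub>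
        else if k = N - 1 then e else d (nat (N - 2 - k)))\<rparr>"

text \<open>The cases follow the shape of the augmented complex: the module itself, the zero modules
  above it, \<open>P 0\<close>, and \<open>P (Suc j)\<close>.\<close>

lemma int_cases_below:
  fixes k N :: int
  obtains "k = N" | "N < k" | "k = N - 1" | j where "k = N - 1 - int (Suc j)"
proof -
  consider "k = N" | "N < k" | "k = N - 1" | "k \<le> N - 2" by linarith
  then show ?thesis
  proof cases
    case 4
    then have "k = N - 1 - int (Suc (nat (N - 2 - k)))" by simp
    then show ?thesis using that by blast
  qed (use that in blast)+
qed

text \<open>The same degree is listed in several spellings, because arithmetic normalisation can
  produce any of them.\<close>

lemma obj_augmented [simp]:
  "obj (augmented_complex N P d M e) N = M"
  "N < k \<Longrightarrow> obj (augmented_complex N P d M e) k = M\<lparr>carrier := {\<zero>\<^bsub>M\<^esub>}\<rparr>"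
  "obj (augmented_complex N P d M e) (N - 1) = P 0"
  "obj (augmented_complex N P d M e) (N - 1 - int j) = P j"
  "obj (augmented_complex N P d M e) (N - 2) = P (Suc 0)"
  "obj (augmented_complex N P d M e) (N - 2 - int j) = P (Suc j)"
  "obj (augmented_complex N P d M e) (N - int j - 1) = P j"
  "obj (augmented_complex N P d M e) (N - int j - 2) = P (Suc j)"
  "obj (augmented_complex N P d M e) (N - int j - 3) = P (Suc (Suc j))"
  "obj (augmented_complex N P d M e) (N - 3 - int j) = P (Suc (Suc j))"
  by (simp_all add: augmented_complex_def nat_diff_distrib nat_add_distrib algebra_simps)

lemma dif_augmented [simp]:
  "dif (augmented_complex N P d M e) N = (\<lambda>x\<in>carrier M. \<zero>\<^bsub>M\<^esub>)"
  "N < k \<Longrightarrow> dif (augmented_complex N P d M e) k = (\<lambda>x\<in>{\<zero>\<^bsub>M\<^esub>}. \<zero>\<^bsub>M\<^esub>)"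
  "dif (augmented_complex N P d M e) (N - 1) = e"
  "dif (augmented_complex N P d M e) (N - 2) = d 0"
  "dif (augmented_complex N P d M e) (N - 2 - int j) = d j"
  "dif (augmented_complex N P d M e) (N - int j - 2) = d j"
  "dif (augmented_complex N P d M e) (N - int j - 3) = d (Suc j)"
  "dif (augmented_complex N P d M e) (N - 3 - int j) = d (Suc j)"
  by (simp_all add: augmented_complex_def nat_diff_distrib nat_add_distrib algebra_simps)

lemma
  fixes M :: "('r, 'u) module"
  assumes res: "finite_projective_resolution R M n P d e" and M: "left_module R M"
  shows is_complex_augmented: "is_complex R (augmented_complex N P d M e)" (is "is_complex R ?X")
    and acyclic_augmented: "acyclic_complex (augmented_complex N P d M e)"
proof -
  interpret M: left_module R M by fact
  \<comment> \<open>The zero module is taken as the zero submodule of \<open>M\<close>, so it has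
    the right type without a further choice.\<close>
  let ?Z = "M\<lparr>carrier := {\<zero>\<^bsub>M\<^esub>}\<rparr>"
  note resD = finite_projective_resolutionD[OF res]
  note P = projective_module_left_module[OF resD(1)] and d = resD(2) and e = resD(3)
    and ed = finite_projective_resolution_zero(1)[OF res] and dd = finite_projective_resolution_zero(2)[OF res]
  have Z: "left_module R ?Z"
    by (rule M.submodule) (auto simp: M.smult_zero)
  have zM: "(\<lambda>x\<in>carrier M. \<zero>\<^bsub>M\<^esub>) \<in> lhom R M ?Z" using lhom_restrict_zero[OF M Z] by simp
  have zZ: "(\<lambda>x\<in>{\<zero>\<^bsub>M\<^esub>}. \<zero>\<^bsub>M\<^esub>) \<in> lhom R ?Z ?Z" using lhom_restrict_zero[OF Z Z] by simp
  show X: "is_complex R ?X"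
    unfolding is_complex_def
  proof (intro conjI allI ballI)
    fix k
    show "left_module R (obj ?X k)"
      by (rule int_cases_below[of k N]) (simp_all add: M P Z)
    show "dif ?X k \<in> lhom R (obj ?X k) (obj ?X (k + 1))"
      by (rule int_cases_below[of k N]) (simp_all add: zM zZ d e)
    fix x assume x: "x \<in> carrier (obj ?X k)"
    show "dif ?X (k + 1) (dif ?X k x) = \<zero>\<^bsub>obj ?X (k + 2)\<^esub>"
    proof (rule int_cases_below[of k N])
      assume "k = N - 1"
      then show ?thesis using x lhom_closed[OF e] by simp
    next
      fix j assume k: "k = N - 1 - int (Suc j)"
      show ?thesis
      proof (cases j)
        case 0
        then show ?thesis using x k ed by simp
      next
        case (Suc i)
        then show ?thesis using x k dd by simp
      qed
    qed (use x in simp_all)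
  qed
  interpret X: cpx R ?X by unfold_locales (rule X)
  have "cocycles ?X k \<subseteq> coboundaries ?X k" for k
  proof (rule int_cases_below[of k N])
    assume "k = N"
    then show ?thesis using resD(4) by (auto simp: cocycles_def coboundaries_def)
  next
    assume k: "N < k"
    have "dif ?X (k - 1) \<zero>\<^bsub>M\<^esub> = \<zero>\<^bsub>M\<^esub> \<and> \<zero>\<^bsub>M\<^esub> \<in> carrier (obj ?X (k - 1))"
      by (cases "k = N + 1") (use k in simp_all)
    then show ?thesis using k by (auto simp: cocycles_def coboundaries_def intro!: image_eqI[of _ _ "\<zero>\<^bsub>M\<^esub>"])
  next
    assume k: "k = N - 1"
    then have "cocycles ?X k = {x \<in> carrier (P 0). e x = \<zero>\<^bsub>M\<^esub>}" by (simp add: cocycles_def)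
    also have "\<dots> = d 0 ` carrier (P (Suc 0))" by (rule resD(5))
    also have "\<dots> = coboundaries ?X k" by (simp add: k coboundaries_def)
    finally show ?thesis by simp
  next
    fix j assume k: "k = N - 1 - int (Suc j)"
    then have "cocycles ?X k = {x \<in> carrier (P (Suc j)). d j x = \<zero>\<^bsub>P j\<^esub>}" by (simp add: cocycles_def)
    also have "\<dots> = d (Suc j) ` carrier (P (Suc (Suc j)))" by (rule resD(6))
    also have "\<dots> = coboundaries ?X k" by (simp add: k coboundaries_def)
    finally show ?thesis by simp
  qed
  then show "acyclic_complex ?X"
    using X.coboundaries_cocycles by (auto simp: acyclic_complex_def)
qed

text \<open>\<open>\<sigma>\<close> is injective on \<open>M\<close> because \<open>e\<close> undoes
  it, so the new augmentation has the same kernel as \<open>e\<close> and exactness at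
  \<open>P 0\<close> is unchanged.\<close>

lemma transport_resolution:
  fixes M :: "('r, 'm) module" and P :: "nat \<Rightarrow> ('r, 'u) module"
  assumes res: "finite_projective_resolution R M n P d e" and M: "left_module R M"
    and \<sigma>: "\<And>x. x \<in> carrier M \<Longrightarrow> e (\<sigma> x) = x"
  shows "finite_projective_resolution R (transport \<sigma> e M) n P d (\<lambda>x\<in>carrier (P 0). \<sigma> (e x))"
proof -
  note resD = finite_projective_resolutionD[OF res]
  note P = projective_module_left_module[OF resD(1)] and e = resD(3)
  interpret M: left_module R M by fact
  have inj: "\<sigma> x = \<sigma> y \<longleftrightarrow> x = y" if "x \<in> carrier M" "y \<in> carrier M" for x y
    using \<sigma> that by metis
  have "(\<lambda>x\<in>carrier (P 0). \<sigma> (e x)) \<in> lhom R (P 0) (transport \<sigma> e M)"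
    using lhom_restrict_comp[OF e lhom_to_transport[where e = e and \<sigma> = \<sigma>, OF M \<sigma>] P] lhom_closed[OF e] by (simp cong: restrict_cong)
  moreover have "(\<lambda>x\<in>carrier (P 0). \<sigma> (e x)) ` carrier (P 0) = carrier (transport \<sigma> e M)"
    by (simp flip: resD(4) add: image_image)
  moreover have "{x \<in> carrier (P 0). (\<lambda>x\<in>carrier (P 0). \<sigma> (e x)) x = \<zero>\<^bsub>transport \<sigma> e M\<^esub>} =
      {x \<in> carrier (P 0). e x = \<zero>\<^bsub>M\<^esub>}"
    using lhom_closed[OF e] by (auto simp: inj)
  ultimately show ?thesis
    using res by (simp add: finite_projective_resolution_def)
qed

lemma (in ring) left_module_regular: "left_module R (regular_module R)"
  by (rule left_moduleI) (auto simp: regular_module_def ring_axioms m_assoc l_distr r_distr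
    intro: abelian_group_cong[OF abelian_group_axioms])

lemma regular_module_simps [simp]:
  "carrier (regular_module R) = carrier R" "\<zero>\<^bsub>regular_module R\<^esub> = \<zero>\<^bsub>R\<^esub>"
  "add (regular_module R) = add R" "a \<odot>\<^bsub>regular_module R\<^esub> x = a \<otimes>\<^bsub>R\<^esub> x"
  by (simp_all add: regular_module_def)

section \<open>The resolution of \<open>B\<close> and the cohomology of the coinduced
  complex\<close>

context ring_epi
begin

abbreviation "BA \<equiv> restrict_scalars h (regular_module B)"

lemma left_module_BA: "left_module A BA"
  by (rule left_module_restrict_scalars[OF B.left_module_regular])

text \<open>Turns an element \<open>y\<close> of the coinduced module back into the homomorphism
  from \<open>B\<close> that takes 1 to \<open>y\<close>.\<close>

lemma orbit_map_lhom:
  assumes M: "left_module A M" and y: "y \<in> carrier (coinduced M)"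
  shows "(\<lambda>b\<in>carrier B. b \<odot>\<^bsub>coinduced M\<^esub> y) \<in> lhom A BA M"
proof -
  interpret M: left_module B "coinduced M" by (rule left_module_coinduced[OF M])
  show ?thesis
    unfolding lhom_coinduced[OF B.left_module_regular M]
    using y by (intro lhomI)
      (auto simp del: coinduced_simps simp: M.lm_smult_closed M.lm_smult_l_distr M.lm_smult_assoc)
qed

text \<open>The resolution serves surjectivity. A cocycle \<open>x\<close> of the coinduced complex
  is compared with W over \<open>P\<close>; vanishing of the higher Hom groups makes the W-part
  descend to \<open>B\<close>, where it is a single element \<open>w\<close>, and K-injectivity
  bounds the remainder \<open>x - i w\<close> within the coinduced complex.\<close>

lemma cohomology_bij_coinduced:
  fixes W :: "('b, 'u) cochain_complex" and J :: "('a, 'u) cochain_complex"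
    and P :: "nat \<Rightarrow> ('a, 'u) module" and pr :: "'u \<Rightarrow> 'u \<Rightarrow> 'u"
  assumes pairing: "pairing pr p1 p2"
    and W: "is_complex B W" and J: "null_from_acyclic A J"
    and i: "quasi_iso A (restrict_scalars_complex h W) J i"
    and res: "finite_projective_resolution A BA n P d e"
    and hom0: "\<And>j (V :: ('b, 'u) module). j > 0 \<Longrightarrow> left_module B V \<Longrightarrow>
       lhom A (P j) (restrict_scalars h V) = {\<lambda>x\<in>carrier (P j). \<zero>\<^bsub>V\<^esub>}"
  shows "cohomology_bij W (coinduced_complex J) i"
proof -
  interpret pairing pr p1 p2 by fact
  let ?W = "restrict_scalars_complex h W"
  let ?J' = "coinduced_complex J"
  have iA: "chain_map A ?W J i" and ibij: "cohomology_bij ?W J i"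
    using i by (simp_all add: quasi_iso_iff)
  have iB: "chain_map B W ?J' i" by (rule chain_map_coinduced[OF W iA])
  interpret WA: cpx A ?W using iA by unfold_locales (simp add: chain_map_def)
  interpret J: cpx A J using iA by unfold_locales (simp add: chain_map_def)
  interpret i: cmap A ?W J i using iA by (simp add: chain_map_iff)
  interpret i': cmap B W ?J' i using iB by (simp add: chain_map_iff)
  note resD = finite_projective_resolutionD[OF res]
  note P = projective_module_left_module[OF resD(1)]
  note e = resD(3)
  note [simp] = coinduced_smult[OF J.left_module]
  have J'J: "x \<in> carrier (obj J m)" if "x \<in> carrier (obj ?J' m)" for m x
    using that by simp
  have dJ': "dif ?J' m x = dif J m x" if "x \<in> carrier (obj ?J' m)" for m x
    using that by (simp only: obj_coinduced dif_coinduced)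
  have "\<exists>w\<in>cocycles W N. \<exists>b\<in>coboundaries ?J' N. x = i N w \<oplus>\<^bsub>obj ?J' N\<^esub> b"
    if x: "x \<in> cocycles ?J' N" for N x
  proof -
    have xc: "x \<in> carrier (coinduced (obj J N))" and dx: "dif J N x = \<zero>\<^bsub>obj J (N + 1)\<^esub>"
      using x dJ'[of x N] by (auto simp only: cocycles_def obj_coinduced coinduced_simps(2))
    let ?F = "fibre ?W J i"
    interpret F: cpx A ?F by unfold_locales (rule is_complex_fibre[OF iA])
    \<comment> \<open>\<open>x\<close> gives a cocycle of \<open>Hom(P, J)\<close>; a null-homotopy \<open>s\<close> of its image in \<open>Hom(P, fibre i)\<close>, shifted
      by one, shows that it comes from \<open>Hom(P, W)\<close> up to a coboundary.\<close>
    define \<phi> where "\<phi> = (\<lambda>p\<in>carrier (P 0). pr \<zero>\<^bsub>obj W (N + 1)\<^esub> (e p \<odot>\<^bsub>coinduced (obj J N)\<^esub> x))"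
    have orb: "(\<lambda>p\<in>carrier (P 0). e p \<odot>\<^bsub>coinduced (obj J N)\<^esub> y) \<in> lhom A (P 0) (obj J N)"
      if "y \<in> carrier (coinduced (obj J N))" for y
      using lhom_restrict_comp[OF e orbit_map_lhom[OF J.left_module that] P] lhom_closed[OF e]
      by (simp cong: restrict_cong)
    have \<phi>l: "\<phi> \<in> lhom A (P 0) (obj ?F (N + 1))"
      using lhom_pr[OF lhom_restrict_zero[OF P WA.left_module[of "N + 1"]] orb[OF xc] P]
      by (simp add: \<phi>_def cong: restrict_cong)
    \<comment> \<open>The differential of the coinduced complex is \<open>B\<close>-linear, so the
      whole orbit of a cocycle consists of cocycles.\<close>
    have dorb: "dif J N (b \<odot>\<^bsub>coinduced (obj J N)\<^esub> y) = \<zero>\<^bsub>obj J (N + 1)\<^esub>"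
      if "b \<in> carrier B" "y \<in> carrier (coinduced (obj J N))" "dif J N y = \<zero>\<^bsub>obj J (N + 1)\<^esub>" for b y
      using that i'.Y.dif_smult[of b y N] dJ'[of y N] dJ'[of "b \<odot>\<^bsub>coinduced (obj J N)\<^esub> y" N]
        i'.Y.smult_closed[of b y N] left_module.smult_zero[OF i'.Y.left_module[of "N + 1"]]
      by (simp del: coinduced_simps(1) i'.Y.dif_smult)
    have e0: "\<zero>\<^bsub>B\<^esub> \<odot>\<^bsub>coinduced (obj J N)\<^esub> y = \<zero>\<^bsub>obj J N\<^esub>" if "y \<in> carrier (coinduced (obj J N))" for y
      using left_module.smult_l_zero[OF left_module_coinduced[OF J.left_module] that] by simp
    have orbc: "b \<odot>\<^bsub>coinduced (obj J N)\<^esub> y \<in> carrier (coinduced (obj J N))"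
      if "b \<in> carrier B" "y \<in> carrier (coinduced (obj J N))" for b y
      using left_module.lm_smult_closed[OF left_module_coinduced[OF J.left_module] that] .
    have ec: "e p \<in> carrier B" if "p \<in> carrier (P 0)" for p
      using lhom_closed[OF e that] by simp
    have "dif ?F (N + 1) (\<phi> p) = \<zero>\<^bsub>obj ?F (N + 2)\<^esub>" if p: "p \<in> carrier (P 0)" for p
      using p orbc[OF ec[OF p] xc] dorb[OF ec[OF p] xc dx] i'.X.dif_zero[of "N + 1"]
      by (simp add: \<phi>_def pr_eq_iff a_minus_def add.commute[of 2 N] add.commute[of 1 N])
    moreover have "\<phi> (d 0 p) = \<zero>\<^bsub>obj ?F (N + 1)\<^esub>" if "p \<in> carrier (P (Suc 0))" for p
      using that lhom_closed[OF resD(2)[of 0]] finite_projective_resolution_zero(1)[OF res that] e0[OF xc]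
      by (simp add: \<phi>_def)
    ultimately obtain s where s: "\<And>j. s j \<in> lhom A (P j) (obj ?F (N - int j))"
      "\<And>p. p \<in> carrier (P 0) \<Longrightarrow> dif ?F N (s 0 p) = \<phi> p"
      "\<And>j p. p \<in> carrier (P (Suc j)) \<Longrightarrow>
         dif ?F (N - int (Suc j)) (s (Suc j) p) = \<ominus>\<^bsub>obj ?F (N - int j)\<^esub> s j (d j p)"
      using lift_along_projectives[where P = P and d = d, OF F.is_complex acyclic_fibre[OF i] resD(1,2)
          finite_projective_resolution_zero(2)[OF res] \<phi>l] by metis
    \<comment> \<open>The two components of \<open>s\<close>. The sign of \<open>t\<close> is chosen
      so that \<open>e p\<close> applied to \<open>x\<close> becomes
      \<open>i (v 0 p) + dif (t 0 p)\<close> and the \<open>t j\<close> commute with the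
      differentials without signs.\<close>
    define v t where "v = (\<lambda>j. \<lambda>p\<in>carrier (P j). p1 (s j p))"
      and "t = (\<lambda>j. \<lambda>p\<in>carrier (P j). \<ominus>\<^bsub>obj J (N - int j - 1)\<^esub> p2 (s j p))"
    have sc: "p1 (s j p) \<in> carrier (obj W (N - int j))" "p2 (s j p) \<in> carrier (obj J (N - int j - 1))"
      if "p \<in> carrier (P j)" for j p
      using lhom_closed[OF s(1) that] by auto
    have v: "v j \<in> lhom A (P j) (restrict_scalars h (obj W (N - int j)))" for j
      using lhom_restrict_comp[OF s(1)[unfolded obj_fibre] lhom_p1[OF WA.left_module J.left_module] P] sc
      by (simp add: v_def cong: restrict_cong)
    have t: "t j \<in> lhom A (P j) (obj J (N - int j - 1))" for j
      using lhom_restrict_neg[OF lhom_restrict_comp[OF s(1)[unfolded obj_fibre] lhom_p2[OF WA.left_module J.left_module] P]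
         P J.left_module] sc
      by (simp add: t_def cong: restrict_cong)
    \<comment> \<open>This is where the vanishing of homomorphisms from \<open>P j\<close> into
      \<open>B\<close>-modules enters, applied to the module of \<open>W\<close> in degree
      \<open>N - j\<close>.\<close>
    have v0: "p1 (s j p) = \<zero>\<^bsub>obj W (N - int j)\<^esub>" if "j > 0" "p \<in> carrier (P j)" for j p
      using v[of j] hom0[OF that(1) i'.X.left_module[of "N - int j"]] that(2)
      by (auto simp: v_def fun_eq_iff split: if_splits)
    have neg: "p1 (\<ominus>\<^bsub>obj ?F m\<^esub> z) = \<ominus>\<^bsub>obj W m\<^esub> p1 z" "p2 (\<ominus>\<^bsub>obj ?F m\<^esub> z) = \<ominus>\<^bsub>obj J (m - 1)\<^esub> p2 z"
      if z: "z \<in> carrier (obj ?F m)" for m z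
    proof -
      have "\<ominus>\<^bsub>obj ?F m\<^esub> z = pr (\<ominus>\<^bsub>obj W m\<^esub> p1 z) (\<ominus>\<^bsub>obj J (m - 1)\<^esub> p2 z)"
        by (rule F.g.minus_equality) (use z in \<open>auto simp: i'.X.g.l_neg J.g.l_neg\<close>)
      then show "p1 (\<ominus>\<^bsub>obj ?F m\<^esub> z) = \<ominus>\<^bsub>obj W m\<^esub> p1 z" "p2 (\<ominus>\<^bsub>obj ?F m\<^esub> z) = \<ominus>\<^bsub>obj J (m - 1)\<^esub> p2 z"
        by simp_all
    qed
    have s0: "dif W N (p1 (s 0 p)) = \<zero>\<^bsub>obj W (N + 1)\<^esub>"
      "i N (p1 (s 0 p)) \<ominus>\<^bsub>obj J N\<^esub> dif J (N - 1) (p2 (s 0 p)) = e p \<odot>\<^bsub>coinduced (obj J N)\<^esub> x"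
      if p: "p \<in> carrier (P 0)" for p
      using s(2)[OF p] sc[OF p] p by (auto simp: \<phi>_def pr_eq_iff)
    have dc: "d j p \<in> carrier (P j)" if "p \<in> carrier (P (Suc j))" for j p
      using lhom_closed[OF resD(2) that] .
    \<comment> \<open>First component of the homotopy identity on \<open>P 1\<close>: its left side
      is the differential of \<open>v 1 p\<close>, which vanishes with \<open>v 1\<close>.\<close>
    have vd: "v 0 (d 0 p) = \<zero>\<^bsub>obj W N\<^esub>" if p: "p \<in> carrier (P (Suc 0))" for p
    proof -
      have "p1 (dif ?F (N - 1) (s (Suc 0) p)) = \<ominus>\<^bsub>obj W N\<^esub> p1 (s 0 (d 0 p))"
        using s(3)[of p 0] p neg(1)[OF lhom_closed[OF s(1) dc[OF p]]] by simp
      moreover have "p1 (dif ?F (N - 1) (s (Suc 0) p)) = \<zero>\<^bsub>obj W N\<^esub>"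
        using sc[OF p] v0[OF _ p] i'.X.dif_zero[of "N - 1"] by simp
      ultimately have "\<ominus>\<^bsub>obj W N\<^esub> p1 (s 0 (d 0 p)) = \<zero>\<^bsub>obj W N\<^esub>" by simp
      moreover have "\<ominus>\<^bsub>obj W N\<^esub> (\<ominus>\<^bsub>obj W N\<^esub> p1 (s 0 (d 0 p))) = p1 (s 0 (d 0 p))"
        using sc[OF dc[OF p]] by (intro i'.X.g.minus_minus) simp
      ultimately show ?thesis
        using dc[OF p] by (simp add: v_def)
    qed
    \<comment> \<open>Second component of the homotopy identity: the term
      \<open>i (v (Suc j) p)\<close> vanishes by \<open>v0\<close>, which leaves a relation among
      the \<open>t j\<close> alone.\<close>
    have dt: "dif J (N - int (Suc j) - 1) (t (Suc j) p) = t j (d j p)" if p: "p \<in> carrier (P (Suc j))" for j p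
    proof -
      have [simp]: "N - (1 + int j) = N - int j - 1" by simp
      have "p2 (dif ?F (N - int (Suc j)) (s (Suc j) p)) = \<ominus>\<^bsub>obj J (N - int j - 1)\<^esub> p2 (s j (d j p))"
        unfolding s(3)[OF p] by (rule neg(2)[OF lhom_closed[OF s(1) dc[OF p]]])
      moreover have "p2 (dif ?F (N - int (Suc j)) (s (Suc j) p)) =
         \<ominus>\<^bsub>obj J (N - int (Suc j))\<^esub> dif J (N - int (Suc j) - 1) (p2 (s (Suc j) p))"
        using sc[OF p] v0[OF _ p] i.map_zero[of "N - int (Suc j)"] J.dif_closed2[OF sc(2)[OF p]]
        by (simp add: a_minus_def)
      moreover have "dif J (N - int (Suc j) - 1) (t (Suc j) p) =
         \<ominus>\<^bsub>obj J (N - int (Suc j))\<^esub> dif J (N - int (Suc j) - 1) (p2 (s (Suc j) p))"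
        using J.dif_neg[OF sc(2)[OF p]] p by (simp add: t_def)
      ultimately show ?thesis
        using p dc[OF p] by (simp add: t_def)
    qed
    obtain u where u: "u \<in> carrier (P 0)" "e u = \<one>\<^bsub>B\<^esub>"
      using resD(4) B.one_closed by (metis imageE regular_module_simps(1) restrict_scalars_simps(1))
    \<comment> \<open>Since \<open>v j = 0\<close> for \<open>j > 0\<close>, the map \<open>v 0\<close> factors through \<open>e\<close>, so it is the orbit map of some \<open>w\<close>.\<close>
    define w where "w = v 0 u"
    have w: "w \<in> carrier (obj W N)" "dif W N w = \<zero>\<^bsub>obj W (N + 1)\<^esub>"
      using sc[OF u(1)] s0[OF u(1)] u(1) by (simp_all add: w_def v_def)
    have ve: "v 0 p = e p \<odot>\<^bsub>obj W N\<^esub> w" if p: "p \<in> carrier (P 0)" for p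
    proof -
      interpret P0: left_module A "P 0" by (rule P)
      have v00: "v 0 \<in> lhom A (P 0) (restrict_scalars h (obj W N))" using v[of 0] by simp
      note G = P0.M.abelian_group_axioms left_module_group[OF left_module_BA] WA.abelian_group[of N, simplified]
      \<comment> \<open>Lifting the scalar \<open>e p\<close> to \<open>A\<close> makes
        \<open>p - a u\<close> an element of augmentation zero, hence in the image of
        \<open>d 0\<close>, where \<open>v 0\<close> vanishes.\<close>
      obtain a where a: "a \<in> carrier A" "e p = h a" using ec[OF p] by (rule surjE)
      let ?q = "p \<ominus>\<^bsub>P 0\<^esub> a \<odot>\<^bsub>P 0\<^esub> u"
      have au: "a \<odot>\<^bsub>P 0\<^esub> u \<in> carrier (P 0)" using a u P0.lm_smult_closed by simp
      have "e ?q = e p \<ominus>\<^bsub>BA\<^esub> e (a \<odot>\<^bsub>P 0\<^esub> u)"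
        by (rule lhom_minus[OF e G(1,2) p au])
      also have "e (a \<odot>\<^bsub>P 0\<^esub> u) = e p"
        using lhom_smult[OF e a(1) u(1)] a u by simp
      also have "e p \<ominus>\<^bsub>BA\<^esub> e p = \<zero>\<^bsub>BA\<^esub>"
        using abelian_group.r_neg[OF G(2)] lhom_closed[OF e p] by (simp only: a_minus_def)
      finally have "?q \<in> d 0 ` carrier (P (Suc 0))"
        using p au resD(5) by blast
      then have "v 0 ?q = \<zero>\<^bsub>obj W N\<^esub>" using vd by auto
      then have "v 0 p \<ominus>\<^bsub>restrict_scalars h (obj W N)\<^esub> v 0 (a \<odot>\<^bsub>P 0\<^esub> u) = \<zero>\<^bsub>restrict_scalars h (obj W N)\<^esub>"
        using lhom_minus[OF v00 G(1,3) p au] by simp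
      then have "v 0 p = v 0 (a \<odot>\<^bsub>P 0\<^esub> u)"
        using lhom_closed[OF v00 p] lhom_closed[OF v00 au]
          WA.minus_eq_zeroD[of "v 0 p" N "v 0 (a \<odot>\<^bsub>P 0\<^esub> u)"] by simp
      then show ?thesis
        using lhom_smult[OF v00 a(1) u(1)] a by (simp add: w_def)
    qed
    \<comment> \<open>\<open>y\<close> is \<open>x - i w\<close>. Writing the second term as the
      image of \<open>- w\<close> lets membership in the coinduced module follow from closure under
      addition and under \<open>i\<close>.\<close>
    define y where "y = x \<oplus>\<^bsub>obj J N\<^esub> i N (\<ominus>\<^bsub>obj W N\<^esub> w)"
    have nw: "i N (\<ominus>\<^bsub>obj W N\<^esub> w) = \<ominus>\<^bsub>obj J N\<^esub> i N w"
      using i.map_neg[of w N] w by simp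
    have ic: "i N w \<in> carrier (coinduced (obj J N))" "i N (\<ominus>\<^bsub>obj W N\<^esub> w) \<in> carrier (coinduced (obj J N))"
      using i'.map_closed[of _ N] w by (simp_all del: coinduced_simps(1) i'.map_neg)
    have yc: "y \<in> carrier (coinduced (obj J N))"
      unfolding y_def using i'.Y.g.a_closed[of x N "i N (\<ominus>\<^bsub>obj W N\<^esub> w)"] xc ic
      by (simp del: coinduced_simps(1))
    have "dif J N (i N w) = i (N + 1) (dif W N w)"
      using i.map_dif[of w N] w(1) by simp
    then have "dif J N (i N w) = \<zero>\<^bsub>obj J (N + 1)\<^esub>"
      using i.map_zero[of "N + 1"] w(2) by simp
    then have dy: "dif J N y = \<zero>\<^bsub>obj J (N + 1)\<^esub>"
      unfolding y_def nw using J'J[of x N] J'J[of "i N w" N] xc ic(1) dx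
      by (simp del: coinduced_simps(1))
    \<comment> \<open>By \<open>ve\<close> and linearity, \<open>e p\<close> times
      \<open>i w\<close> equals \<open>i (v 0 p)\<close>. Subtracting this from the second identity
      in \<open>s0\<close> leaves the differential of \<open>t 0 p\<close>.\<close>
    have ey: "e p \<odot>\<^bsub>coinduced (obj J N)\<^esub> y = dif J (N - 1) (t 0 p)" if p: "p \<in> carrier (P 0)" for p
    proof -
      have "e p \<odot>\<^bsub>coinduced (obj J N)\<^esub> y = e p \<odot>\<^bsub>coinduced (obj J N)\<^esub> x \<oplus>\<^bsub>obj J N\<^esub>
         e p \<odot>\<^bsub>coinduced (obj J N)\<^esub> i N (\<ominus>\<^bsub>obj W N\<^esub> w)"
        using left_module.lm_smult_r_distr[OF left_module_coinduced[OF J.left_module] ec[OF p] xc ic(2)]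
        by (simp add: y_def)
      also have "e p \<odot>\<^bsub>coinduced (obj J N)\<^esub> i N (\<ominus>\<^bsub>obj W N\<^esub> w) = i N (e p \<odot>\<^bsub>obj W N\<^esub> (\<ominus>\<^bsub>obj W N\<^esub> w))"
        using i'.map_smult[OF ec[OF p], of "\<ominus>\<^bsub>obj W N\<^esub> w" N] w by (simp del: coinduced_simps i'.map_neg)
      also have "e p \<odot>\<^bsub>obj W N\<^esub> (\<ominus>\<^bsub>obj W N\<^esub> w) = \<ominus>\<^bsub>obj W N\<^esub> p1 (s 0 p)"
        using left_module.smult_neg[OF i'.X.left_module ec[OF p] w(1)] ve[OF p] p by (simp add: v_def)
      also have "i N (\<ominus>\<^bsub>obj W N\<^esub> p1 (s 0 p)) = \<ominus>\<^bsub>obj J N\<^esub> i N (p1 (s 0 p))"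
        using i.map_neg[of "p1 (s 0 p)" N] sc[OF p] by simp
      also have "e p \<odot>\<^bsub>coinduced (obj J N)\<^esub> x = i N (p1 (s 0 p)) \<ominus>\<^bsub>obj J N\<^esub> dif J (N - 1) (p2 (s 0 p))"
        using s0(2)[OF p] by simp
      also have "\<dots> \<oplus>\<^bsub>obj J N\<^esub> \<ominus>\<^bsub>obj J N\<^esub> i N (p1 (s 0 p)) = \<ominus>\<^bsub>obj J N\<^esub> dif J (N - 1) (p2 (s 0 p))"
        using sc[OF p] i.map_closed[of "p1 (s 0 p)" N] by (simp add: a_minus_def J.g.a_ac J.a_cancel2 J.g.r_neg2)
      finally show ?thesis
        using J.dif_neg[of "p2 (s 0 p)" "N - 1"] sc[OF p] p by (simp add: t_def)
    qed
    \<comment> \<open>The orbit map of \<open>y\<close> on \<open>B\<close> and the \<open>t j\<close> on \<open>P j\<close> form a chain map from the augmented, acyclic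
      complex to \<open>J\<close>; its null-homotopy makes \<open>y\<close> a coboundary within \<open>Hom\<^sub>A(B, J)\<close>.\<close>
    define \<sigma> where "\<sigma> = inv_into (carrier (P 0)) e"
    have e\<sigma>: "e (\<sigma> b) = b" if "b \<in> carrier BA" for b
      unfolding \<sigma>_def using that resD(4) by (intro f_inv_into_f) auto
    \<comment> \<open>The copy of \<open>B\<close> in \<open>'u\<close>, carried by the preimages
      under \<open>e\<close> that \<open>\<sigma>\<close> selects.\<close>
    let ?M = "transport \<sigma> e BA"
    let ?X = "augmented_complex N P d ?M (\<lambda>p\<in>carrier (P 0). \<sigma> (e p))"
    note M = left_module_transport[of A BA e \<sigma>, OF left_module_BA e\<sigma>]
    note res' = transport_resolution[OF res left_module_BA e\<sigma>]
    interpret X: cpx A ?X by unfold_locales (rule is_complex_augmented[OF res' M])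
    define \<theta> where "\<theta> k = (if k = N then (\<lambda>m\<in>carrier ?M. e m \<odot>\<^bsub>coinduced (obj J N)\<^esub> y)
      else if k < N then t (nat (N - 1 - k)) else (\<lambda>m\<in>{\<zero>\<^bsub>?M\<^esub>}. \<zero>\<^bsub>obj J k\<^esub>))" for k
    have \<theta>N: "\<theta> N = (\<lambda>m\<in>carrier ?M. e m \<odot>\<^bsub>coinduced (obj J N)\<^esub> y)"
      and \<theta>P: "\<theta> (N - 1 - int j) = t j" 
      and \<theta>Z: "N < k \<Longrightarrow> \<theta> k = (\<lambda>m\<in>{\<zero>\<^bsub>?M\<^esub>}. \<zero>\<^bsub>obj J k\<^esub>)" for j k
      by (simp_all add: \<theta>_def)
    have emc: "e m \<in> carrier B" if "m \<in> carrier ?M" for m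
      using that e\<sigma> by auto
    have \<theta>l: "\<theta> k \<in> lhom A (obj ?X k) (obj J k)" for k
    proof (rule int_cases_below[of k N])
      assume k: "k = N"
      show ?thesis
        using lhom_restrict_comp[OF lhom_from_transport[of A BA e \<sigma>, OF left_module_BA e\<sigma>]
            orbit_map_lhom[OF J.left_module yc] M] emc
        by (simp add: k \<theta>N cong: restrict_cong)
    next
      assume k: "N < k"
      then have "left_module A (?M\<lparr>carrier := {\<zero>\<^bsub>?M\<^esub>}\<rparr>)"
        using X.left_module[of k] by (simp del: transport_simps)
      from lhom_restrict_zero[OF this J.left_module[of k]] show ?thesis
        using k by (simp add: \<theta>Z del: transport_simps)
    next
      assume k: "k = N - 1"
      then show ?thesis using \<theta>P[of 0] t[of 0] by simp
    next
      fix j assume k: "k = N - 1 - int (Suc j)"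
      show ?thesis
        unfolding k \<theta>P using t[of "Suc j"] by (simp del: transport_simps)
    qed
    \<comment> \<open>The three facts prepared above fit together: in degree \<open>N\<close> the
      square is \<open>dorb\<close> with \<open>dy\<close>, in degree \<open>N - 1\<close> it is
      \<open>ey\<close>, and below that it is \<open>dt\<close>.\<close>
    have \<theta>d: "\<theta> (k + 1) (dif ?X k m) = dif J k (\<theta> k m)" if m: "m \<in> carrier (obj ?X k)" for k m
    proof (rule int_cases_below[of k N])
      assume k: "k = N"
      show ?thesis
        using m dorb[OF emc yc dy] unfolding k by (simp add: \<theta>N \<theta>Z del: transport_simps)
    next
      assume k: "N < k"
      then show ?thesis using m by (simp add: \<theta>Z del: transport_simps)
    next
      assume k: "k = N - 1"
      then show ?thesis
        using m ey[of m] \<theta>P[of 0] e\<sigma>[OF lhom_closed[OF e]] lhom_closed[OF e, of m] by (simp add: \<theta>N)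
    next
      fix j assume k: "k = N - 1 - int (Suc j)"
      then have "k + 1 = N - 1 - int j" by simp
      then have "\<theta> (k + 1) = t j" "\<theta> k = t (Suc j)"
        by (simp_all only: k \<theta>P)
      then show ?thesis
        using m dt[of m j] by (simp add: k)
    qed
    have "chain_map A ?X J \<theta>"
      unfolding chain_map_def using X.is_complex J.is_complex \<theta>l \<theta>d by blast
    from null_from_acyclicE[OF J this acyclic_augmented[OF res' M]]
    obtain r where r: "\<And>k. r k \<in> lhom A (obj ?X k) (obj J (k - 1))"
      "\<And>k m. m \<in> carrier (obj ?X k) \<Longrightarrow> \<theta> k m = dif J (k - 1) (r k m) \<oplus>\<^bsub>obj J k\<^esub> r (k + 1) (dif ?X k m)"
      by metis
    define m where "m = \<sigma> \<one>\<^bsub>B\<^esub>"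
    have m: "m \<in> carrier ?M" "e m = \<one>\<^bsub>B\<^esub>"
      using e\<sigma> by (simp_all add: m_def)
    have rN: "r N \<in> lhom A ?M (obj J (N - 1))" using r(1)[of N] by simp
    \<comment> \<open>The homotopy identity is read off in degree \<open>N\<close> at the generator
      \<open>m\<close>. The differential leaving degree \<open>N\<close> of the augmented complex is
      zero, so only the term with \<open>r N m\<close> survives.\<close>
    have "r (N + 1) \<zero>\<^bsub>?M\<^esub> = \<zero>\<^bsub>obj J N\<^esub>"
      using lhom_zero[OF r(1)[of "N + 1"] X.abelian_group J.abelian_group] by (simp del: transport_simps)
    moreover have "\<one>\<^bsub>B\<^esub> \<odot>\<^bsub>coinduced (obj J N)\<^esub> y = y"
      by (rule left_module.lm_smult_one[OF left_module_coinduced[OF J.left_module] yc])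
    ultimately have y: "y = dif J (N - 1) (r N m)"
      using r(2)[of m N] m lhom_closed[OF rN m(1)] by (simp add: \<theta>N del: transport_simps)
    \<comment> \<open>The kernel of \<open>h\<close> annihilates the generator \<open>m\<close> of
      the copy of \<open>B\<close>, hence also its image. So the primitive lies in the coinduced
      submodule and not merely in \<open>J\<close>.\<close>
    have "a \<odot>\<^bsub>obj J (N - 1)\<^esub> r N m = \<zero>\<^bsub>obj J (N - 1)\<^esub>" if "a \<in> carrier A" "h a = \<zero>\<^bsub>B\<^esub>" for a
    proof -
      have "a \<odot>\<^bsub>obj J (N - 1)\<^esub> r N m = r N (a \<odot>\<^bsub>?M\<^esub> m)"
        using lhom_smult[OF rN that(1) m(1)] by simp
      also have "a \<odot>\<^bsub>?M\<^esub> m = \<zero>\<^bsub>?M\<^esub>" using that m by simp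
      also have "r N \<zero>\<^bsub>?M\<^esub> = \<zero>\<^bsub>obj J (N - 1)\<^esub>"
        using lhom_zero[OF rN left_module_group[OF M] J.abelian_group] .
      finally show ?thesis .
    qed
    then have rm: "r N m \<in> carrier (obj ?J' (N - 1))"
      using lhom_closed[OF rN m(1)] by simp
    have "y \<in> coboundaries ?J' N"
      using dJ'[OF rm] y by (intro i'.Y.coboundariesI[OF rm]) simp
    moreover have "x = i N w \<oplus>\<^bsub>obj ?J' N\<^esub> y"
      using xc ic(1) by (simp add: y_def nw J.g.a_ac J.g.r_neg J.a_cancel2)
    moreover have "w \<in> cocycles W N" using w by (simp add: cocycles_def)
    ultimately show ?thesis by blast
  qed
  \<comment> \<open>Injectivity is inherited from W -> J: a primitive in the coinduced complex is
    also one in \<open>J\<close>.\<close>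
  moreover have "w \<in> coboundaries W N" if wc: "w \<in> cocycles W N" "i N w \<in> coboundaries ?J' N" for w N
  proof -
    obtain z where z: "z \<in> carrier (obj ?J' (N - 1))" "i N w = dif ?J' (N - 1) z"
      using wc(2) unfolding coboundaries_def by blast
    then have "i N w \<in> coboundaries J N"
      using dJ'[OF z(1)] J'J[OF z(1)] by (auto simp: coboundaries_def)
    then show ?thesis using ibij wc(1) by (simp add: cohomology_bij_def)
  qed
  ultimately show ?thesis unfolding cohomology_bij_def by blast
qed

end

section \<open>Hom complexes\<close>

text \<open>Makes an integer multiple of an \<open>R\<close>-linear map again
  \<open>R\<close>-linear, as the action of the integers on \<open>hom_group\<close>
  requires.\<close>

lemma (in left_module) smult_add_pow:
  assumes "a \<in> carrier R" "x \<in> carrier M"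
  shows "a \<odot>\<^bsub>M\<^esub> ([(k::int)] \<cdot>\<^bsub>M\<^esub> x) = [k] \<cdot>\<^bsub>M\<^esub> (a \<odot>\<^bsub>M\<^esub> x)"
proof -
  have "(\<lambda>x. a \<odot>\<^bsub>M\<^esub> x) \<in> hom (add_monoid M) (add_monoid M)"
    using assms by (auto simp: hom_def lm_smult_closed lm_smult_r_distr)
  from hom_int_pow[OF this] show ?thesis
    using assms M.a_group by (simp add: add_pow_def)
qed

text \<open>The module axioms determine the action of the integers from the action of 1, so
  additivity implies linearity, by induction upwards and downwards from 0.\<close>

lemma lhom_intI:
  assumes "left_module \<Z> M" "left_module \<Z> N" "f \<in> extensional (carrier M)"
    "\<And>x. x \<in> carrier M \<Longrightarrow> f x \<in> carrier N"
    "\<And>x y. \<lbrakk>x \<in> carrier M; y \<in> carrier M\<rbrakk> \<Longrightarrow> f (x \<oplus>\<^bsub>M\<^esub> y) = f x \<oplus>\<^bsub>N\<^esub> f y"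
  shows "f \<in> lhom \<Z> M N"
proof (rule lhomI[OF assms(3-5)])
  interpret M: left_module \<Z> M by fact
  interpret N: left_module \<Z> N by fact
  fix k :: int and x assume x: "x \<in> carrier M"
  have cl: "k \<odot>\<^bsub>M\<^esub> x \<in> carrier M" "k \<odot>\<^bsub>N\<^esub> f x \<in> carrier N" for k
    using M.lm_smult_closed[of k x] N.lm_smult_closed[of k "f x"] x assms(4) by simp_all
  have sM: "(k + 1) \<odot>\<^bsub>M\<^esub> x = k \<odot>\<^bsub>M\<^esub> x \<oplus>\<^bsub>M\<^esub> x" for k
    using M.lm_smult_l_distr[of k 1 x] M.lm_smult_one[of x] x by simp
  have sN: "(k + 1) \<odot>\<^bsub>N\<^esub> f x = k \<odot>\<^bsub>N\<^esub> f x \<oplus>\<^bsub>N\<^esub> f x" for k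
    using N.lm_smult_l_distr[of k 1 "f x"] N.lm_smult_one[of "f x"] x assms(4) by simp
  have z: "0 \<odot>\<^bsub>M\<^esub> x = \<zero>\<^bsub>M\<^esub>" "0 \<odot>\<^bsub>N\<^esub> f x = \<zero>\<^bsub>N\<^esub>"
    using M.smult_l_zero[OF x] N.smult_l_zero[OF assms(4)[OF x]] by simp_all
  have "f \<zero>\<^bsub>M\<^esub> \<oplus>\<^bsub>N\<^esub> f \<zero>\<^bsub>M\<^esub> = f \<zero>\<^bsub>M\<^esub>"
    using assms(5)[of "\<zero>\<^bsub>M\<^esub>" "\<zero>\<^bsub>M\<^esub>"] by simp
  then have f0: "f \<zero>\<^bsub>M\<^esub> = \<zero>\<^bsub>N\<^esub>"
    using assms(4) N.M.add.r_cancel_one' by simp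
  show "f (k \<odot>\<^bsub>M\<^esub> x) = k \<odot>\<^bsub>N\<^esub> f x"
  proof (induction k rule: int_induct[of _ 0])
    case base
    show ?case using z f0 by simp
  next
    case (step1 i)
    then show ?case using sM[of i] sN[of i] assms(5)[OF cl(1) x, of i] by simp
  next
    case (step2 i)
    have "f ((i - 1) \<odot>\<^bsub>M\<^esub> x) \<oplus>\<^bsub>N\<^esub> f x = (i - 1) \<odot>\<^bsub>N\<^esub> f x \<oplus>\<^bsub>N\<^esub> f x"
      using sM[of "i - 1"] sN[of "i - 1"] assms(5)[OF cl(1) x, of "i - 1"] step2 by simp
    then show ?case
      using N.M.add.right_cancel[OF assms(4)[OF x] assms(4)[OF cl(1)] cl(2)] by simp
  qed
qed

lemma obj_hom_complex [simp]: "obj (hom_complex R X Y) n = hom_group R X Y n"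
  by (simp add: hom_complex_def)

locale hom_cpx = X: cpx R X + Y: cpx R Y
  for R :: "('r, 'c) ring_scheme" and X :: "('r, 'm) cochain_complex" and Y :: "('r, 'n) cochain_complex"
begin

abbreviation "H n \<equiv> hom_group R X Y n"
abbreviation "D n \<equiv> dif (hom_complex R X Y) n"

lemma carrier_H: "\<phi> \<in> carrier (H n) \<longleftrightarrow> (\<forall>p. \<phi> p \<in> lhom R (obj X p) (obj Y (p + n)))"
  by (simp add: hom_group_def)

lemma H_lhom: "\<phi> \<in> carrier (H n) \<Longrightarrow> m = p + n \<Longrightarrow> \<phi> p \<in> lhom R (obj X p) (obj Y m)"
  by (simp add: carrier_H)

lemma H_closed: "\<phi> \<in> carrier (H n) \<Longrightarrow> m = p + n \<Longrightarrow> x \<in> carrier (obj X p) \<Longrightarrow> \<phi> p x \<in> carrier (obj Y m)"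
  by (rule lhom_closed[OF H_lhom])

lemmas H_closed1 [simp] = H_closed[OF _ refl]

lemma H_closed2 [simp]: "\<phi> \<in> carrier (H n) \<Longrightarrow> x \<in> carrier (obj X (p + 1)) \<Longrightarrow> \<phi> (p + 1) x \<in> carrier (obj Y (p + n + 1))"
  by (erule H_closed) simp_all

lemma H_eqI:
  "\<phi> \<in> carrier (H n) \<Longrightarrow> \<psi> \<in> carrier (H n) \<Longrightarrow> (\<And>p x. x \<in> carrier (obj X p) \<Longrightarrow> \<phi> p x = \<psi> p x) \<Longrightarrow> \<phi> = \<psi>"
  by (rule ext, rule lhom_eqI) (auto simp: carrier_H)

lemma H_apply [simp]: "x \<in> carrier (obj X p) \<Longrightarrow> (\<phi> \<oplus>\<^bsub>H n\<^esub> \<psi>) p x = \<phi> p x \<oplus>\<^bsub>obj Y (p + n)\<^esub> \<psi> p x"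
  "x \<in> carrier (obj X p) \<Longrightarrow> \<zero>\<^bsub>H n\<^esub> p x = \<zero>\<^bsub>obj Y (p + n)\<^esub>"
  "x \<in> carrier (obj X p) \<Longrightarrow> (k \<odot>\<^bsub>H n\<^esub> \<phi>) p x = [k] \<cdot>\<^bsub>obj Y (p + n)\<^esub> (\<phi> p x)"
  by (simp_all add: hom_group_def)

lemma H_op_closed:
  "\<phi> \<in> carrier (H n) \<Longrightarrow> \<psi> \<in> carrier (H n) \<Longrightarrow> \<phi> \<oplus>\<^bsub>H n\<^esub> \<psi> \<in> carrier (H n)"
  "\<zero>\<^bsub>H n\<^esub> \<in> carrier (H n)"
  using X.left_module Y.left_module
  by (simp_all add: hom_group_def lhom_restrict_add lhom_restrict_zero)

lemma H_smult_closed: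
  assumes \<phi>: "\<phi> \<in> carrier (H n)" shows "k \<odot>\<^bsub>H n\<^esub> \<phi> \<in> carrier (H n)"
  unfolding carrier_H
proof
  fix p
  note l = H_lhom[OF \<phi> refl, of p]
  show "(k \<odot>\<^bsub>H n\<^esub> \<phi>) p \<in> lhom R (obj X p) (obj Y (p + n))"
    using \<phi>
    by (intro lhomI) (auto simp: hom_group_def lhom_closed[OF l] lhom_add[OF l] lhom_smult[OF l]
       Y.g.add.int_pow_distrib left_module.smult_add_pow[OF Y.left_module])
qed

lemma left_module_H: "left_module \<Z> (H n)"
proof (rule left_moduleI)
  show "ring \<Z>" using int_is_cring by (simp add: cring_def)
  show "abelian_group (H n)"
  proof (rule abelian_groupI)
    fix \<phi> assume \<phi>: "\<phi> \<in> carrier (H n)"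
    have "(- 1) \<odot>\<^bsub>H n\<^esub> \<phi> \<oplus>\<^bsub>H n\<^esub> \<phi> = \<zero>\<^bsub>H n\<^esub>"
      using \<phi> by (intro H_eqI[of _ n]) (auto simp: H_op_closed H_smult_closed Y.g.add.int_pow_neg Y.g.l_neg)
    then show "\<exists>\<psi>\<in>carrier (H n). \<psi> \<oplus>\<^bsub>H n\<^esub> \<phi> = \<zero>\<^bsub>H n\<^esub>" using H_smult_closed[OF \<phi>] by blast
  next
    fix \<phi> \<psi> \<chi> assume *: "\<phi> \<in> carrier (H n)" "\<psi> \<in> carrier (H n)" "\<chi> \<in> carrier (H n)"
    show "\<phi> \<oplus>\<^bsub>H n\<^esub> \<psi> \<oplus>\<^bsub>H n\<^esub> \<chi> = \<phi> \<oplus>\<^bsub>H n\<^esub> (\<psi> \<oplus>\<^bsub>H n\<^esub> \<chi>)"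
      using * by (intro H_eqI[of _ n]) (auto simp: H_op_closed Y.g.a_assoc)
  next
    fix \<phi> \<psi> assume *: "\<phi> \<in> carrier (H n)" "\<psi> \<in> carrier (H n)"
    show "\<phi> \<oplus>\<^bsub>H n\<^esub> \<psi> = \<psi> \<oplus>\<^bsub>H n\<^esub> \<phi>"
      using * by (intro H_eqI[of _ n]) (auto simp: H_op_closed Y.g.a_comm)
    show "\<phi> \<oplus>\<^bsub>H n\<^esub> \<psi> \<in> carrier (H n)" using * by (rule H_op_closed)
  next
    fix \<phi> assume *: "\<phi> \<in> carrier (H n)"
    show "\<zero>\<^bsub>H n\<^esub> \<oplus>\<^bsub>H n\<^esub> \<phi> = \<phi>"
      using * by (intro H_eqI[of _ n]) (auto simp: H_op_closed)
  qed (rule H_op_closed)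
next
  fix a b :: int and \<phi> \<psi> assume *: "\<phi> \<in> carrier (H n)"
  show "a \<odot>\<^bsub>H n\<^esub> \<phi> \<in> carrier (H n)" using * by (rule H_smult_closed)
  show "(a \<oplus>\<^bsub>\<Z>\<^esub> b) \<odot>\<^bsub>H n\<^esub> \<phi> = a \<odot>\<^bsub>H n\<^esub> \<phi> \<oplus>\<^bsub>H n\<^esub> b \<odot>\<^bsub>H n\<^esub> \<phi>"
    using * by (intro H_eqI[of _ n]) (auto simp: H_op_closed H_smult_closed Y.g.add.int_pow_mult)
  show "(a \<otimes>\<^bsub>\<Z>\<^esub> b) \<odot>\<^bsub>H n\<^esub> \<phi> = a \<odot>\<^bsub>H n\<^esub> (b \<odot>\<^bsub>H n\<^esub> \<phi>)"
    using * by (intro H_eqI[of _ n]) (auto simp: H_op_closed H_smult_closed Y.g.add.int_pow_pow mult.commute)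
  show "\<one>\<^bsub>\<Z>\<^esub> \<odot>\<^bsub>H n\<^esub> \<phi> = \<phi>"
    using * by (intro H_eqI[of _ n]) (auto simp: H_op_closed H_smult_closed)
  assume **: "\<psi> \<in> carrier (H n)"
  show "a \<odot>\<^bsub>H n\<^esub> (\<phi> \<oplus>\<^bsub>H n\<^esub> \<psi>) = a \<odot>\<^bsub>H n\<^esub> \<phi> \<oplus>\<^bsub>H n\<^esub> a \<odot>\<^bsub>H n\<^esub> \<psi>"
    using * ** by (intro H_eqI[of _ n]) (auto simp: H_op_closed H_smult_closed Y.g.add.int_pow_distrib)
qed

lemma D_apply: "\<phi> \<in> carrier (H n) \<Longrightarrow> x \<in> carrier (obj X p) \<Longrightarrow>
   D n \<phi> p x = (if even n then dif Y (p + n) (\<phi> p x) \<ominus>\<^bsub>obj Y (p + n + 1)\<^esub> \<phi> (p + 1) (dif X p x)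
     else dif Y (p + n) (\<phi> p x) \<oplus>\<^bsub>obj Y (p + n + 1)\<^esub> \<phi> (p + 1) (dif X p x))"
  by (simp add: hom_complex_def add.assoc)

lemma D_closed:
  assumes \<phi>: "\<phi> \<in> carrier (H n)"
  shows "D n \<phi> \<in> carrier (H (n + 1))"
  unfolding carrier_H
proof
  fix p
  let ?Y = "obj Y (p + n + 1)"
  have l: "(\<lambda>x\<in>carrier (obj X p). dif Y (p + n) (\<phi> p x)) \<in> lhom R (obj X p) ?Y"
    "(\<lambda>x\<in>carrier (obj X p). \<phi> (p + 1) (dif X p x)) \<in> lhom R (obj X p) ?Y"
    by (rule lhom_restrict_comp[OF H_lhom[OF \<phi> refl] Y.dif_lhom X.left_module],
        rule lhom_restrict_comp[OF X.dif_lhom H_lhom[OF \<phi>] X.left_module]) simp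
  have "D n \<phi> p = (if even n then \<lambda>x\<in>carrier (obj X p). dif Y (p + n) (\<phi> p x) \<ominus>\<^bsub>?Y\<^esub> \<phi> (p + 1) (dif X p x)
     else (\<lambda>x\<in>carrier (obj X p). dif Y (p + n) (\<phi> p x) \<oplus>\<^bsub>?Y\<^esub> \<phi> (p + 1) (dif X p x)))"
    using \<phi> by (auto simp: hom_complex_def add.assoc fun_eq_iff)
  also have "\<dots> \<in> lhom R (obj X p) ?Y"
    using lhom_restrict_add[OF l X.left_module Y.left_module]
      lhom_restrict_add[OF l(1) lhom_restrict_neg[OF l(2) X.left_module Y.left_module] X.left_module Y.left_module]
    by (simp add: a_minus_def cong: restrict_cong)
  finally show "D n \<phi> p \<in> lhom R (obj X p) (obj Y (p + (n + 1)))"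
    by (simp add: add.assoc)
qed

lemma D_extensional: "D n \<in> extensional (carrier (H n))"
  by (simp add: hom_complex_def)

text \<open>In the square of the differential the terms with two differentials on the same side
  vanish, and the two mixed terms cancel because \<open>n\<close> and \<open>n + 1\<close> have
  opposite parity.\<close>

lemma is_complex_hom: "is_complex \<Z> (hom_complex R X Y)"
  unfolding is_complex_def
proof (intro conjI allI ballI)
  fix n :: int
  have ix: "p + (n + 1) = p + n + 1" "p + (n + 2) = p + n + 2" "p + 1 + n = p + n + 1" "p + 1 + (n + 1) = p + n + 2" for p :: int by auto
  show "left_module \<Z> (obj (hom_complex R X Y) n)" by (simp add: left_module_H)
  show "D n \<in> lhom \<Z> (obj (hom_complex R X Y) n) (obj (hom_complex R X Y) (n + 1))"
    unfolding obj_hom_complex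
  proof (rule lhom_intI[OF left_module_H left_module_H D_extensional D_closed])
    fix \<phi> \<psi> assume *: "\<phi> \<in> carrier (H n)" "\<psi> \<in> carrier (H n)"
    have "D n (\<phi> \<oplus>\<^bsub>H n\<^esub> \<psi>) p x = (D n \<phi> \<oplus>\<^bsub>H (n + 1)\<^esub> D n \<psi>) p x" if x: "x \<in> carrier (obj X p)" for p x
      using * x by (simp add: D_apply H_op_closed ix a_minus_def Y.g.minus_add Y.g.a_ac)
    then show "D n (\<phi> \<oplus>\<^bsub>H n\<^esub> \<psi>) = D n \<phi> \<oplus>\<^bsub>H (n + 1)\<^esub> D n \<psi>"
      using * by (intro H_eqI[of _ "n + 1"] D_closed H_op_closed)
  qed
  fix \<phi> assume "\<phi> \<in> carrier (obj (hom_complex R X Y) n)"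
  then have \<phi>: "\<phi> \<in> carrier (H n)" by simp
  have "D (n + 1) (D n \<phi>) p x = \<zero>\<^bsub>H (n + 2)\<^esub> p x" if x: "x \<in> carrier (obj X p)" for p x
  proof -
    have z: "\<phi> (p + 2) \<zero>\<^bsub>obj X (p + 2)\<^esub> = \<zero>\<^bsub>obj Y (p + n + 2)\<^esub>"
      by (rule lhom_zero[OF H_lhom[OF \<phi>]]) auto
    have c: "dif Y (p + n + 1) (\<phi> (p + 1) (dif X p x)) \<in> carrier (obj Y (p + n + 2))"
      by (rule Y.dif_closed) (use \<phi> x in simp_all)
    show ?thesis
      using x \<phi> D_closed[OF \<phi>] z c
      by (simp add: D_apply ix add.commute[of 2] a_minus_def Y.g.r_neg Y.g.l_neg)
  qed
  then have "D (n + 1) (D n \<phi>) = \<zero>\<^bsub>H (n + 2)\<^esub>"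
    using D_closed[OF D_closed[OF \<phi>]] by (intro H_eqI[of _ "n + 2"] H_op_closed) (simp_all add: add.assoc)
  then show "D (n + 1) (D n \<phi>) = \<zero>\<^bsub>obj (hom_complex R X Y) (n + 2)\<^esub>" by simp
qed

end

text \<open>The functor Hom(V, -) on maps. \<open>f\<close> is an arbitrary family of functions, so
  that homotopies can be inserted as well as chain maps; over \<open>B\<close> the body is that of
  \<open>natural_RHom_map\<close>.\<close>

definition hom_post where
  "hom_post R V X f = (\<lambda>n. \<lambda>\<phi>\<in>carrier (hom_group R V X n). \<lambda>p. compose (carrier (obj V p)) (f (p + n)) (\<phi> p))"

lemma hom_post_apply:
  "\<phi> \<in> carrier (hom_group R V X n) \<Longrightarrow> x \<in> carrier (obj V p) \<Longrightarrow> hom_post R V X f n \<phi> p x = f (p + n) (\<phi> p x)"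
  by (simp add: hom_post_def compose_def)

lemma hom_post_closed:
  assumes "is_complex R V" "chain_map R X Y f" "\<phi> \<in> carrier (hom_group R V X n)"
  shows "hom_post R V X f n \<phi> \<in> carrier (hom_group R V Y n)"
proof -
  interpret V: cpx R V by unfold_locales fact
  interpret f: cmap R X Y f using assms(2) by (simp add: chain_map_iff)
  show ?thesis
    using assms(3) lhom_compose[OF _ f.map_lhom V.left_module] by (simp add: hom_group_def hom_post_def)
qed

lemma chain_map_hom_post:
  assumes V: "is_complex R V" and f: "chain_map R X Y f"
  shows "chain_map \<Z> (hom_complex R V X) (hom_complex R V Y) (hom_post R V X f)"
proof -
  interpret f: cmap R X Y f using f by (simp add: chain_map_iff)
  interpret HX: hom_cpx R V X by unfold_locales (fact V)
  interpret HY: hom_cpx R V Y by unfold_locales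
  note cl = hom_post_closed[OF V f]
  have "hom_post R V X f n \<in> lhom \<Z> (HX.H n) (HY.H n)" for n
  proof (rule lhom_intI[OF HX.left_module_H HY.left_module_H _ cl])
    fix \<phi> \<psi> assume *: "\<phi> \<in> carrier (HX.H n)" "\<psi> \<in> carrier (HX.H n)"
    then show "hom_post R V X f n (\<phi> \<oplus>\<^bsub>HX.H n\<^esub> \<psi>) = hom_post R V X f n \<phi> \<oplus>\<^bsub>HY.H n\<^esub> hom_post R V X f n \<psi>"
      by (intro HY.H_eqI[of _ n]) (auto simp: cl HX.H_op_closed HY.H_op_closed hom_post_apply)
  qed (simp add: hom_post_def extensional_def)
  moreover have "hom_post R V X f (n + 1) (HX.D n \<phi>) = HY.D n (hom_post R V X f n \<phi>)" if \<phi>: "\<phi> \<in> carrier (HX.H n)" for n \<phi>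
  proof (rule HY.H_eqI[of _ "n + 1"])
    show "hom_post R V X f (n + 1) (HX.D n \<phi>) \<in> carrier (HY.H (n + 1))"
      "HY.D n (hom_post R V X f n \<phi>) \<in> carrier (HY.H (n + 1))"
      using \<phi> by (auto simp: cl HX.D_closed HY.D_closed)
    fix p x assume x: "x \<in> carrier (obj V p)"
    have ix: "p + (n + 1) = p + n + 1" "p + 1 + n = p + n + 1" by auto
    show "hom_post R V X f (n + 1) (HX.D n \<phi>) p x = HY.D n (hom_post R V X f n \<phi>) p x"
      using \<phi> x by (simp add: hom_post_apply HX.D_closed HX.D_apply HY.D_apply cl ix)
  qed
  ultimately show ?thesis
    unfolding chain_map_def using HX.is_complex_hom HY.is_complex_hom by simp
qed

text \<open>Composition with \<open>s\<close> is itself the homotopy. It lowers the degree by one,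
  so the parity in the differential flips and the two terms in which \<open>s\<close> is applied
  after the differential of \<open>V\<close> cancel.\<close>

lemma homotopic_hom_post:
  assumes V: "is_complex R V" and fg: "homotopic R X Y f g"
  shows "homotopic \<Z> (hom_complex R V X) (hom_complex R V Y) (hom_post R V X f) (hom_post R V X g)"
proof -
  have f: "chain_map R X Y f" and g: "chain_map R X Y g" using fg by (auto simp: homotopic_def)
  interpret f: cmap R X Y f using f by (simp add: chain_map_iff)
  interpret g: cmap R X Y g using g by (simp add: chain_map_iff)
  interpret HX: hom_cpx R V X by unfold_locales (fact V)
  interpret HY: hom_cpx R V Y by unfold_locales
  obtain s where s: "\<And>n. s n \<in> lhom R (obj X n) (obj Y (n - 1))"
    "\<And>n x. x \<in> carrier (obj X n) \<Longrightarrow> f n x = g n x \<oplus>\<^bsub>obj Y n\<^esub>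
               (dif Y (n - 1) (s n x) \<oplus>\<^bsub>obj Y n\<^esub> s (n + 1) (dif X n x))"
    using homotopicD[OF fg] by blast
  let ?S = "hom_post R V X s"
  have S: "?S n \<phi> \<in> carrier (HY.H (n - 1))" if "\<phi> \<in> carrier (HX.H n)" for n \<phi>
    using that lhom_compose[OF _ s(1) HX.X.left_module] by (simp add: hom_group_def hom_post_def add_diff_eq)
  have "?S n \<in> lhom \<Z> (HX.H n) (HY.H (n - 1))" for n
  proof (rule lhom_intI[OF HX.left_module_H HY.left_module_H _ S])
    fix \<phi> \<psi> assume *: "\<phi> \<in> carrier (HX.H n)" "\<psi> \<in> carrier (HX.H n)"
    then show "?S n (\<phi> \<oplus>\<^bsub>HX.H n\<^esub> \<psi>) = ?S n \<phi> \<oplus>\<^bsub>HY.H (n - 1)\<^esub> ?S n \<psi>"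
      by (intro HY.H_eqI[of _ "n - 1"])
        (auto simp: S HX.H_op_closed HY.H_op_closed hom_post_apply lhom_add[OF s(1)] add_diff_eq)
  qed (simp add: hom_post_def extensional_def)
  moreover have "hom_post R V X f n \<phi> = hom_post R V X g n \<phi> \<oplus>\<^bsub>HY.H n\<^esub>
      (HY.D (n - 1) (?S n \<phi>) \<oplus>\<^bsub>HY.H n\<^esub> ?S (n + 1) (HX.D n \<phi>))" if \<phi>: "\<phi> \<in> carrier (HX.H n)" for n \<phi>
  proof (rule HY.H_eqI[of _ n])
    have c: "HY.D (n - 1) (?S n \<phi>) \<in> carrier (HY.H n)" "?S (n + 1) (HX.D n \<phi>) \<in> carrier (HY.H n)"
      using HY.D_closed[OF S[OF \<phi>]] S[OF HX.D_closed[OF \<phi>]] by auto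
    then show "hom_post R V X f n \<phi> \<in> carrier (HY.H n)"
      "hom_post R V X g n \<phi> \<oplus>\<^bsub>HY.H n\<^esub> (HY.D (n - 1) (?S n \<phi>) \<oplus>\<^bsub>HY.H n\<^esub> ?S (n + 1) (HX.D n \<phi>)) \<in> carrier (HY.H n)"
      using \<phi> by (auto intro!: hom_post_closed[OF V f] hom_post_closed[OF V g] HY.H_op_closed)
    fix p x assume x: "x \<in> carrier (obj V p)"
    have ix: "p + (n + 1) = p + n + 1" "p + 1 + n = p + n + 1" "p + (n - 1) = p + n - 1" "p + 1 + (n - 1) = p + n" by auto
    let ?d = "dif X (p + n) (\<phi> p x)" and ?e = "\<phi> (p + 1) (dif V p x)"
    have e: "?d \<in> carrier (obj X (p + n + 1))" "?e \<in> carrier (obj X (p + n + 1))"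
      using \<phi> x by simp_all
    have s1: "s (p + n + 1) \<in> lhom R (obj X (p + n + 1)) (obj Y (p + n))" using s(1)[of "p + n + 1"] by simp
    note sc = lhom_closed[OF s1 e(1)] lhom_closed[OF s1 e(2)]
    have dc: "dif Y (p + n - 1) (s (p + n) (\<phi> p x)) \<in> carrier (obj Y (p + n))"
      using \<phi> x lhom_closed[OF s(1)] by (intro f.Y.dif_closed) auto
    have "HY.D (n - 1) (?S n \<phi>) p x = (if even n
       then dif Y (p + n - 1) (s (p + n) (\<phi> p x)) \<oplus>\<^bsub>obj Y (p + n)\<^esub> s (p + n + 1) ?e
       else dif Y (p + n - 1) (s (p + n) (\<phi> p x)) \<ominus>\<^bsub>obj Y (p + n)\<^esub> s (p + n + 1) ?e)"
      using x S[OF \<phi>] \<phi> by (simp add: HY.D_apply hom_post_apply ix)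
    moreover have "?S (n + 1) (HX.D n \<phi>) p x = (if even n
       then s (p + n + 1) ?d \<ominus>\<^bsub>obj Y (p + n)\<^esub> s (p + n + 1) ?e
       else s (p + n + 1) ?d \<oplus>\<^bsub>obj Y (p + n)\<^esub> s (p + n + 1) ?e)"
      using x \<phi> HX.D_closed[OF \<phi>] e
      by (simp add: hom_post_apply HX.D_apply ix lhom_add[OF s1] lhom_minus[OF s1])
    ultimately show "hom_post R V X f n \<phi> p x =
      (hom_post R V X g n \<phi> \<oplus>\<^bsub>HY.H n\<^esub> (HY.D (n - 1) (?S n \<phi>) \<oplus>\<^bsub>HY.H n\<^esub> ?S (n + 1) (HX.D n \<phi>))) p x"
      using x \<phi> sc dc s(2)[of "\<phi> p x" "p + n"]
      by (simp add: hom_post_apply a_minus_def f.Y.g.a_ac f.Y.g.r_neg f.Y.g.r_neg1 f.Y.g.r_neg2 f.Y.a_cancel f.Y.a_cancel2)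
  qed
  ultimately show ?thesis
    unfolding homotopic_def using chain_map_hom_post[OF V f] chain_map_hom_post[OF V g]
    by (auto intro!: exI[of _ ?S])
qed

lemma hom_post_comp:
  assumes V: "is_complex R V" and f: "chain_map R X Y f"
  shows "comp_map (hom_complex R V X) (hom_post R V Y g) (hom_post R V X f) = hom_post R V X (comp_map X g f)"
proof (intro ext)
  fix n \<phi> p x
  interpret f: cmap R X Y f using f by (simp add: chain_map_iff)
  interpret HX: hom_cpx R V X by unfold_locales (fact V)
  have "hom_post R V X f n \<phi> \<in> carrier (hom_group R V Y n)" if "\<phi> \<in> carrier (hom_group R V X n)"
    by (rule hom_post_closed[OF V f that])
  then show "comp_map (hom_complex R V X) (hom_post R V Y g) (hom_post R V X f) n \<phi> p x = hom_post R V X (comp_map X g f) n \<phi> p x"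
    by (auto simp: comp_map_def hom_post_def compose_def)
qed

lemma hom_post_id:
  assumes V: "is_complex R V" and X: "is_complex R X"
  shows "hom_post R V X (id_map X) = id_map (hom_complex R V X)"
proof (intro ext)
  fix n \<phi> p x
  interpret HX: hom_cpx R V X by unfold_locales (fact V X)+
  show "hom_post R V X (id_map X) n \<phi> p x = id_map (hom_complex R V X) n \<phi> p x"
  proof (cases "\<phi> \<in> carrier (HX.H n)")
    case True
    have "\<phi> p \<in> extensional (carrier (obj V p))"
      by (rule lhom_extensional[OF HX.H_lhom[OF True refl]])
    with True show ?thesis
      by (cases "x \<in> carrier (obj V p)") (auto simp: hom_post_def compose_def id_map_def extensional_def)
  qed (simp add: hom_post_def id_map_def)
qed

lemma homotopy_equivalence_cohomology_bij:
  assumes f: "chain_map R X Y f" and g: "chain_map R Y X g"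
    and gf: "homotopic R X X (comp_map X g f) (id_map X)"
    and fg: "homotopic R Y Y (comp_map Y f g) (id_map Y)"
  shows "cohomology_bij X Y f"
proof -
  interpret f: cmap R X Y f using f by (simp add: chain_map_iff)
  interpret g: cmap R Y X g using g by (simp add: chain_map_iff)
  have 1: "\<exists>b\<in>coboundaries X n. g n (f n x) = x \<oplus>\<^bsub>obj X n\<^esub> b" if "x \<in> cocycles X n" for n x
    using homotopic_cocycle[OF gf that] f.X.cocyclesD[OF that] by (auto simp: comp_map_def compose_def id_map_def)
  have 2: "\<exists>b\<in>coboundaries Y n. f n (g n x) = x \<oplus>\<^bsub>obj Y n\<^esub> b" if "x \<in> cocycles Y n" for n x
    using homotopic_cocycle[OF fg that] f.Y.cocyclesD[OF that] by (auto simp: comp_map_def compose_def id_map_def)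
  show ?thesis
    unfolding cohomology_bij_def
  proof (intro allI conjI ballI impI)
    fix n x assume x: "x \<in> cocycles X n" "f n x \<in> coboundaries Y n"
    obtain b where b: "b \<in> coboundaries X n" "g n (f n x) = x \<oplus>\<^bsub>obj X n\<^esub> b" using 1[OF x(1)] by blast
    have "x = g n (f n x) \<ominus>\<^bsub>obj X n\<^esub> b"
      using b f.X.coboundaries_closed f.X.cocyclesD[OF x(1)] by (simp add: a_minus_def f.X.g.a_assoc f.X.g.r_neg)
    then show "x \<in> coboundaries X n"
      using g.map_coboundaries[OF x(2)] b(1) f.X.coboundaries_minus by metis
  next
    fix n y assume y: "y \<in> cocycles Y n"
    obtain b where b: "b \<in> coboundaries Y n" "f n (g n y) = y \<oplus>\<^bsub>obj Y n\<^esub> b" using 2[OF y] by blast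
    have "y = f n (g n y) \<oplus>\<^bsub>obj Y n\<^esub> \<ominus>\<^bsub>obj Y n\<^esub> b"
      using b f.Y.coboundaries_closed f.Y.cocyclesD[OF y] by (simp add: f.Y.g.a_assoc f.Y.g.r_neg)
    then show "\<exists>x\<in>cocycles X n. \<exists>b\<in>coboundaries Y n. y = f n x \<oplus>\<^bsub>obj Y n\<^esub> b"
      using g.map_cocycles[OF y] f.Y.coboundaries_neg[OF b(1)] by blast
  qed
qed

section \<open>Quasi-isomorphisms in the derived category\<close>

lemma comp_map_id_right: "chain_map R X Y f \<Longrightarrow> comp_map X f (id_map X) = f"
  by (rule ext, rule extensionalityI[of _ "carrier (obj X _)"])
    (auto simp: comp_map_def id_map_def compose_def chain_map_def intro: lhom_extensional)

lemma comp_map_id_left: "chain_map R X Y f \<Longrightarrow> comp_map X (id_map Y) f = f"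
  by (rule ext, rule extensionalityI[of _ "carrier (obj X _)"])
    (auto simp: comp_map_def id_map_def compose_def chain_map_def intro: lhom_extensional dest: lhom_closed)

text \<open>The inverse is the roof with apex \<open>X\<close>, left leg \<open>f\<close> and right
  leg the identity; its left leg is allowed because \<open>f\<close> is a quasi-isomorphism.\<close>

lemma quasi_iso_derived_iso:
  assumes "quasi_iso R X Y f"
  shows "derived_iso R X Y f"
proof -
  have f: "chain_map R X Y f" using assms by (simp add: quasi_iso_def)
  note X = chain_map_cpx(1)[OF f] and Y = chain_map_cpx(2)[OF f]
  have qX: "quasi_iso R X X (id_map X)" and qY: "quasi_iso R Y Y (id_map Y)"
    using X Y by (simp_all add: quasi_iso_iff chain_map_id cohomology_bij_id)
  note [simp] = comp_map_id_right[OF f] comp_map_id_left[OF f] comp_map_id_right[OF chain_map_id[OF X]]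
    chain_map_id[OF X] chain_map_id[OF Y] homotopic_refl[OF f] homotopic_refl[OF chain_map_id[OF X]] qX qY assms f
  have "roof_composite R X Y X (roof_of_map X f) (X, f, id_map X) (X, id_map X, id_map X)"
    unfolding roof_composite_def roof_of_map_def is_roof_def prod.case
    by (intro conjI exI[of _ X] exI[of _ "id_map X"]) simp_all
  moreover have "roof_equiv R X X (X, id_map X, id_map X) (roof_of_map X (id_map X))"
    unfolding roof_equiv_def roof_of_map_def is_roof_def prod.case
    by (intro conjI exI[of _ X] exI[of _ "id_map X"]) simp_all
  moreover have "roof_composite R Y X Y (X, f, id_map X) (roof_of_map X f) (X, f, f)"
    unfolding roof_composite_def roof_of_map_def is_roof_def prod.case
    by (intro conjI exI[of _ X] exI[of _ "id_map X"]) simp_all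
  \<comment> \<open>The common refinement has apex \<open>X\<close>, mapped identically to the first
    roof and by \<open>f\<close> to the identity roof of \<open>Y\<close>.\<close>
  moreover have "roof_equiv R Y Y (X, f, f) (roof_of_map Y (id_map Y))"
    unfolding roof_equiv_def roof_of_map_def is_roof_def prod.case
    by (intro conjI exI[of _ X] exI[of _ "id_map X"] exI[of _ f]) simp_all
  moreover have "is_roof R Y X (X, f, id_map X)"
    by (simp add: is_roof_def)
  ultimately show ?thesis
    unfolding derived_iso_def using f by blast
qed

section \<open>Condition (R)\<close>

lemma (in ring_epi) a_inv_coinduced:
  assumes M: "left_module A M" and x: "x \<in> carrier (coinduced M)"
  shows "\<ominus>\<^bsub>coinduced M\<^esub> x = \<ominus>\<^bsub>M\<^esub> x"
proof -
  interpret M: left_module A M by fact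
  interpret N: left_module B "coinduced M" by (rule left_module_coinduced[OF M])
  have "\<ominus>\<^bsub>coinduced M\<^esub> x \<in> carrier (coinduced M)" using x by (rule N.M.a_inv_closed)
  then show ?thesis
    using N.M.l_neg[OF x] x by (intro sym[OF M.M.minus_equality]) auto
qed

text \<open>The adjunction for whole Hom complexes, again as equalities. The action of the integers
  is left out of the comparison; where linearity over \<open>\<Z>\<close> is needed, it is recovered
  from additivity by \<open>lhom_intI\<close>.\<close>

lemma (in ring_epi) hom_group_coinduced:
  assumes V: "is_complex B V" and J: "is_complex A J"
  shows "carrier (hom_group A (restrict_scalars_complex h V) J n) = carrier (hom_group B V (coinduced_complex J) n)"
    "\<zero>\<^bsub>hom_group A (restrict_scalars_complex h V) J n\<^esub> = \<zero>\<^bsub>hom_group B V (coinduced_complex J) n\<^esub>"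
    "add (hom_group A (restrict_scalars_complex h V) J n) = add (hom_group B V (coinduced_complex J) n)"
    "dif (hom_complex A (restrict_scalars_complex h V) J) n = dif (hom_complex B V (coinduced_complex J)) n"
proof -
  let ?V = "restrict_scalars_complex h V" and ?J = "coinduced_complex J"
  interpret V: cpx B V by unfold_locales fact
  interpret VA: cpx A ?V by unfold_locales (rule is_complex_restrict_scalars[OF V])
  interpret J: cpx A J by unfold_locales fact
  interpret J': cpx B ?J by unfold_locales (rule is_complex_coinduced[OF J])
  interpret HA: hom_cpx A ?V J ..
  interpret HB: hom_cpx B V ?J ..
  show carr: "carrier (hom_group A ?V J n) = carrier (hom_group B V ?J n)" for n
    using lhom_coinduced[OF V.left_module J.left_module] by (simp add: hom_group_def)
  show "\<zero>\<^bsub>hom_group A ?V J n\<^esub> = \<zero>\<^bsub>hom_group B V ?J n\<^esub>"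
    "add (hom_group A ?V J n) = add (hom_group B V ?J n)"
    by (simp_all add: hom_group_def)
  have "HA.D n \<phi> = HB.D n \<phi>" if \<phi>: "\<phi> \<in> carrier (HB.H n)" for \<phi>
  proof (rule HB.H_eqI[OF _ HB.D_closed[OF \<phi>]])
    have \<phi>A: "\<phi> \<in> carrier (HA.H n)" using \<phi> carr by simp
    then show "HA.D n \<phi> \<in> carrier (HB.H (n + 1))" using HA.D_closed carr by simp
    fix p x assume x: "x \<in> carrier (obj V p)"
    have "\<phi> p x \<in> carrier (coinduced (obj J (p + n)))" "\<phi> (p + 1) (dif V p x) \<in> carrier (coinduced (obj J (p + n + 1)))"
      using HB.H_closed1[OF \<phi> x] HB.H_closed2[OF \<phi> V.dif_closed1[OF x]] by (simp_all only: obj_coinduced)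
    then show "HA.D n \<phi> p x = HB.D n \<phi> p x"
      using HA.D_apply[OF \<phi>A, of x p] HB.D_apply[OF \<phi> x] x
      by (simp del: coinduced_simps(1) add: dif_coinduced a_minus_def a_inv_coinduced[OF J.left_module])
  qed
  then show "dif (hom_complex A ?V J) n = dif (hom_complex B V ?J) n"
    using HA.D_extensional[of n] HB.D_extensional[of n] carr[of n]
    by (intro extensionalityI[of "HA.D n" "carrier (HB.H n)" "HB.D n"]) simp_all
qed

lemma (in ring_epi) quasi_iso_hom_coinduced:
  assumes V: "is_complex B V" and J: "is_complex A J"
    and f: "quasi_iso \<Z> X (hom_complex B V (coinduced_complex J)) f"
  shows "quasi_iso \<Z> X (hom_complex A (restrict_scalars_complex h V) J) f"
proof -
  let ?V = "restrict_scalars_complex h V" and ?J = "coinduced_complex J"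
  interpret HA: hom_cpx A ?V J by unfold_locales (fact is_complex_restrict_scalars[OF V] J)+
  note eq = hom_group_coinduced[OF V J]
  have cm: "chain_map \<Z> X (hom_complex B V ?J) f" and bij: "cohomology_bij X (hom_complex B V ?J) f"
    using f by (simp_all add: quasi_iso_iff)
  interpret f: cmap \<Z> X "hom_complex B V ?J" f using cm by (simp add: chain_map_iff)
  have "f n \<in> lhom \<Z> (obj X n) (HA.H n)" for n
    using f.map_lhom[of n] HA.left_module_H f.X.left_module[of n]
    by (intro lhom_intI) (auto simp: eq lhom_extensional lhom_closed lhom_add)
  then have "chain_map \<Z> X (hom_complex A ?V J) f"
    unfolding chain_map_def using f.X.is_complex HA.is_complex_hom f.map_dif by (simp add: eq)
  moreover have "cocycles (hom_complex A ?V J) = cocycles (hom_complex B V ?J)"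
    "coboundaries (hom_complex A ?V J) = coboundaries (hom_complex B V ?J)"
    by (simp_all add: cocycles_def coboundaries_def eq fun_eq_iff)
  ultimately show ?thesis
    using bij by (simp add: quasi_iso_iff cohomology_bij_def eq)
qed

text \<open>All comparison maps are treated alike, since the argument uses of \<open>c\<close> only
  that it is a chain map whose composite with \<open>i2\<close> is homotopic to
  \<open>i1\<close>.\<close>

lemma (in ring_epi) condition_R_of_resolution:
  fixes P :: "nat \<Rightarrow> ('a, 'u) module"
  assumes inf: "infinite (UNIV :: 'u set)"
    and res: "finite_projective_resolution A BA n P d e"
    and hom0: "\<And>j (V :: ('b, 'u) module). j > 0 \<Longrightarrow> left_module B V \<Longrightarrow>
       lhom A (P j) (restrict_scalars h V) = {\<lambda>x\<in>carrier (P j). \<zero>\<^bsub>V\<^esub>}"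
  shows "condition_R TYPE('u) A B h"
  unfolding condition_R_def
proof (intro allI impI; elim conjE)
  obtain b :: "'u \<times> 'u \<Rightarrow> 'u" where "bij b"
    \<comment> \<open>An infinite type is in bijection with its square; this bijection is the
      pairing with which the mapping fibres are formed.\<close>
    using card_of_Times_same_infinite[OF inf] card_of_ordIso[of "UNIV \<times> UNIV :: ('u \<times> 'u) set" "UNIV :: 'u set"] by auto
  then have pairing: "pairing (\<lambda>x y. b (x, y)) (\<lambda>z. fst (inv_into UNIV b z)) (\<lambda>z. snd (inv_into UNIV b z))"
    by unfold_locales (simp_all add: bij_is_inj bij_is_surj surj_f_inv_f)
  interpret pairing "\<lambda>x y. b (x, y)" "\<lambda>z. fst (inv_into UNIV b z)" "\<lambda>z. snd (inv_into UNIV b z)" by (rule pairing)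
  fix V W :: "('b, 'u) cochain_complex" and J2 i2 J1 i1
  assume V: "is_complex B V" and W: "is_complex B W"
    and r2: "K_injective_resolution B W J2 i2"
    and r1: "K_injective_resolution A (restrict_scalars_complex h W) J1 i1"
  let ?W = "restrict_scalars_complex h W" and ?J2 = "restrict_scalars_complex h J2"
  let ?J1 = "coinduced_complex J1"
  have n2: "null_from_acyclic B J2" and q2: "quasi_iso B W J2 i2"
    using r2 by (auto simp: K_injective_resolution_def K_injective_null_from_acyclic)
  have n1: "null_from_acyclic A J1" and q1: "quasi_iso A ?W J1 i1"
    using r1 by (auto simp: K_injective_resolution_def K_injective_null_from_acyclic)
  have n1': "null_from_acyclic B ?J1" by (rule null_from_acyclic_coinduced[OF n1])
  have m1: "chain_map A ?W J1 i1" and m2: "chain_map B W J2 i2"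
    using q1 q2 by (simp_all add: quasi_iso_def)
  have J1: "is_complex A J1" and J2: "is_complex B J2"
    using m1 m2 by (simp_all add: chain_map_def)
  have bij1: "cohomology_bij W ?J1 i1"
    by (rule cohomology_bij_coinduced[OF pairing W n1 q1 res hom0])
  have m1': "chain_map B W ?J1 i1" by (rule chain_map_coinduced[OF W m1])
  show "(\<exists>c. comparison_map A h W (J2, i2) (J1, i1) c) \<and>
     (\<forall>c. comparison_map A h W (J2, i2) (J1, i1) c \<longrightarrow>
        derived_iso \<Z> (RHom B V (J2, i2)) (RHom A (restrict_scalars_complex h V) (J1, i1))
          (natural_RHom_map B V (J2, i2) c))"
  proof (intro conjI allI impI)
    obtain c where "chain_map A ?J2 J1 c" "homotopic A ?W J1 (comp_map ?W c i2) i1"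
      using extend_along_quasi_iso[OF n1 quasi_iso_restrict_scalars[OF q2] m1] by blast
    then show "\<exists>c. comparison_map A h W (J2, i2) (J1, i1) c"
      by (auto simp: comparison_map_def)
  next
    fix c assume "comparison_map A h W (J2, i2) (J1, i1) c"
    then have c: "chain_map A ?J2 J1 c" and ci: "homotopic A ?W J1 (comp_map W c i2) i1"
      by (auto simp: comparison_map_def)
    have c': "chain_map B J2 ?J1 c" by (rule chain_map_coinduced[OF J2 c])
    \<comment> \<open>Both resolutions start at \<open>W\<close>, and \<open>i1\<close> is a
      quasi-isomorphism into the coinduced complex, so two out of three applies to the triangle
      formed by \<open>i2\<close>, \<open>c\<close> and \<open>i1\<close>.\<close>
    have "cohomology_bij J2 ?J1 c"
      using cohomology_bij_cancel[OF m2 _ c' m1' bij1 homotopic_coinduced[OF W ci]] q2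
      by (simp add: quasi_iso_iff)
    then have qc: "quasi_iso B J2 ?J1 c" using c' by (simp add: quasi_iso_iff)
    \<comment> \<open>A left inverse up to homotopy: the identity of \<open>J2\<close> is extended
      along the quasi-isomorphism \<open>c\<close>.\<close>
    obtain g where g: "chain_map B ?J1 J2 g" "homotopic B J2 J2 (comp_map J2 g c) (id_map J2)"
      using extend_along_quasi_iso[OF n2 qc chain_map_id[OF J2]] by blast
    have "cohomology_bij ?J1 J2 g"
      using cohomology_bij_cancel[OF c' _ g(1) chain_map_id[OF J2] cohomology_bij_id[OF J2] g(2)] qc
      by (simp add: quasi_iso_iff)
    then have qg: "quasi_iso B ?J1 J2 g" using g by (simp add: quasi_iso_iff)
    \<comment> \<open>The same construction applied to \<open>g\<close> gives \<open>g\<close> a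
      left inverse as well, which upgrades \<open>g\<close> to a two-sided homotopy inverse of
      \<open>c\<close>. A quasi-isomorphism alone would not be preserved by Hom(V, -).\<close>
    obtain k where k: "chain_map B J2 ?J1 k" "homotopic B ?J1 ?J1 (comp_map ?J1 k g) (id_map ?J1)"
      using extend_along_quasi_iso[OF n1' qg chain_map_id[OF chain_map_cpx(2)[OF c']]] by blast
    have cg: "homotopic B ?J1 ?J1 (comp_map ?J1 c g) (id_map ?J1)"
      by (rule homotopy_inverse[OF c' g(1) k(1) g(2) k(2)])
    note post = chain_map_hom_post[OF V]
    have "cohomology_bij (hom_complex B V J2) (hom_complex B V ?J1) (hom_post B V J2 c)"
      using homotopy_equivalence_cohomology_bij[OF post[OF c'] post[OF g(1)]]
        homotopic_hom_post[OF V g(2)] homotopic_hom_post[OF V cg]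
      by (simp add: hom_post_comp[OF V c'] hom_post_comp[OF V g(1)] hom_post_id[OF V J2]
          hom_post_id[OF V chain_map_cpx(2)[OF c']])
    then have "quasi_iso \<Z> (hom_complex B V J2) (hom_complex B V ?J1) (hom_post B V J2 c)"
      using post[OF c'] by (simp add: quasi_iso_iff)
    from quasi_iso_hom_coinduced[OF V J1 this]
    show "derived_iso \<Z> (RHom B V (J2, i2)) (RHom A (restrict_scalars_complex h V) (J1, i1))
          (natural_RHom_map B V (J2, i2) c)"
      by (simp add: RHom_def natural_RHom_map_def hom_post_def quasi_iso_derived_iso)
  qed
qed

theorem corollary8:
  fixes A :: "('a, 'c) ring_scheme" and I :: "'a set"
    and n :: nat and P :: "nat \<Rightarrow> ('a, 'u) module" and d :: "nat \<Rightarrow> 'u \<Rightarrow> 'u"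
    and e :: "'u \<Rightarrow> 'a set"
  assumes "infinite (UNIV :: 'u set)"
    and "ring A" and "ideal I A"
    and "finite_projective_resolution A
           (restrict_scalars (\<lambda>a. I +>\<^bsub>A\<^esub> a) (regular_module (A Quot I))) n P d e"
    and "\<And>j (V :: ('a set, 'u) module). j > 0 \<Longrightarrow> left_module (A Quot I) V \<Longrightarrow>
           lhom A (P j) (restrict_scalars (\<lambda>a. I +>\<^bsub>A\<^esub> a) V) = {\<lambda>x\<in>carrier (P j). \<zero>\<^bsub>V\<^esub>}"
  shows "condition_R TYPE('u) A (A Quot I) (\<lambda>a. I +>\<^bsub>A\<^esub> a)"
proof -
  interpret I: ideal I A by fact
  interpret Q: ring "A Quot I" by (rule I.quotient_is_ring)
  interpret ring_epi A "A Quot I" "\<lambda>a. I +>\<^bsub>A\<^esub> a"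
  proof
    show "(\<lambda>a. I +>\<^bsub>A\<^esub> a) \<in> ring_hom A (A Quot I)" by (rule I.rcos_ring_hom)
    show "(\<lambda>a. I +>\<^bsub>A\<^esub> a) ` carrier A = carrier (A Quot I)"
      by (auto simp: FactRing_def A_RCOSETS_def')
  qed
  show ?thesis by (rule condition_R_of_resolution[OF assms(1,4,5)])
qed

end
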